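(* Let $K$ be a quadratic field, let $c \in K$, and let $f_c(z) = z^2+c$. Then $f_c$ admits a point $\alpha \in K$ of (exact) period $4$ if and only if there exist $u, v \in K$ with $v^2 = -u(u^2+1)(u^2-2u-1)$ and $v(u+1)(u-1) \neq 0$ such that \[ \alpha = \frac{u-1}{2(u+1)} + \frac{v}{2u(u-1)}, \qquad c = \frac{(u^2-4u-1)(u^4+u^3+2u^2-u+1)}{4u(u+1)^2(u-1)^2}. \] In this case there are precisely four points of $K$ of period $4$ for $f_c$, and they form a single $4$-cycle: \[ \alpha = \frac{u-1}{2(u+1)} + \frac{v}{2u(u-1)},\quad f_c(\alpha) = -\frac{u+1}{2(u-1)} + \frac{v}{2u(u+1)}, \] \[ f_c^2(\alpha) = \frac{u-1}{2(u+1)} - \frac{v}{2u(u-1)},\quad f_c^3(\alpha) = -\frac{u+1}{2(u-1)} - \frac{v}{2u(u+1)}. \] Moreover, $c \in \mathbb{Q}$, and $\alpha$ and $f_c^2(\alpha)$ are Galois conjugates over $\mathbb{Q}$.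
   Context: A point $x$ has (exact) period $N$ for $f_c$ if $f_c^N(x) = x$ and $f_c^n(x) \neq x$ for $0 < n < N$. *)

theory Defs
  imports Complex_Main
begin

text \<open>
  Number fields are represented as subfields \<open>K\<close> of an arbitrary ambient field of
  characteristic zero; the field of rational numbers is then the library set \<open>\<rat>\<close>.
  The ambient field is a parameter, so it may be the complex numbers or \<open>K\<close> itself.
\<close>

definition is_subfield :: "'a::field_char_0 set \<Rightarrow> bool" where
  "is_subfield K \<longleftrightarrow>
     0 \<in> K \<and> 1 \<in> K \<and>
     (\<forall>x\<in>K. \<forall>y\<in>K. x + y \<in> K) \<and> (\<forall>x\<in>K. - x \<in> K) \<and>
     (\<forall>x\<in>K. \<forall>y\<in>K. x * y \<in> K) \<and> (\<forall>x\<in>K. inverse x \<in> K)"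

definition rat_scale :: "rat \<Rightarrow> 'a::field_char_0 \<Rightarrow> 'a" where
  "rat_scale q x = of_rat q * x"

lemma vector_space_rat_scale: "vector_space (rat_scale :: rat \<Rightarrow> 'a::field_char_0 \<Rightarrow> 'a)"
  by unfold_locales (simp_all add: rat_scale_def algebra_simps of_rat_add of_rat_mult)

text \<open>
  The library's \<open>dim\<close> is \<open>0\<close> for infinite-dimensional spaces, so the equation below
  does include finite-dimensionality.
\<close>

definition quadratic_field :: "'a::field_char_0 set \<Rightarrow> bool" where
  "quadratic_field K \<longleftrightarrow> is_subfield K \<and> vector_space.dim rat_scale K = 2"

definition rat_automorphism :: "'a::field_char_0 set \<Rightarrow> ('a \<Rightarrow> 'a) \<Rightarrow> bool" where
  "rat_automorphism K \<sigma> \<longleftrightarrow>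
     bij_betw \<sigma> K K \<and>
     (\<forall>x\<in>K. \<forall>y\<in>K. \<sigma> (x + y) = \<sigma> x + \<sigma> y \<and> \<sigma> (x * y) = \<sigma> x * \<sigma> y) \<and>
     (\<forall>q\<in>\<rat>. \<sigma> q = q)"

text \<open>Used for \<open>K\<close> quadratic, hence Galois, over the rationals.\<close>

definition galois_conjugate :: "'a::field_char_0 set \<Rightarrow> 'a \<Rightarrow> 'a \<Rightarrow> bool" where
  "galois_conjugate K x y \<longleftrightarrow> x \<in> K \<and> y \<in> K \<and> (\<exists>\<sigma>. rat_automorphism K \<sigma> \<and> \<sigma> x = y)"

definition has_exact_period :: "('a \<Rightarrow> 'a) \<Rightarrow> nat \<Rightarrow> 'a \<Rightarrow> bool" where
  "has_exact_period f N x \<longleftrightarrow>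
     0 < N \<and> (f ^^ N) x = x \<and> (\<forall>n. 0 < n \<and> n < N \<longrightarrow> (f ^^ n) x \<noteq> x)"

definition quad_map :: "'a::field_char_0 \<Rightarrow> 'a \<Rightarrow> 'a" where
  "quad_map c z = z ^ 2 + c"

end

theory Submission imports Defs "HOL-Computational_Algebra.Nth_Powers"
begin

text \<open>
  A cycle of length 4 corresponds to an orbit of the automorphism \<open>\<sigma>(u, v) = (-1/u, v/u^3)\<close> on
  the curve of genus 2 given by \<open>v^2 = -u (u^2+1) (u^2-2u-1)\<close>; here \<open>\<sigma>\<close> has order 4, and its
  square is the hyperelliptic involution. The crucial point is that a point with
  \<open>v \<noteq> 0\<close> over a quadratic field has a rational \<open>u\<close>; as the curve has no rational points except those with \<open>u \<in> {0, 1, -1}\<close>, conjugation over the rationals then maps \<open>v\<close> to \<open>-v\<close>.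

  If \<open>u\<close> is a root of an irreducible \<open>x^2 - s x + p\<close> and \<open>v = b1 u + b0\<close>, then the point and its
  conjugate together define a rational point of the Jacobian. Descent for the isogeny
  \<open>1 - \<sigma>\<close> is carried out with explicit coordinates \<open>(n : m : B : j)\<close> on the Kummer surface.
  After one application of \<open>1 - \<sigma>\<close> to a rational point,
  a preimage of the same kind exists again and is given by closed formulas, so one obtains an infinite
  chain of preimages. On the other hand \<open>1 - \<sigma>\<close> contracts 2-adically, hence a point with such a
  chain is the origin or a torsion point. The degenerate points on the way are handled by Fermat's
  theorems on \<open>x^4 \<plusminus> y^4 = z^2\<close>.

  Finally \<open>c\<close> is a function of \<open>t = u - 1/u\<close>. Two distinct rational \<open>t\<close> with the same \<open>c\<close> lead to a
  rational point on \<open>w^2 = q^4 + 4(q-1)^2\<close>, and this curve is treated by one more descent of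
  Fermat's type.
\<close>

text \<open>On the Jacobian \<sigma>^2 = -1, so \<open>1 - \<sigma>\<close> acts as 1 - i: its
  square is -2\<sigma> and its degree is 4. The substitution u -> -1/u preserves each of the pairs
  {0, infinity}, {i, -i}, {1 + sqrt 2, 1 - sqrt 2} of branch points, so its kernel consists of the
  origin and the three classes attached to these pairs, all rational. This is why square classes of
  rational numbers suffice, without arithmetic in Q(i) or Q(sqrt 2). The coordinates
  \<open>n\<close>, \<open>m\<close> are chosen so that \<sigma> only changes the signs of
  \<open>m\<close> and \<open>B\<close>.

  The chain of preimages together with the 2-adic contraction takes the place of heights and of
  finite generation. The price of the Kummer surface is a lost sign: a rational point on it may come
  from a quadratic twist, so each preimage must be shown to have again a nonzero square as its value
  of \<open>Q1\<close>.

  The link with dynamics is that \<open>quad_map c\<close> carries the point with parameters (u, v)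
  to the one with parameters \<sigma>(u, v); t = u - 1/u is invariant under this and thus labels the
  cycle.\<close>

section \<open>Three quartic equations\<close>

lemma coprime_mult_square_int:
  fixes a b c :: int
  assumes "coprime a b" "a * b = c^2" "a \<ge> 0"
  shows "\<exists>x. a = x^2"
proof (cases "c = 0")
  case True
  then have "a = 0 \<or> a = 1" using assms by auto
  then show ?thesis by (metis power2_eq_square mult_zero_left mult_1)
next
  case False
  then have pos: "b > 0" using assms by (metis mult_eq_0_iff order_le_less zero_less_mult_pos zero_less_power2)
  have "nat a * nat b = (nat \<bar>c\<bar>)^2"
    using assms pos by (metis nat_mult_distrib nat_power_eq power2_abs abs_ge_zero)
  moreover have "coprime (nat a) (nat b)"
    using assms(1,3) pos by (simp add: coprime_int_iff [symmetric])
  ultimately have "is_nth_power 2 (nat a)"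
    by (metis is_nth_powerI is_nth_power_mult_coprime_natD(1) assms(2,3) False pos nat_0_iff mult_eq_0_iff zero_neq_numeral zero_less_nat_eq bot_nat_0.not_eq_extremum)
  then obtain y where "nat a = y^2" by (auto simp: is_nth_power_def)
  then have "a = (int y)^2" using assms(3) by (metis int_nat_eq of_nat_power)
  then show ?thesis by blast
qed

lemma primitive_pythagorean_int:
  fixes x y z :: int
  assumes "coprime x y" "odd x" "even y" "x^2 + y^2 = z^2"
  obtains g h where "x = g^2 - h^2" "y = 2*g*h" "\<bar>z\<bar> = g^2 + h^2" "coprime g h"
proof -
  define Z where "Z = \<bar>z\<bar>"
  have Z: "Z^2 = x^2 + y^2" "Z \<ge> 0" using assms by (auto simp: Z_def)
  then have "odd (Z^2)" using assms(2,3) by simp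
  then have oZ: "odd Z" by simp
  obtain p q where p: "Z + x = 2*p" and q: "Z - x = 2*q"
    using oZ assms(2) by (metis evenE odd_even_add even_diff)
  obtain y' where y': "y = 2*y'" using assms(3) by blast
  have pq: "p * q = y'^2"
  proof -
    have "(Z + x) * (Z - x) = y^2" using Z by (simp add: algebra_simps power2_eq_square)
    then show ?thesis unfolding p q y' by (simp add: power2_eq_square)
  qed
  have cop: "coprime p q"
  proof (rule coprimeI)
    fix d assume d: "d dvd p" "d dvd q"
    have "x = p - q" using p q by simp
    then have dx: "d dvd x" using d by simp
    have "d^2 dvd y'^2" using mult_dvd_mono[OF d] pq by (simp add: power2_eq_square)
    then have "d dvd y'" by (simp add: pow_divides_pow_iff)
    then have "d dvd y" using y' by simp
    then show "is_unit d" using dx assms(1) by (meson coprime_common_divisor)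
  qed
  have "\<bar>x\<bar> \<le> Z" using Z by (metis abs_le_square_iff abs_of_nonneg le_add_same_cancel1 zero_le_power2)
  then have nn: "p \<ge> 0" "q \<ge> 0" using p q by linarith+
  obtain g where g: "p = g^2" using coprime_mult_square_int[OF cop pq nn(1)] by blast
  obtain h where h: "q = h^2"
    using coprime_mult_square_int[of q p y'] cop pq nn(2) by (auto simp: coprime_commute mult.commute)
  have cgh: "coprime g h" using cop g h by simp
  have "y'^2 = (g*h)^2" using pq g h by (simp add: power_mult_distrib)
  then consider "y' = g*h" | "y' = g*(-h)" by (metis minus_mult_right power2_eq_iff)
  then show thesis
  proof cases
    case 1
    have "x = g^2 - h^2" "\<bar>z\<bar> = g^2 + h^2" using p q g h Z_def by auto
    then show thesis using that[of g h] 1 y' cgh by simp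
  next
    case 2
    have "x = g^2 - (-h)^2" "\<bar>z\<bar> = g^2 + (-h)^2" using p q g h Z_def by auto
    then show thesis using that[of g "-h"] 2 y' cgh by simp
  qed
qed

lemma coprime_mult_square_int_signed:
  fixes a b c :: int
  assumes "coprime a b" "a * b = c^2"
  obtains x y s where "a = s * x^2" "b = s * y^2" "s = 1 \<or> s = -1"
proof (cases "a \<ge> 0 \<and> b \<ge> 0")
  case True
  then show thesis using coprime_mult_square_int[of a b c] coprime_mult_square_int[of b a c] assms that[of 1]
    by (auto simp: coprime_commute mult.commute)
next
  case False
  have "a * b \<ge> 0" using assms by simp
  then have "-a \<ge> 0" "-b \<ge> 0" using False by (auto simp: zero_le_mult_iff)
  then obtain x y where "-a = x^2" "-b = y^2" using coprime_mult_square_int[of "-a" "-b" c] coprime_mult_square_int[of "-b" "-a" c] assms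
    by (auto simp: coprime_commute mult.commute)
  then have "a = -1 * x^2" "b = -1 * y^2" by linarith+
  then show thesis using that[of "-1" x y] by simp
qed

lemma abs_le_square_int: "\<bar>a\<bar> \<le> (a::int)^2"
proof (cases "a = 0")
  case False
  then have "\<bar>a\<bar> * 1 \<le> \<bar>a\<bar> * \<bar>a\<bar>" by (intro mult_left_mono) auto
  then show ?thesis by (simp add: power2_eq_square)
qed simp

lemma abs_less_sum_squares:
  fixes a r s :: int
  assumes "a^2 = \<bar>r\<bar>" "s \<noteq> 0"
  shows "\<bar>a\<bar> < r^2 + s^2"
proof -
  have "\<bar>a\<bar> \<le> r^2" using abs_le_square_int[of a] abs_le_square_int[of r] assms(1) by linarith
  moreover have "s^2 > 0" using assms(2) by simp
  ultimately show ?thesis by linarith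
qed

lemma coprimeI_primes_int:
  fixes a b :: int
  assumes "a \<noteq> 0" "\<And>p. prime p \<Longrightarrow> p dvd a \<Longrightarrow> p dvd b \<Longrightarrow> False"
  shows "coprime a b"
proof (rule ccontr)
  assume "\<not> coprime a b"
  then have "\<not> is_unit (gcd a b)" by (simp add: coprime_iff_gcd_eq_1)
  moreover have "gcd a b \<noteq> 0" using assms(1) by simp
  ultimately obtain p where "p dvd gcd a b" "prime p" using prime_divisor_exists[of "gcd a b"] by auto
  then show False using assms(2) by auto
qed

text \<open>Descent on |x|. For odd \<open>y\<close> one triple \<open>(y^2, z, x^2)\<close>
  suffices, because (g^2 - h^2)(g^2 + h^2) = (xy)^2. For even \<open>y\<close> it only leads to x^2
  = 4a^4 + b^4, and the second triple \<open>(b^2, 2*a^2, x)\<close> leads back to the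
  equation.\<close>

lemma fermat_minus_coprime:
  fixes x y z :: int
  assumes "coprime x y" "x^4 - y^4 = z^2"
  shows "y = 0 \<or> z = 0"
  using assms
proof (induction "nat \<bar>x\<bar>" arbitrary: x y z rule: less_induct)
  case less
  show ?case
  proof (rule ccontr)
    assume "\<not> ?thesis"
    then have nz: "y \<noteq> 0" "z \<noteq> 0" by auto
    have xz: "x \<noteq> 0"
    proof
      assume "x = 0"
      then have "x^4 = 0" by simp
      moreover have "y^4 > 0" "z^2 > 0" using nz by auto
      ultimately show False using less.prems(2) by linarith
    qed
    have eq: "z^2 + (y^2)^2 = (x^2)^2" using less.prems(2) by (simp add: algebra_simps)
    have copyz: "coprime z (y^2)"
    proof (rule coprimeI_primes_int)
      fix p assume p: "prime p" "p dvd z" "p dvd y^2"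
      then have "p dvd z^2 + (y^2)^2" by (intro dvd_add) (auto simp: power2_eq_square intro: dvd_mult)
      then have "p dvd (x^2)^2" using eq by simp
      then have "p dvd x" "p dvd y" using p by (auto dest: prime_dvd_power)
      then show False using less.prems(1) p(1) by (meson coprime_common_divisor not_prime_unit)
    qed (use nz in auto)
    show False
    proof (cases "even y")
      case False
      have "even z"
      proof (rule ccontr)
        assume "odd z"
        then obtain a b where "z = 2*a+1" "y^2 = 2*b+1" using False by (metis oddE even_power)
        then have "(x^2)^2 = 4*(a^2+a+b^2+b) + 2" using eq by (simp add: algebra_simps power2_eq_square)
        then have "even x" by (metis even_add even_mult_iff even_numeral even_power)
        then obtain c where "x = 2*c" by blast
        then have "(x^2)^2 = 4*(4*c^4)" by (simp add: power_mult_distrib flip: power_mult)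
        then show False using \<open>(x^2)^2 = 4*(a^2+a+b^2+b) + 2\<close> by presburger
      qed
      have "coprime (y^2) z" using copyz by (simp add: coprime_commute)
      moreover have "(y^2)^2 + z^2 = (x^2)^2" using eq by simp
      ultimately obtain g h where gh: "y^2 = g^2-h^2" "z = 2*g*h" "\<bar>x^2\<bar> = g^2+h^2" "coprime g h"
        using primitive_pythagorean_int[of "y^2" z "x^2"] False \<open>even z\<close> by auto
      have x2: "x^2 = g^2+h^2" using gh(3) by simp
      have "h \<noteq> 0" using gh(2) nz by auto
      have "g^4 - h^4 = (x*y)^2" using gh(1) x2 by algebra
      moreover have "g^2 < x^2" using x2 \<open>h \<noteq> 0\<close> by simp
      then have "\<bar>g\<bar> < \<bar>x\<bar>" by (metis abs_le_square_iff not_le)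
      ultimately have "h = 0 \<or> x*y = 0" using less.hyps[of g h "x*y"] gh(4) by auto
      then show False using \<open>h\<noteq>0\<close> xz nz by simp
    next
      case True
      then have "odd x" using less.prems(1) by (meson coprime_common_divisor odd_one)
      have "even (y^2)" using True by simp
      have "odd z" using eq \<open>odd x\<close> True by (metis even_add even_power zero_less_numeral)
      then obtain g h where gh: "z = g^2-h^2" "y^2 = 2*g*h" "\<bar>x^2\<bar> = g^2+h^2" "coprime g h"
        using primitive_pythagorean_int[of z "y^2" "x^2"] copyz eq \<open>even (y^2)\<close> by blast
      have x2: "x^2 = g^2+h^2" using gh(3) by simp
      \<comment> \<open>one of \<open>g\<close>, \<open>h\<close> is \<open>\<plusminus>2a\<^sup>2\<close>, the other \<open>\<plusminus>b\<^sup>2\<close>\<close>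
      obtain a b where ab: "x^2 = 4*a^4 + b^4" "a \<noteq> 0" "coprime (2*a) b"
      proof -
        have main: "\<exists>a b. x^2 = 4*a^4 + b^4 \<and> a \<noteq> 0 \<and> coprime (2*a) b" if ev: "even u" and cop: "coprime u w" and uw: "u*w*2 = y^2" and xs: "x^2 = u^2+w^2" for u w
        proof -
          obtain u' where u': "u = 2*u'" using ev by blast
          obtain y' where y': "y = 2*y'" using True by blast
          have "u' * w = y'^2" using uw u' y' by (simp add: power2_eq_square)
          moreover have "coprime u' w" using cop u' by simp
          ultimately obtain a b s where s: "u' = s*a^2" "w = s*b^2" "s = 1 \<or> s = -1"
            using coprime_mult_square_int_signed by metis
          have s1: "s^2 = 1" using s(3) by auto
          have "x^2 = (s^2)*(4*a^4+b^4)" using xs u' s(1,2) by algebra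
          then have e: "x^2 = 4*a^4+b^4" using s1 by simp
          have "a \<noteq> 0" using uw u' s nz by auto
          moreover have "coprime (2*a) b"
            using cop s(1,2) unfolding u' by (auto simp: coprime_mult_left_iff coprime_mult_right_iff)
          ultimately show ?thesis using e by blast
        qed
        have "even g \<or> even h" using gh(1) \<open>odd z\<close> by auto
        then have "\<exists>a b. x^2 = 4*a^4 + b^4 \<and> a \<noteq> 0 \<and> coprime (2*a) b"
        proof
          assume "even g" then show ?thesis using main[of g h] gh(2,4) x2 by (simp add: algebra_simps)
        next
          assume "even h" then show ?thesis using main[of h g] gh(2,4) x2 by (simp add: algebra_simps coprime_commute)
        qed
        then show thesis using that by blast
      qed
      have ob: "odd b" using ab(3) by (simp add: coprime_mult_left_iff)
      have "coprime (b^2) (2*a^2)" using ab(3) ob by (auto simp: coprime_mult_left_iff coprime_mult_right_iff coprime_commute)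
      moreover have "(b^2)^2 + (2*a^2)^2 = x^2" using ab(1) by (simp add: power_mult_distrib)
      ultimately obtain r s where rs: "b^2 = r^2-s^2" "2*a^2 = 2*r*s" "\<bar>x\<bar> = r^2+s^2" "coprime r s"
        using primitive_pythagorean_int[of "b^2" "2*a^2" x] ob by auto
      have "r * s = a^2" using rs(2) by simp
      then obtain \<alpha> \<beta> t where t: "r = t*\<alpha>^2" "s = t*\<beta>^2" "t = 1 \<or> t = -1"
        using coprime_mult_square_int_signed rs(4) by metis
      have "s \<noteq> 0" using rs(2) ab(2) by auto
      have t2: "t^2 = 1" using t by auto
      have "b^2 = t^2*(\<alpha>^4 - \<beta>^4)" using rs(1) t(1,2) by algebra
      then have e: "\<alpha>^4-\<beta>^4 = b^2" using t2 by simp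
      have "\<alpha>^2 = \<bar>r\<bar>" using t by auto
      then have "\<bar>\<alpha>\<bar> < \<bar>x\<bar>" using abs_less_sum_squares[of \<alpha> r s] \<open>s\<noteq>0\<close> rs(3) by simp
      moreover have "coprime \<alpha> \<beta>" using rs(4) t(1,2) by (auto simp: coprime_mult_left_iff coprime_mult_right_iff)
      ultimately have "\<beta> = 0 \<or> b = 0" using less.hyps[of \<alpha> \<beta> b] e by auto
      then show False using \<open>s\<noteq>0\<close> t ob by auto
    qed
  qed
qed

lemma coprime_mult_power_int:
  fixes a b c :: int
  assumes "coprime a b" "a * b = c^k" "a > 0" "b > 0" "k > 0"
  shows "\<exists>x. a = x^k"
proof -
  have "nat a * nat b = nat \<bar>c\<bar> ^ k"
  proof -
    have "a * b = \<bar>c\<bar>^k" using assms by (metis abs_of_pos mult_pos_pos power_abs)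
    then show ?thesis using assms(3,4) by (metis nat_mult_distrib nat_power_eq abs_ge_zero less_imp_le)
  qed
  moreover have "coprime (nat a) (nat b)"
    using assms by (simp add: coprime_int_iff [symmetric])
  moreover have "nat a > 0" "nat b > 0" using assms by auto
  ultimately have "is_nth_power k (nat a)"
    using is_nth_power_mult_coprime_natD(1)[of "nat a" "nat b" k] by (auto intro: is_nth_powerI)
  then obtain y where "nat a = y^k" by (auto simp: is_nth_power_def)
  then have "a = (int y)^k" using assms(3) by (metis int_nat_eq of_nat_power less_imp_le)
  then show ?thesis by blast
qed

lemma coprime_mult_square_int_left:
  fixes a b c :: int
  assumes "coprime a b" "a * b = c^2"
  shows "\<exists>x t. a = t * x^2 \<and> (t = 1 \<or> t = -1)"
  using coprime_mult_square_int_signed[OF assms] by metis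

text \<open>Descent on |z|. Two odd terms are impossible modulo 4. Otherwise X^2 = g^2 - h^2 is
  again a triple, with parameters r, s, and g*r*s is a square with coprime factors; taking roots of
  g, r, s turns |g| = r^2 + s^2 into a smaller solution.\<close>

lemma fermat_plus_coprime:
  fixes x y z :: int
  assumes "coprime x y" "x^4 + y^4 = z^2"
  shows "x = 0 \<or> y = 0"
  using assms
proof (induction "nat \<bar>z\<bar>" arbitrary: x y z rule: less_induct)
  case less
  have main: "X = 0 \<or> Y = 0" if X: "odd X" and Y: "even Y" and cXY: "coprime X Y" and XY: "X^4 + Y^4 = z^2" for X Y
  proof (rule ccontr)
    assume "\<not> ?thesis"
    then have nz: "X \<noteq> 0" "Y \<noteq> 0" by auto
    have "coprime (X^2) (Y^2)" "odd (X^2)" "even (Y^2)" "(X^2)^2 + (Y^2)^2 = z^2"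
      using that by auto
    then obtain g h where gh: "X^2 = g^2-h^2" "Y^2 = 2*g*h" "\<bar>z\<bar> = g^2+h^2" "coprime g h"
      using primitive_pythagorean_int by blast
    have nz2: "g \<noteq> 0" "h \<noteq> 0" using gh(2) nz by auto
    have "even h"
    proof (rule ccontr)
      assume "odd h"
      moreover have "odd (g^2-h^2)" using gh(1) X by (metis even_power)
      ultimately have "even g" by simp
      then obtain g1 h1 x1 where "g = 2*g1" "h = 2*h1+1" "X = 2*x1+1" using \<open>odd h\<close> X by (metis evenE oddE)
      then have "(2*x1+1)^2 = (2*g1)^2 - (2*h1+1)^2" using gh(1) by simp
      then have "2*(x1^2+x1+h1^2+h1-g1^2)+1 = 0" by (simp add: power2_eq_square algebra_simps)
      then show False by presburger
    qed
    have "coprime X h"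
    proof (rule coprimeI_primes_int)
      fix p assume p: "prime p" "p dvd X" "p dvd h"
      have "g^2 = X^2 + h^2" using gh(1) by simp
      then have "p dvd g^2" using p by (simp add: power2_eq_square)
      then have "p dvd g" using p(1) prime_dvd_power by blast
      then show False using p gh(4) by (meson coprime_common_divisor not_prime_unit)
    qed (use nz in auto)
    moreover have "X^2 + h^2 = g^2" using gh(1) by simp
    ultimately obtain r s where rs: "X = r^2 - s^2" "h = 2*r*s" "\<bar>g\<bar> = r^2+s^2" "coprime r s"
      using primitive_pythagorean_int X \<open>even h\<close> by blast
    obtain Y' where Y': "Y = 2*Y'" using Y by blast
    have prod: "g*r*s = Y'^2" using gh(2) rs(2) Y' by (simp add: power2_eq_square)
    have crg: "coprime r g" "coprime s g" using gh(4) rs(2) by (auto simp: coprime_mult_right_iff coprime_commute)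
    have "r * (g*s) = Y'^2" "s * (g*r) = Y'^2" "g * (r*s) = Y'^2" using prod by algebra+
    moreover have "coprime r (g*s)" "coprime s (g*r)" "coprime g (r*s)"
      using crg rs(4) by (auto simp: coprime_commute)
    ultimately obtain \<alpha> t1 \<beta> t2 \<gamma> t3 where a: "r = t1*\<alpha>^2" "t1 = 1 \<or> t1 = -1"
      and b: "s = t2*\<beta>^2" "t2 = 1 \<or> t2 = -1" and c: "g = t3*\<gamma>^2" "t3 = 1 \<or> t3 = -1"
      using coprime_mult_square_int_left by metis
    have "\<alpha>^4 + \<beta>^4 = \<gamma>^2" using rs(3) a b c by (auto simp flip: power_mult)
    moreover have "coprime \<alpha> \<beta>" using rs(4) a b by auto
    moreover have "\<bar>\<gamma>\<bar> < \<bar>z\<bar>"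
      using abs_less_sum_squares[of \<gamma> g h] c nz2 gh(3) by auto
    ultimately have "\<alpha> = 0 \<or> \<beta> = 0" using less.hyps[of \<gamma> \<alpha> \<beta>] by auto
    then show False using a b rs(2) nz2 by auto
  qed
  show ?case
  proof (cases "even y")
    case True
    then have "odd x" using less.prems(1) by (meson coprime_common_divisor odd_one)
    then show ?thesis using main[of x y] True less.prems by auto
  next
    case False
    show ?thesis
    proof (cases "even x")
      case True
      then show ?thesis using main[of y x] False less.prems by (auto simp: coprime_commute add.commute)
    next
      case oddx: False
      then obtain a b where ab: "x^2 = 2*a+1" "y^2 = 2*b+1" using False by (metis oddE even_power)
      have "(x^2)^2 + (y^2)^2 = z^2" using less.prems(2) by simp
      then have e: "z^2 = 4*(a^2+a+b^2+b) + 2" using ab by algebra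
      then have "even z" by (metis even_add even_mult_iff even_numeral even_power)
      then obtain c where "z = 2*c" by blast
      then have "z^2 = 4*c^2" by (simp add: power_mult_distrib)
      then show ?thesis using e by presburger
    qed
  qed
qed

section \<open>Descent for b^4 + a^2 b^2 - a^4 = Y^2\<close>

lemma coprime_mult_5_fourth_power_int:
  fixes P Q w :: int
  assumes "coprime P Q" "P * Q = 5 * w^4" "P + Q > 0" "w \<noteq> 0"
  obtains x y where "P + Q = x^4 + 5*y^4" "w^2 = x^2 * y^2" "coprime x y" "P*Q = x^4 * (5*y^4)"
proof -
  have main: "\<exists>x y. P + Q = x^4 + 5*y^4 \<and> w^2 = x^2 * y^2 \<and> coprime x y \<and> P*Q = x^4 * (5*y^4)"
    if cPQ: "coprime P Q" and PQ: "P * Q = 5 * w^4" and s: "P + Q > 0" and five: "5 dvd Q" for P Q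
  proof -
    obtain Q' where Q': "Q = 5*Q'" using five by blast
    have "w^4 > 0" using assms(4) by simp
    then have "P * Q > 0" using PQ by simp
    then have pos: "P > 0" "Q > 0" using s by (auto simp: zero_less_mult_iff)
    have e: "P * Q' = w^4" using PQ Q' by simp
    have c: "coprime P Q'" using cPQ Q' by simp
    obtain x where x: "P = x^4" using coprime_mult_power_int[OF c e] pos Q' by auto
    obtain y where y: "Q' = y^4" using coprime_mult_power_int[of Q' P w 4] c e pos Q' by (auto simp: coprime_commute mult.commute)
    have "(w^2)^2 = (x^2*y^2)^2" using e x y by (simp add: power_mult_distrib flip: power_mult)
    then have "w^2 = x^2*y^2" by (metis power2_eq_iff_nonneg zero_le_power2 mult_nonneg_nonneg)
    moreover have "coprime x y" using c x y by simp
    ultimately show ?thesis using x y Q' by auto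
  qed
  have "5 dvd P * Q" using assms(2) by simp
  moreover have "prime (5::int)" by simp
  ultimately have "5 dvd P \<or> 5 dvd Q" using prime_dvd_mult_iff by blast
  then have "\<exists>x y. P + Q = x^4 + 5*y^4 \<and> w^2 = x^2 * y^2 \<and> coprime x y \<and> P*Q = x^4 * (5*y^4)"
  proof
    assume "5 dvd P"
    then show ?thesis using main[of Q P] assms by (simp add: coprime_commute add.commute mult.commute)
  next
    assume "5 dvd Q"
    then show ?thesis using main[of P Q] assms by simp
  qed
  then show thesis using that by blast
qed

lemma odd_dvd_doubleD: "odd q \<Longrightarrow> q dvd 2 * x \<Longrightarrow> q dvd x" for q x :: int
  by (metis coprime_dvd_mult_right_iff coprime_right_2_iff_odd)

lemma not_square_dvd_5: "p^2 dvd 5 \<Longrightarrow> p \<ge> 2 \<Longrightarrow> False" for p :: int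
proof -
  assume a: "p^2 dvd 5" "p \<ge> 2"
  then have "p^2 \<le> 5" by (auto intro: zdvd_imp_le)
  moreover have "p * p \<ge> 3 * 3" if "p \<ge> 3" using that by (intro mult_mono) auto
  ultimately have "\<not> p \<ge> 3" by (auto simp: power2_eq_square)
  then have "p = 2" using a(2) by linarith
  then show False using a(1) by simp
qed

lemma coprime_diff_sum:
  fixes g h :: int
  assumes "coprime g h" "odd (g-h)"
  shows "coprime (g-h) (g+h)"
proof (rule coprimeI_primes_int)
  fix q assume q: "prime q" "q dvd g-h" "q dvd g+h"
  have "odd q" using assms(2) q(2) dvd_trans by blast
  have "q dvd (g+h)+(g-h)" "q dvd (g+h)-(g-h)" using q(2,3) dvd_add dvd_diff by blast+
  moreover have "(g+h)+(g-h) = 2*g" "(g+h)-(g-h) = 2*h" by simp_all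
  ultimately have "q dvd 2*g" "q dvd 2*h" by (simp_all only:)
  then have "q dvd g" "q dvd h" using \<open>odd q\<close> odd_dvd_doubleD by blast+
  then show False using q(1) assms(1) by (meson coprime_common_divisor not_prime_unit)
qed (use assms(2) in \<open>metis even_zero\<close>)

text \<open>Completing the square gives (2b^2 + a^2)^2 - 4Y^2 = 5a^4, whose coprime factors are x^4
  and 5y^4 in some order. Then 4b^2 = (x^2 - y^2)^2 + 4y^4 is twice a Pythagorean triple, and its
  parameters solve the same equation with \<open>(l, k, x)\<close> for \<open>(a, b, Y)\<close>. The
  last two conclusions keep the way back to \<open>a\<close> and \<open>b\<close>.\<close>

lemma quartic_odd_step:
  fixes a b Y :: int
  assumes eq: "b^4 + a^2*b^2 - a^4 = Y^2" and cop: "coprime a b" and odd: "odd a"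
  obtains x k l where "coprime l k" "k^4 + l^2*k^2 - l^4 = x^2" "a^2 = x^2 * (k*l)^2"
    "4*b^2 = (x^2 - (k*l)^2)^2 + 4*(k*l)^4"
proof -
  have a0: "a \<noteq> 0" using odd by auto
  define P Q where "P = 2*b^2 + a^2 - 2*Y" and "Q = 2*b^2 + a^2 + 2*Y"
  have PQ: "P * Q = 5 * a^4" using eq unfolding P_def Q_def by algebra
  have oP: "odd P" "odd Q" using odd by (auto simp: P_def Q_def)
  have cPQ: "coprime P Q"
  proof (rule coprimeI_primes_int)
    fix p assume p: "prime p" "p dvd P" "p dvd Q"
    then have "p dvd P + Q" by simp
    then have "p dvd 2*(2*b^2+a^2)" by (simp add: P_def Q_def)
    moreover have "odd p" using p(2) oP dvd_trans by blast
    ultimately have p1: "p dvd 2*b^2+a^2" using odd_dvd_doubleD by blast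
    have "p^2 dvd 5*a^4" using mult_dvd_mono[OF p(2,3)] PQ by (simp add: power2_eq_square)
    have "p dvd a"
    proof (rule ccontr)
      assume n: "\<not> p dvd a"
      then have "coprime (p^2) (a^4)" using p(1) by (simp add: prime_imp_coprime)
      then have "p^2 dvd 5" using \<open>p^2 dvd 5*a^4\<close> by (simp add: coprime_dvd_mult_left_iff)
      then show False using p(1) prime_ge_2_int not_square_dvd_5 by blast
    qed
    then have "p dvd a^2" by (simp add: power2_eq_square)
    then have "p dvd 2*b^2" using p1 by (simp add: dvd_add_left_iff)
    then have "p dvd b^2" using \<open>odd p\<close> odd_dvd_doubleD by blast
    then have "p dvd b" using p(1) prime_dvd_power by blast
    then show False using \<open>p dvd a\<close> p(1) cop by (meson coprime_common_divisor not_prime_unit)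
  qed (use oP in auto)
  have pos: "P + Q > 0" using a0 by (simp add: P_def Q_def add_nonneg_pos)
  obtain x y where xy: "P + Q = x^4 + 5*y^4" "a^2 = x^2 * y^2" "coprime x y" "P*Q = x^4 * (5*y^4)"
    using coprime_mult_5_fourth_power_int[OF cPQ PQ pos a0] .
  have "odd (x^4 * (5*y^4))" using xy(4) oP by (metis even_mult_iff)
  then have oxy: "odd x" "odd y" by auto
  have b4: "4*b^2 = (x^2-y^2)^2 + 4*y^4" using xy(1,2) unfolding P_def Q_def by algebra
  obtain p where p: "x^2 - y^2 = 2*p" using oxy by (metis evenE even_diff even_power odd_add zero_less_numeral)
  have bb: "(y^2)^2 + p^2 = b^2" using b4 unfolding p by (simp add: power_mult_distrib flip: power_mult)
  have "even p"
  proof -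
    obtain x1 y1 where "x = 2*x1+1" "y = 2*y1+1" using oxy by (metis oddE)
    then have "2*p = 4*(x1^2+x1-y1^2-y1)" using p by algebra
    then show ?thesis by presburger
  qed
  have "coprime (y^2) p"
  proof (rule coprimeI_primes_int)
    fix q assume q: "prime q" "q dvd y^2" "q dvd p"
    then have "q dvd 2*p + y^2" by simp
    moreover have "2*p + y^2 = x^2" using p by simp
    ultimately have "q dvd x^2" by simp
    then have "q dvd x" "q dvd y" using q prime_dvd_power by blast+
    then show False using q(1) xy(3) by (meson coprime_common_divisor not_prime_unit)
  qed (use oxy in auto)
  then obtain g h where gh: "y^2 = g^2-h^2" "p = 2*g*h" "coprime g h"
    using primitive_pythagorean_int[of "y^2" p b] oxy \<open>even p\<close> bb by (metis even_power)
  have prod: "(g-h)*(g+h) = y^2" using gh(1) by algebra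
  have "odd ((g-h)*(g+h))" using prod oxy by simp
  then have "coprime (g-h) (g+h)" using coprime_diff_sum[OF gh(3)] by simp
  then obtain l k t where lk: "g-h = t*l^2" "g+h = t*k^2" "t = 1 \<or> t = -1"
    using coprime_mult_square_int_signed prod by metis
  have t2: "t^2 = 1" using lk(3) by auto
  have y2: "y^2 = (k*l)^2" using prod lk(1,2) t2 by algebra
  have "x^2 = y^2 + 4*g*h" using p gh(2) by simp
  also have "4*g*h = k^4 - l^4" using lk(1,2) t2 by algebra
  finally have x2: "k^4 + l^2*k^2 - l^4 = x^2" using y2 by (simp add: algebra_simps power_mult_distrib)
  have "coprime l k"
    using \<open>coprime (g-h) (g+h)\<close> lk by auto
  moreover have "a^2 = x^2*(k*l)^2" using xy(2) y2 by simp
  moreover have "4*b^2 = (x^2 - (k*l)^2)^2 + 4*(k*l)^4" using b4 y2 by algebra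
  ultimately show thesis using that x2 by blast
qed

text \<open>With a = 2a' the square is completed as (b^2 + 2a'^2)^2 - Y^2 = 20a'^4, where both
  factors are even and are halved. Now x^2 - y^2 is the odd leg of the triple; this parity is kept
  in the conclusion because it excludes k^2 = l^2 = x^2 = 1, so that no solution with even
  \<open>a\<close> survives.\<close>

lemma quartic_even_step:
  fixes a b Y :: int
  assumes eq: "b^4 + a^2*b^2 - a^4 = Y^2" and cop: "coprime a b" and even: "even a" and a0: "a \<noteq> 0"
  obtains x k l where "coprime l k" "k^4 + l^2*k^2 - l^4 = x^2" "a^2 = 4 * x^2 * (k*l)^2"
    "odd (x^2 - (k*l)^2)"
proof -
  obtain a' where a': "a = 2*a'" using even by blast
  have ob: "odd b" using cop even by (meson coprime_common_divisor odd_one)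
  have "odd (Y^2)" using ob even by (simp flip: eq)
  then have oY: "odd Y" by simp
  obtain P Q where P: "b^2+2*a'^2-Y = 2*P" and Q: "b^2+2*a'^2+Y = 2*Q"
  proof -
    have "even (b^2+2*a'^2-Y)" "even (b^2+2*a'^2+Y)" using ob oY by auto
    then show thesis using that unfolding dvd_def by blast
  qed
  have "4*(P*Q) = (b^2+2*a'^2-Y)*(b^2+2*a'^2+Y)" using P Q by simp
  also have "\<dots> = 4*(5*a'^4)" using eq a' by algebra
  finally have PQ: "P * Q = 5 * a'^4" by simp
  have sum: "P + Q = b^2 + 2*a'^2" using P Q by simp
  have "b \<noteq> 0" using ob by auto
  then have pos: "P + Q > 0" using sum by (simp add: add_pos_nonneg)
  have a'0: "a' \<noteq> 0" using a0 a' by simp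
  have cPQ: "coprime P Q"
  proof (rule coprimeI_primes_int)
    fix p assume p: "prime p" "p dvd P" "p dvd Q"
    then have p1: "p dvd b^2+2*a'^2" by (simp flip: sum)
    have "p^2 dvd 5*a'^4" using mult_dvd_mono[OF p(2,3)] PQ by (simp add: power2_eq_square)
    have "p dvd a'"
    proof (rule ccontr)
      assume n: "\<not> p dvd a'"
      then have "coprime (p^2) (a'^4)" using p(1) by (simp add: prime_imp_coprime)
      then have d: "p^2 dvd 5" using \<open>p^2 dvd 5*a'^4\<close> by (simp add: coprime_dvd_mult_left_iff)
      then show False using p(1) prime_ge_2_int not_square_dvd_5 by blast
    qed
    then have "p dvd 2*a'^2" by (simp add: power2_eq_square)
    then have "p dvd b^2" using p1 by (simp add: dvd_add_left_iff)
    then have "p dvd b" using p(1) prime_dvd_power by blast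
    moreover have "p dvd a" using \<open>p dvd a'\<close> a' by simp
    ultimately show False using p(1) cop by (meson coprime_common_divisor not_prime_unit)
  qed (use PQ a'0 in auto)
  obtain x y where xy: "P + Q = x^4 + 5*y^4" "a'^2 = x^2 * y^2" "coprime x y" "P*Q = x^4 * (5*y^4)"
    using coprime_mult_5_fourth_power_int[OF cPQ PQ pos a'0] .
  have bb: "(x^2-y^2)^2 + (2*y^2)^2 = b^2" using xy(1,2) sum by algebra
  have oxy: "odd (x^2-y^2)"
  proof
    assume "even (x^2-y^2)"
    then have "even (b^2)" by (simp flip: bb)
    then show False using ob by simp
  qed
  have "coprime (x^2-y^2) (2*y^2)"
  proof (rule coprimeI_primes_int)
    fix q assume q: "prime q" "q dvd x^2-y^2" "q dvd 2*y^2"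
    have "odd q" using q(2) oxy dvd_trans by blast
    then have qy: "q dvd y^2" using q(3) odd_dvd_doubleD by blast
    then have "q dvd (x^2-y^2) + y^2" using q(2) by (intro dvd_add)
    then have "q dvd x^2" by simp
    then have "q dvd x" "q dvd y" using q(1) qy prime_dvd_power by blast+
    then show False using q(1) xy(3) by (meson coprime_common_divisor not_prime_unit)
  qed (use oxy in \<open>metis even_zero\<close>)
  then obtain g h where gh: "x^2-y^2 = g^2-h^2" "2*y^2 = 2*g*h" "coprime g h"
    using primitive_pythagorean_int[of "x^2-y^2" "2*y^2" b] oxy bb by (metis dvd_triv_left)
  then have "g * h = y^2" by simp
  then obtain k l t where lk: "g = t*k^2" "h = t*l^2" "t = 1 \<or> t = -1"
    using coprime_mult_square_int_signed gh(3) by metis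
  have t2: "t^2 = 1" using lk(3) by auto
  have y2: "y^2 = (k*l)^2" using \<open>g*h = y^2\<close> lk(1,2) t2 by algebra
  have "k^4 + l^2*k^2 - l^4 = x^2" using gh(1) lk(1,2) t2 y2 by algebra
  moreover have "coprime l k" using gh(3) lk by (auto simp: coprime_commute)
  moreover have "a^2 = 4*x^2*(k*l)^2" using xy(2) y2 a' by algebra
  moreover have "odd (x^2 - (k*l)^2)" using oxy y2 by simp
  ultimately show thesis using that by blast
qed

lemma quartic_solutions:
  fixes a b Y :: int
  assumes "b^4 + a^2*b^2 - a^4 = Y^2" "coprime a b" "a \<noteq> 0"
  shows "a^2 = 1 \<and> b^2 = 1"
  using assms
proof (induction "nat \<bar>a\<bar>" arbitrary: a b Y rule: less_induct)
  case less
  have sq1: "z^2 \<ge> 1" if "z \<noteq> 0" for z :: int using that by (simp add: int_one_le_iff_zero_less)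
  have abs_less: "\<bar>u\<bar> < \<bar>v\<bar>" if "u^2 < v^2" for u v :: int using that by (metis abs_le_square_iff not_le)
  show ?case
  proof (cases "odd a")
    case True
    obtain x k l where s: "coprime l k" "k^4 + l^2*k^2 - l^4 = x^2" "a^2 = x^2 * (k*l)^2"
      "4*b^2 = (x^2 - (k*l)^2)^2 + 4*(k*l)^4"
      using quartic_odd_step[OF less.prems(1,2) True] by metis
    have nz: "x \<noteq> 0" "k \<noteq> 0" "l \<noteq> 0" using s(3) less.prems(3) by auto
    have e: "a^2 = (x^2*k^2)*l^2" using s(3) by (simp add: power_mult_distrib)
    have all: "l^2 = 1 \<and> k^2 = 1"
    proof (cases "x^2*k^2 = 1")
      case True
      moreover have "x^2 > 0" "k^2 > 0" using nz by auto
      ultimately have "x^2 = 1" "k^2 = 1" by (auto simp: zmult_eq_1_iff)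
      then have "l^2 * (l^2 - 1) = 0" using s(2) by algebra
      then show ?thesis using nz \<open>k^2 = 1\<close> by simp
    next
      case False
      then have "x^2*k^2 > 1" using nz by (metis int_one_le_iff_zero_less le_less mult_pos_pos zero_less_power2)
      then have "l^2 < a^2" using e nz by simp
      then show ?thesis using less.hyps[of l k x] s(1,2) nz abs_less less.prems(3) by auto
    qed
    then have "x^2 = 1" using s(2) by algebra
    moreover have "(k*l)^2 = 1" using all by (simp add: power_mult_distrib)
    moreover from this have "(k*l)^4 = 1" by algebra
    ultimately show ?thesis using s(3,4) by simp
  next
    case False
    obtain x k l where s: "coprime l k" "k^4 + l^2*k^2 - l^4 = x^2" "a^2 = 4 * x^2 * (k*l)^2"
      "odd (x^2 - (k*l)^2)"
      using quartic_even_step[OF less.prems(1,2) _ less.prems(3)] False by metis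
    have nz: "x \<noteq> 0" "k \<noteq> 0" "l \<noteq> 0" using s(3) less.prems(3) by auto
    have e: "a^2 = (4*(x^2*k^2))*l^2" using s(3) by (simp add: power_mult_distrib)
    have "x^2*k^2 > 0" using nz by simp
    then have "4*(x^2*k^2) > 1" by linarith
    then have "l^2 < a^2" using e nz by simp
    then have "l^2 = 1 \<and> k^2 = 1" using less.hyps[of l k x] s(1,2) nz abs_less less.prems(3) by auto
    moreover from this have "x^2 = 1" using s(2) by algebra
    ultimately show ?thesis using s(4) by (simp add: power_mult_distrib)
  qed
qed

section \<open>Rational points on two curves\<close>

lemma coprime_add_mult_int: "coprime a (a * k + c)" if "coprime a c" for a c k :: int
proof (rule coprimeI)
  fix d assume d: "d dvd a" "d dvd a*k + c"
  then have "d dvd c" by (simp add: dvd_add_right_iff)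
  then show "is_unit d" using d(1) that by (meson coprime_common_divisor)
qed

lemma rat_coprime_quotient:
  fixes r :: rat
  obtains a b where "r = of_int a / of_int b" "b > 0" "coprime a b"
  by (metis quotient_of_coprime quotient_of_denom_pos quotient_of_div surj_pair)

lemma rat_square_of_int:
  fixes r :: rat and N :: int
  assumes "of_int N = r^2"
  obtains z where "N = z^2" "r = of_int z"
proof -
  obtain a b where ab: "r = of_int a / of_int b" "b > 0" "coprime a b" by (rule rat_coprime_quotient)
  have "(of_int (N * b^2) :: rat) = of_int (a^2)" using assms ab by (simp add: field_simps)
  then have "N * b^2 = a^2" by (simp only: of_int_eq_iff)
  then have "b^2 dvd a^2" by (metis dvd_triv_right)
  then have "b dvd a" by (simp add: pow_divides_pow_iff)
  then have "b = 1" using ab(2) coprime_common_divisor[OF ab(3), of b] by (simp add: zdvd1_eq)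
  then show thesis using that[of a] ab(1) \<open>N * b^2 = a^2\<close> by simp
qed

lemma two_times_square_rat: "2*x^2 = y^2 \<Longrightarrow> x = 0" for x y :: rat
proof (rule ccontr)
  assume a: "2*x^2 = y^2" "x \<noteq> 0"
  have "(y/x)^2 = of_int 2" using a by (simp add: power_divide field_simps)
  then obtain z :: int where z: "2 = z^2" by (metis rat_square_of_int)
  then have "even (z^2)" by (metis dvd_refl)
  then have "4 dvd z^2" by (auto elim!: evenE simp: power_mult_distrib)
  then show False using z by simp
qed

lemma fermat_plus_rat:
  fixes t s :: rat
  assumes "t^4 + 1 = s^2"
  shows "t = 0"
proof -
  obtain a b where ab: "t = of_int a / of_int b" "b > 0" "coprime a b" by (rule rat_coprime_quotient)
  have "of_int (a^4 + b^4) = (s * of_int b^2)^2"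
  proof -
    have e: "of_int a = t * of_int b" using ab by simp
    show ?thesis using assms by (simp add: e) algebra
  qed
  then obtain z where "a^4 + b^4 = z^2" by (rule rat_square_of_int)
  then show ?thesis using fermat_plus_coprime[OF ab(3)] ab by auto
qed

lemma fermat_minus_rat:
  fixes x y z :: rat
  assumes "x^4 - y^4 = z^2"
  shows "y = 0 \<or> z = 0"
proof (cases "x = 0")
  case True
  then have "- (y^4) = z^2" using assms by simp
  moreover have "y^4 \<ge> 0" "z^2 \<ge> 0" by auto
  ultimately have "z^2 = 0" by linarith
  then show ?thesis by simp
next
  case False
  define t where "t = y / x"
  obtain a b where ab: "t = of_int a / of_int b" "b > 0" "coprime a b" by (rule rat_coprime_quotient)
  have "(z/x^2)^2 = (x^4-y^4)/x^4" using assms by (simp add: power_divide flip: power_mult)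
  also have "\<dots> = 1 - t^4" using False by (simp add: t_def power_divide diff_divide_distrib)
  finally have t: "(z/x^2)^2 = 1 - t^4" .
  have "of_int (b^4 - a^4) = (z/x^2 * of_int b^2)^2"
  proof -
    have e: "of_int a = t * of_int b" using ab by simp
    show ?thesis unfolding power_mult_distrib t by (simp add: e) algebra
  qed
  then obtain w where w: "b^4 - a^4 = w^2" "z/x^2 * of_int b^2 = of_int w" by (rule rat_square_of_int)
  have "a = 0 \<or> w = 0" using fermat_minus_coprime[of b a w] w ab(3) by (simp add: coprime_commute)
  then show ?thesis using w(2) ab False by (auto simp: t_def)
qed

text \<open>Over a common denominator the factors a, b, a^2 + b^2 and M are coprime in pairs, except
  that 2 may divide the last two. So a and b are squares up to sign and a^2 + b^2 = x^4 + y^4 is a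
  square or twice a square w^2. The first contradicts \<open>fermat_plus_coprime\<close>; the second
  gives w^4 - (xy)^4 = ((x^4 - y^4)/2)^2.\<close>

lemma curve_rational_points:
  fixes u s :: rat
  assumes "s^2 = - u * (u^2+1) * (u^2-2*u-1)"
  shows "u = 0 \<or> u = 1 \<or> u = -1"
proof (rule ccontr)
  assume nt: "\<not> ?thesis"
  obtain a b where ab: "u = of_int a / of_int b" "b > 0" "coprime a b" by (rule rat_coprime_quotient)
  define M where "M = a^2 - 2*a*b - b^2"
  have "of_int (- a * b * (a^2+b^2) * M) = (s * of_int b^3)^2"
  proof -
    have e: "of_int a = u * of_int b" using ab by simp
    show ?thesis unfolding M_def using assms by (simp add: e) algebra
  qed
  then obtain z where z: "- a * b * (a^2+b^2) * M = z^2" by (rule rat_square_of_int)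
  have a0: "a \<noteq> 0" using nt ab by auto
  have ab2: "a^2 \<noteq> b^2"
  proof
    assume "a^2 = b^2"
    then have "a = b \<or> a = -b" by (simp add: power2_eq_iff)
    then show False using nt ab by auto
  qed
  have c1: "coprime a (a^2+b^2)" "coprime b (a^2+b^2)" "coprime a M" "coprime b M"
  proof -
    have "coprime a (b^2)" "coprime b (a^2)" using ab(3) by (auto simp: coprime_commute)
    moreover have "a^2+b^2 = a * a + b^2" "a^2+b^2 = b * b + a^2" "M = a * (a - 2*b) + (-(b^2))" "M = b * (-2*a - b) + a^2"
      by (simp_all add: M_def power2_eq_square algebra_simps)
    ultimately show "coprime a (a^2+b^2)" "coprime b (a^2+b^2)" "coprime a M" "coprime b M"
      using coprime_add_mult_int[of a "b^2" a] coprime_add_mult_int[of b "a^2" b]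
        coprime_add_mult_int[of a "-(b^2)" "a-2*b"] coprime_add_mult_int[of b "a^2" "-2*a-b"] by (simp_all add: add.commute)
  qed
  have "a * (- b * (a^2+b^2) * M) = z^2" "b * (- a * (a^2+b^2) * M) = z^2" "(a^2+b^2) * (- a * b * M) = z^2"
    using z by algebra+
  moreover have "coprime a (- b * (a^2+b^2) * M)" "coprime b (- a * (a^2+b^2) * M)"
    using c1 ab(3) by (auto simp: coprime_commute)
  ultimately obtain x t1 y t2 where x: "a = t1*x^2" "t1 = 1 \<or> t1 = -1" and y: "b = t2*y^2" "t2 = 1 \<or> t2 = -1"
    using coprime_mult_square_int_left by metis
  have sq: "a^2+b^2 = x^4+y^4" using x y by auto
  have cxy: "coprime x y" using ab(3) x y by auto
  have nz: "x \<noteq> 0" "y \<noteq> 0" using a0 ab(2) x y by auto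
  have cM: "p dvd 2" if p: "prime p" "p dvd a^2+b^2" "p dvd M" for p :: int
  proof -
    have "p dvd (a^2+b^2) - M" "p dvd (a^2+b^2) + M" using p(2,3) by (auto intro: dvd_add dvd_diff)
    moreover have "(a^2+b^2) - M = (2*b)*(a+b)" "(a^2+b^2) + M = (2*a)*(a-b)" by (simp_all add: M_def power2_eq_square algebra_simps)
    ultimately have d: "p dvd (2*b)*(a+b)" "p dvd (2*a)*(a-b)" by (simp_all only:)
    have "\<not> p dvd a" "\<not> p dvd b" using p c1 by (meson coprime_common_divisor not_prime_unit)+
    then have "p dvd 2 \<or> p dvd a+b" "p dvd 2 \<or> p dvd a-b" using d p(1) by (auto simp: prime_dvd_mult_iff)
    moreover have "p dvd 2" if "p dvd a+b" "p dvd a-b"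
    proof -
      have "p dvd (a+b)+(a-b)" using that by (rule dvd_add)
      then have "p dvd 2*a" by simp
      then show ?thesis using \<open>\<not> p dvd a\<close> p(1) by (simp add: prime_dvd_mult_iff)
    qed
    ultimately show ?thesis by blast
  qed
  show False
  proof (cases "even (a^2+b^2)")
    case False
    have "coprime (a^2+b^2) M"
    proof (rule coprimeI_primes_int)
      fix p :: int assume p: "prime p" "p dvd a^2+b^2" "p dvd M"
      then have "p dvd 2" by (rule cM)
      then have "p = 2" using p(1) by (simp add: primes_dvd_imp_eq)
      then show False using p(2) False by simp
    qed (use False in \<open>metis even_zero\<close>)
    then have "coprime (a^2+b^2) (- a * b * M)" using c1 by (auto simp: coprime_commute)
    then obtain w where "a^2+b^2 = w^2"
      using coprime_mult_square_int \<open>(a^2+b^2) * (- a * b * M) = z^2\<close> by (metis add_nonneg_nonneg zero_le_power2)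
    then show False using fermat_plus_coprime[OF cxy] sq nz by auto
  next
    case True
    then have "even a \<longleftrightarrow> even b" by simp
    then have odd: "odd a" "odd b" using ab(3) by (meson coprime_common_divisor odd_one)+
    obtain a1 b1 where ab1: "a = 2*a1+1" "b = 2*b1+1" using odd by (metis oddE)
    obtain S where S: "a^2+b^2 = 2*S" using True by blast
    have oS: "odd S"
    proof -
      have "2*S = 2*(2*(a1^2+a1+b1^2+b1)+1)" using S ab1 by algebra
      then have "S = 2*(a1^2+a1+b1^2+b1)+1" by simp
      then show ?thesis by simp
    qed
    have "even M" using odd by (simp add: M_def)
    then obtain M' where M': "M = 2*M'" by blast
    obtain z' where z': "z = 2*z'"
    proof -
      have "even (z^2)" by (simp flip: z add: S)
      then show thesis using that by auto
    qed
    have "4 * (S * (- a * b * M')) = 4*(z'^2)" using \<open>(a^2+b^2) * (- a * b * M) = z^2\<close> S M' z' by algebra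
    then have pr: "S * (- a * b * M') = z'^2" by (simp add: algebra_simps)
    have "coprime S M'"
    proof (rule coprimeI_primes_int)
      fix p :: int assume p: "prime p" "p dvd S" "p dvd M'"
      then have "p dvd 2" using cM[of p] S M' by simp
      then have "p = 2" using p(1) by (simp add: primes_dvd_imp_eq)
      then show False using p(2) oS by simp
    qed (use oS in \<open>metis even_zero\<close>)
    moreover have "coprime S a" "coprime S b" using c1 S by (auto simp: coprime_commute)
    ultimately have "coprime S (- a * b * M')" by auto
    moreover have "S \<ge> 0"
    proof -
      have "0 \<le> a^2 + b^2" by simp
      then show ?thesis using S by linarith
    qed
    ultimately obtain w where w: "S = w^2" using coprime_mult_square_int[OF _ pr] by blast
    have "x^4 + y^4 = 2*w^2" using sq S w by simp
    then have e: "4 * (w^4 - (x*y)^4) = (x^4-y^4)^2" by algebra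
    have "even (x^4 - y^4)" using e
    proof -
      have "even ((x^4-y^4)^2)" by (simp flip: e)
      then show ?thesis by simp
    qed
    then obtain v where v: "x^4-y^4 = 2*v" by blast
    have "w^4 - (x*y)^4 = v^2" using e v by (simp add: power2_eq_square)
    moreover have "coprime w (x*y)"
    proof -
      have "coprime (w^2) a" "coprime (w^2) b" using \<open>coprime S a\<close> \<open>coprime S b\<close> w by simp_all
      then show ?thesis using x y by auto
    qed
    ultimately have "x*y = 0 \<or> v = 0" using fermat_minus_coprime by blast
    then have "x^4 = y^4" using nz v by auto
    then have "a^2 = b^2" using x y by auto
    then show False using ab2 by simp
  qed
qed

text \<open>Clearing denominators gives the triple a^2, 2b(a-b), z, up to a factor 2 when
  \<open>a\<close> is even. In both cases its parameters are squares up to sign, or have such a sum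
  and difference, and eliminating them leads to \<open>quartic_solutions\<close>.\<close>

lemma second_curve_rational_points:
  fixes q w :: rat
  assumes "w^2 = q^4 + 4*(q-1)^2"
  shows "q = 0 \<or> q = 1"
proof (rule ccontr)
  assume nt: "\<not> ?thesis"
  obtain a b where ab: "q = of_int a / of_int b" "b > 0" "coprime a b" by (rule rat_coprime_quotient)
  have "of_int (a^4 + 4*b^2*(a-b)^2) = (w * of_int b^2)^2"
  proof -
    have e: "of_int a = q * of_int b" using ab by simp
    show ?thesis using assms by (simp add: e) algebra
  qed
  then obtain z where z: "a^4 + 4*b^2*(a-b)^2 = z^2" by (rule rat_square_of_int)
  have nz: "a \<noteq> 0" "b \<noteq> 0" "a \<noteq> b" using nt ab by auto
  have cab: "coprime a (a-b)" "coprime b (a-b)"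
    using ab(3) coprime_add_mult_int[of a "-b" 1] coprime_add_mult_int[of b a "-1"] by (simp_all add: coprime_commute)
  show False
  proof (cases "odd a")
    case True
    have "coprime (a^2) (2*b*(a-b))" using True cab ab(3) by auto
    moreover have "(a^2)^2 + (2*b*(a-b))^2 = z^2" using z by algebra
    ultimately obtain g h where gh: "a^2 = g^2-h^2" "2*b*(a-b) = 2*g*h" "coprime g h"
      using primitive_pythagorean_int[of "a^2" "2*b*(a-b)" z] True by (metis dvd_triv_left even_power mult.assoc)
    have prod: "(g-h)*(g+h) = a^2" using gh(1) by algebra
    have "odd ((g-h)*(g+h))" using prod True by simp
    then have "coprime (g-h) (g+h)" using coprime_diff_sum[OF gh(3)] by simp
    then obtain l k t where lk: "g-h = t*l^2" "g+h = t*k^2" "t = 1 \<or> t = -1"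
      using coprime_mult_square_int_signed prod by metis
    have t2: "t^2 = 1" using lk(3) by auto
    have a2: "a^2 = (k*l)^2" using prod lk(1,2) t2 by algebra
    have "4*(b*(a-b)) = k^4 - l^4" using gh(2) lk(1,2) t2 by algebra
    then have "l^4 + k^2*l^2 - k^4 = (2*b-a)^2" using a2 by algebra
    moreover have "coprime k l" using \<open>coprime (g-h) (g+h)\<close> lk by (auto simp: coprime_commute)
    moreover have "k \<noteq> 0" using a2 nz by auto
    ultimately have k: "k^2 = 1 \<and> l^2 = 1" using quartic_solutions by blast
    then have "a^2 = 1" "(2*b-a)^2 = 1" using a2 \<open>l^4 + k^2*l^2 - k^4 = (2*b-a)^2\<close> by algebra+
    then show False using nz by (auto simp: power2_eq_1_iff)
  next
    case False
    then obtain a' where a': "a = 2*a'" by blast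
    have ob: "odd b" using False ab(3) by (meson coprime_common_divisor odd_one)
    have "even (z^2)" using a' by (simp flip: z)
    then obtain z' where z': "z = 2*z'" by auto
    have "4*((b*(2*a'-b))^2 + (2*a'^2)^2) = 4*z'^2" using z a' z' by algebra
    then have "(b*(2*a'-b))^2 + (2*a'^2)^2 = z'^2" by simp
    moreover have "odd (b*(2*a'-b))" using ob by simp
    moreover have "coprime (b*(2*a'-b)) (2*a'^2)"
    proof -
      have "coprime b a'" "coprime (2*a'-b) a'" using ab(3) cab a' by (auto simp: coprime_commute)
      then show ?thesis using ob by auto
    qed
    ultimately obtain g h where gh: "b*(2*a'-b) = g^2-h^2" "2*a'^2 = 2*g*h" "coprime g h"
      using primitive_pythagorean_int[of "b*(2*a'-b)" "2*a'^2" z'] by (metis dvd_triv_left)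
    then have "g * h = a'^2" by simp
    then obtain k l t where lk: "g = t*k^2" "h = t*l^2" "t = 1 \<or> t = -1"
      using coprime_mult_square_int_signed gh(3) by metis
    have t2: "t^2 = 1" using lk(3) by auto
    have a2: "a'^2 = (k*l)^2" using \<open>g*h = a'^2\<close> lk(1,2) t2 by algebra
    have e: "l^4 + k^2*l^2 - k^4 = (b-a')^2" using gh(1) lk(1,2) t2 a2 by algebra
    moreover have "coprime k l" using gh(3) lk by (auto simp: coprime_commute)
    moreover have "k \<noteq> 0" using a2 nz a' by auto
    ultimately have k: "k^2 = 1 \<and> l^2 = 1" using quartic_solutions by blast
    then have "a'^2 = 1" "(b-a')^2 = 1" using a2 e by algebra+
    then have "odd (a'^2)" "odd ((b-a')^2)" by simp_all
    then have "odd a'" "odd (b-a')" by simp_all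
    then have "even ((b-a') + a')" by presburger
    then show False using ob by simp
  qed
qed

section \<open>The Kummer surface\<close>

text \<open>
  Write \<open>n = A + C\<close> and \<open>m = A - C\<close> for a quadratic form \<open>A x^2 + B x + C\<close>. Its resultants with
  the factors \<open>x\<close>, \<open>x^2 + 1\<close>, \<open>x^2 - 2x - 1\<close> of the right-hand side of the curve are, up to squares,
  \<open>n^2 - m^2\<close>, \<open>m^2 + B^2\<close> and \<open>2n^2 - (m+B)^2\<close>; they are all squares for an image of \<open>1 - \<sigma>\<close>.
\<close>

definition ypoint :: "'a::comm_ring_1 \<Rightarrow> 'a \<Rightarrow> 'a \<Rightarrow> 'a \<Rightarrow> 'a \<Rightarrow> 'a \<Rightarrow> bool" where
  "ypoint n m B E d e \<longleftrightarrow> E^2 = n^2 - m^2 \<and> d^2 = m^2 + B^2 \<and> e^2 = 2*n^2 - (m+B)^2"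

definition kummer :: "'a::comm_ring_1 \<Rightarrow> 'a \<Rightarrow> 'a \<Rightarrow> 'a \<Rightarrow> 'a" where
  "kummer n m B j = (m^2+B^2-n^2)*(j-n)^2 - 2*n*(n^2-m^2-m*B)*(j-n)
     + (n^2-m^2)*((m+B)^2-n^2) + n^2*m^2"

text \<open>
  The quartic \<open>kummer\<close> defines the Kummer surface of the Jacobian, and \<open>F\<close> is the action of
  \<open>1 - \<sigma>\<close> on it. The square class of \<open>Q1\<close> distinguishes points that come from the Jacobian
  itself from those that come from a quadratic twist.
\<close>

definition Fn :: "'a::comm_ring_1 \<Rightarrow> 'a \<Rightarrow> 'a \<Rightarrow> 'a \<Rightarrow> 'a" where "Fn n m B j = 2*(n*j - m*(m+B))"
definition Fm :: "'a::comm_ring_1 \<Rightarrow> 'a \<Rightarrow> 'a \<Rightarrow> 'a \<Rightarrow> 'a" where "Fm n m B j = 2*(n*m + B*(j-n))"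
definition FB :: "'a::comm_ring_1 \<Rightarrow> 'a \<Rightarrow> 'a \<Rightarrow> 'a \<Rightarrow> 'a" where "FB n m B j = -2*(n*m + B*n + j*m)"
definition Fj :: "'a::comm_ring_1 \<Rightarrow> 'a \<Rightarrow> 'a \<Rightarrow> 'a \<Rightarrow> 'a" where "Fj n m B j = j^2 + 2*n^2 - 3*m^2 - B^2 - 2*m*B"
definition Q1 :: "'a::comm_ring_1 \<Rightarrow> 'a \<Rightarrow> 'a \<Rightarrow> 'a \<Rightarrow> 'a" where "Q1 n m B j = n*(m-B) - m*(m+B) + j*(n+B)"

lemmas F_defs = Fn_def Fm_def FB_def Fj_def Q1_def

lemma ypointD:
  assumes "ypoint n m B E d e"
  shows "E^2 = n^2 - m^2" "d^2 = m^2 + B^2" "e^2 = 2*n^2 - (m+B)^2"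
  using assms by (auto simp: ypoint_def)

lemma ypoint_n_nonzero:
  fixes n :: rat
  assumes "ypoint n m B E d e" "E \<noteq> 0"
  shows "n \<noteq> 0"
proof
  assume "n = 0"
  then have "E^2 + m^2 = 0" using ypointD(1)[OF assms(1)] by simp
  then show False using assms(2) by (simp add: sum_power2_eq_zero_iff)
qed

text \<open>The square is completed in \<open>j\<close>. The leading coefficient is the discriminant
  B^2 - 4AC of the quadratic form, and the subtracted product consists of the three resultants of
  \<open>ypoint\<close>; when these are squares, \<open>j\<close> is rational in \<open>n\<close>,
  \<open>m\<close>, \<open>B\<close>, \<open>E\<close>, \<open>d\<close>, \<open>e\<close> wherever
  the discriminant is nonzero.\<close>

lemma kummer_eq: fixes n :: "'a::idom" shows
  "(m^2+B^2-n^2) * kummer n m B j = ((m^2+B^2-n^2)*j - n*B*(B-m))^2 - (n^2-m^2)*(m^2+B^2)*(2*n^2-(m+B)^2)"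
  unfolding kummer_def by algebra

context
  fixes n m B E d e j :: "'a::field"
  assumes y: "ypoint n m B E d e"
begin

lemmas ypoint_eqs = ypointD[OF y]

text \<open>
  The point with coordinates \<open>n + d\<close>, \<open>-(B + E)\<close>, \<open>m + E - e\<close>, \<open>J\<close> is a preimage under \<open>F\<close>; the other
  three preimages are obtained by changing two of the signs of \<open>E\<close>, \<open>d\<close>, \<open>e\<close>.
\<close>

lemma ypoint_kummer: assumes "j*(d^2-n^2) = n*B*(B-m) + E*d*e" "d^2 \<noteq> n^2" shows "kummer n m B j = 0"
proof -
  have "(m^2+B^2-n^2) * kummer n m B j = 0" unfolding kummer_eq using ypoint_eqs assms(1) by algebra
  then show ?thesis using assms(2) ypoint_eqs by auto
qed

lemma preimage_kummer: assumes "J*(d-n) = (B+E)*(B-m+e)" "d \<noteq> n"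
  shows "kummer (n+d) (-(B+E)) (m+E-e) J = 0"
proof -
  have "(d-n)^2 * kummer (n+d) (-(B+E)) (m+E-e) J = 0" unfolding kummer_def using ypoint_eqs assms(1) by algebra
  then show ?thesis using assms(2) by simp
qed

lemma preimage_F: assumes J: "J*(d-n) = (B+E)*(B-m+e)" "d \<noteq> n"
  shows "Fn (n+d) (-(B+E)) (m+E-e) J = 4*J*n"
    "Fm (n+d) (-(B+E)) (m+E-e) J = 4*J*m"
    "FB (n+d) (-(B+E)) (m+E-e) J = 4*J*B"
    "j*(d^2-n^2) = n*B*(B-m) + E*d*e \<Longrightarrow> d^2 \<noteq> n^2 \<Longrightarrow> Fj (n+d) (-(B+E)) (m+E-e) J = 4*J*j"
    "Q1 (n+d) (-(B+E)) (m+E-e) J = 2*J*(n+m)"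
proof -
  have "(d-n) * Fn (n+d) (-(B+E)) (m+E-e) J = (d-n) * (4*J*n)" "(d-n) * Fm (n+d) (-(B+E)) (m+E-e) J = (d-n) * (4*J*m)"
    "(d-n) * FB (n+d) (-(B+E)) (m+E-e) J = (d-n) * (4*J*B)" "(d-n) * Q1 (n+d) (-(B+E)) (m+E-e) J = (d-n) * (2*J*(n+m))"
    unfolding F_defs using ypoint_eqs J(1) by algebra+
  then show "Fn (n+d) (-(B+E)) (m+E-e) J = 4*J*n"
    "Fm (n+d) (-(B+E)) (m+E-e) J = 4*J*m"
    "FB (n+d) (-(B+E)) (m+E-e) J = 4*J*B"
    "Q1 (n+d) (-(B+E)) (m+E-e) J = 2*J*(n+m)" using J(2) by simp_all
  assume r: "j*(d^2-n^2) = n*B*(B-m) + E*d*e" "d^2 \<noteq> n^2"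
  have "(d-n)^2 * (d+n) * Fj (n+d) (-(B+E)) (m+E-e) J = (d-n)^2 * (d+n) * (4*J*j)"
    unfolding F_defs using ypoint_eqs J(1) r(1) by algebra
  moreover have "d + n \<noteq> 0" using r(2) by (metis add_eq_0_iff power2_minus)
  then have "(d-n)^2 * (d+n) \<noteq> 0" using J(2) by simp
  ultimately show "Fj (n+d) (-(B+E)) (m+E-e) J = 4*J*j" by simp
qed

text \<open>Transfers the twist condition to a preimage. If \<open>Q1\<close> is a nonzero square
  here, twice the product is a square. Since that product is J*(d-n)^2*c1*c2*c3 with c1 = n+m, c2 =
  d+m, c3 = 2n+m+B+e, and \<open>Q1\<close> of the preimage is 2*J*c1, the latter has the square
  class of c2*c3 when the product is nonzero.\<close>

lemma lift_identity: assumes r: "j*(d^2-n^2) = n*B*(B-m) + E*d*e" "d^2 \<noteq> n^2"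
  shows "\<exists>W. W^2 = 2*((B+E)*(B-m+e)*(d-n)*(n+m)*(d+m)*(2*n+m+B+e)) * Q1 n m B j"
proof -
  \<comment> \<open>\<open>W\<close> is the unique quartic form, up to sign, that solves the equation modulo the conics.\<close>
  define W where "W = n*n*n*m + n*n*n*B + n*n*n*d + n*n*m*B - n*n*m*E + n*n*m*e + n*n*B*B + n*n*B*E - n*n*E*d + n*n*d*e - n*m*m*m - n*m*m*B - n*m*m*d - n*m*B*d + 2*n*B*B*E - n*B*B*d - n*B*E*d + n*B*E*e + n*B*d*e - m*m*m*B - m*m*m*e - m*m*B*B - m*m*B*d + m*m*E*e - m*m*d*e + m*B*B*E - m*B*B*d + m*B*E*e + m*B*d*e + m*E*d*e + B*B*B*E + B*B*E*e"
  have "(d^2-n^2)*W^2 = (d^2-n^2)*(2*((B+E)*(B-m+e)*(d-n)*(n+m)*(d+m)*(2*n+m+B+e)) * Q1 n m B j)"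
    unfolding W_def Q1_def using ypoint_eqs r(1) by algebra
  then have "W^2 = 2*((B+E)*(B-m+e)*(d-n)*(n+m)*(d+m)*(2*n+m+B+e)) * Q1 n m B j" using r(2) by simp
  then show ?thesis by blast
qed

end

text \<open>With c1 = n+m, c2 = d+m, c3 = 2n+m+B+e, this and the next two identities show that the
  three resultants of the preimage have the square classes of c1*c2, c1*c3 and c2*c3. The preimage
  therefore satisfies \<open>ypoint\<close> again if these products are nonzero squares.\<close>

lemma preimage_sq1: fixes n :: "'a::idom" assumes "ypoint n m B E d e"
  shows "((n+d)^2-(B+E)^2)*((n+m)*(d+m)) = ((n+m)*(d+m)-E*B)^2"
  using assms unfolding ypoint_def by algebra
lemma preimage_sq2: fixes n :: "'a::idom" assumes "ypoint n m B E d e"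
  shows "((B+E)^2+(m+E-e)^2)*((n+m)*(2*n+m+B+e)) = ((m+B-e)*(n+m)+(2*n+m+B+e)*E)^2"
  using assms unfolding ypoint_def by algebra
lemma preimage_sq3: fixes n :: "'a::idom" assumes "ypoint n m B E d e"
  shows "(2*(n+d)^2-(m-B-e)^2)*((d+m)*(2*n+m+B+e)) = ((2*n+m+B+e)*(d+m)+(m+B-e)*B)^2"
  using assms unfolding ypoint_def by algebra
text \<open>Negating \<open>E\<close> and \<open>e\<close> leads to another preimage. The factor 8
  here and in the next identity says that its second and third resultants differ from the old ones
  by the class of 2.\<close>

lemma preimage_sq2_flip: fixes n :: "'a::idom" assumes "ypoint n m B E d e"
  shows "((B+E)^2+(m+E-e)^2)*((B-E)^2+(m-E+e)^2) = 8*(n^2-m*(m+B)-E*e)^2"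
  using assms unfolding ypoint_def by algebra
lemma preimage_sq3_flip: fixes n :: "'a::idom" assumes "ypoint n m B E d e"
  shows "(2*(n+d)^2-(m-B-e)^2)*(2*(n+d)^2-(m-B+e)^2) = 8*((m+B)*(n+d))^2"
  using assms unfolding ypoint_def by algebra

text \<open>E = 0 means that the form has a root at 0 or infinity. The Kummer equation then
  degenerates to a perfect square and determines B*(j-n). Unless B = 0,
  \<open>Q1 n m B j = w^2\<close> turns m^2 + B^2 = d^2 into (w/d)^4 + 1 = (d/B)^2.\<close>

lemma degenerate_E:
  fixes n m B j d e w :: rat
  assumes y: "ypoint n m B 0 d e" and K: "kummer n m B j = 0" and Q: "Q1 n m B j = w^2"
  shows "n = 0 \<and> m = 0 \<and> B = 0"
proof -
  have nm: "n = m \<or> n = -m" using y by (auto simp: ypoint_def power2_eq_iff)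
  have k: "B*(j-n) = m^2 \<and> n = -m \<or> B*(j-n) = -(m^2) \<and> n = m"
  proof -
    have "(B*(j-n) + m^2)^2 = 0" if "n = m" using K that unfolding kummer_def by algebra
    moreover have "(B*(j-n) - m^2)^2 = 0" if "n = -m" using K that unfolding kummer_def by algebra
    ultimately have "n = m \<Longrightarrow> B*(j-n) + m^2 = 0" "n = -m \<Longrightarrow> B*(j-n) - m^2 = 0" by simp_all
    then show ?thesis using nm by (auto simp: eq_neg_iff_add_eq_0)
  qed
  show ?thesis
  proof (cases "B = 0")
    case True
    then show ?thesis using k by auto
  next
    case False
    have "B * Q1 n m B j = - m*(m^2+B^2)" using k unfolding Q1_def by algebra
    then have Bw: "B * w^2 = - m * d^2" using Q y by (simp add: ypoint_def)
    have d0: "d \<noteq> 0" using y False by (auto simp: ypoint_def sum_power2_eq_zero_iff)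
    have e1: "(w/d)^2 = - m / B" using Bw False d0 by (simp add: field_simps)
    have "(w/d)^4 + 1 = ((w/d)^2)^2 + 1" by (simp flip: power_mult)
    also have "\<dots> = (d/B)^2" unfolding e1 using y False by (simp add: ypoint_def power_divide add_divide_distrib)
    finally have "w/d = 0" by (rule fermat_plus_rat)
    then have "w = 0" using d0 by simp
    then have "m = 0" using Bw d0 by simp
    then have "e^2 = -(B^2)" using y nm by (auto simp: ypoint_def)
    then have "e^2 + B^2 = 0" by simp
    then show ?thesis using False by (simp add: sum_power2_eq_zero_iff)
  qed
qed

text \<open>A form of discriminant zero is A*(x-u)^2, the divisor of a doubled point. The Kummer
  equation is then linear in \<open>j\<close>, and after substitution \<open>Q1\<close> becomes f(u)
  up to squares. So there is a rational point of the curve above \<open>u\<close>, and u = 1 or u =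
  -1; these give the torsion points (1 : 0 : -1 : 1) and (1 : 0 : 1 : 1).\<close>

lemma degenerate_disc:
  fixes n m B j w :: rat
  assumes nm: "n^2 \<noteq> m^2" and disc: "n^2 = m^2 + B^2" and K: "kummer n m B j = 0" and Q: "Q1 n m B j = w^2" "w \<noteq> 0"
  shows "m = 0 \<and> j = n \<and> B^2 = n^2"
proof -
  define A u where "A = (n+m)/2" and "u = - B/(n+m)"
  have s0: "n+m \<noteq> 0" using nm by (auto simp: add_eq_0_iff)
  then have A0: "A \<noteq> 0" by (simp add: A_def)
  have nn: "n = A*(1+u^2)" "m = A*(1-u^2)" "B = -2*A*u"
  proof -
    have B: "B = -u*(n+m)" using s0 by (simp add: u_def)
    have "(n+m)*(n-m) = (u*(n+m))^2" using disc B by algebra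
    then have "(n+m)*(n-m) = (n+m)*(u^2*(n+m))" by (simp add: power2_eq_square algebra_simps)
    then have "n-m = u^2*(n+m)" using s0 by simp
    then show "n = A*(1+u^2)" "m = A*(1-u^2)" "B = -2*A*u" using B by (simp_all add: A_def algebra_simps)
  qed
  define f where "f = - u*(u^2+1)*(u^2-2*u-1)"
  have u0: "u \<noteq> 0" using nm nn by auto
  have f0: "f \<noteq> 0"
  proof
    assume "f = 0"
    moreover have "u^2 + 1 \<noteq> 0" by (metis add.commute add_pos_nonneg less_irrefl zero_le_power2 zero_less_one)
    ultimately have "u^2-2*u-1 = 0" using u0 by (auto simp: f_def)
    then have "2*1^2 = (u-1)^2" by (simp add: power2_eq_square algebra_simps)
    then have "(1::rat) = 0" by (rule two_times_square_rat)
    then show False by simp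
  qed
  have "A^4 * ((1-u^2)*((1-u^2)*(1+u^2)^2 - 16*u^3)) = 4*f*A^3*(j-n)"
    using K unfolding kummer_def nn f_def by algebra
  then have kk: "A * ((1-u^2)*((1-u^2)*(1+u^2)^2 - 16*u^3)) = 4*f*(j-n)"
    using A0 by (simp add: power4_eq_xxxx power3_eq_cube mult.assoc)
  have "4*f*Q1 n m B j = (A*(1+u+8*u^2-u^4-u^5))^2"
    using kk unfolding Q1_def nn f_def by algebra
  then have e: "f * (2*w)^2 = (A*(1+u+8*u^2-u^4-u^5))^2" using Q by (simp add: power_mult_distrib algebra_simps)
  then have "f = (A*(1+u+8*u^2-u^4-u^5)/(2*w))^2" using Q by (simp add: power_divide field_simps)
  then have "u = 1 \<or> u = -1" using curve_rational_points u0 unfolding f_def by metis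
  then have "u^2 = 1" by auto
  then show ?thesis using kk nn f0 A0 by (auto simp: power_mult_distrib)
qed

lemma odd_square_mod_8: "odd x \<Longrightarrow> \<exists>k. x^2 = 8*k + 1" for x :: int
proof -
  assume "odd x"
  then obtain y where y: "x = 2*y+1" by (rule oddE)
  have "even (y*(y+1))" by simp
  then obtain k where "y*(y+1) = 2*k" by blast
  then have "x^2 = 8*k+1" unfolding y by (simp add: power2_eq_square algebra_simps)
  then show ?thesis by blast
qed

lemma ypoint_parity:
  fixes n :: int
  assumes y: "ypoint n m B E d e" and odd: "odd n \<or> odd m \<or> odd B"
  shows "odd n \<and> odd d \<and> (odd m \<and> even B \<or> even m \<and> odd B)"
proof -
  have sq: "x^2 mod 4 = (if even x then 0 else 1)" for x :: int
  proof (cases "even x")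
    case True
    then obtain k where "x = 2*k" by blast
    then show ?thesis by (simp add: power_mult_distrib)
  next
    case False
    then obtain k where "x^2 = 8*k+1" using odd_square_mod_8 by blast
    then have "x^2 mod 4 = 1" by presburger
    then show ?thesis using False by simp
  qed
  have "(E^2 mod 4 + m^2 mod 4) mod 4 = n^2 mod 4" "(m^2 mod 4 + B^2 mod 4) mod 4 = d^2 mod 4"
    "(e^2 mod 4 + (m+B)^2 mod 4) mod 4 = (2*(n^2 mod 4)) mod 4"
    using ypointD[OF y] by (simp_all add: mod_simps)
  then show ?thesis
    using odd unfolding sq by (auto split: if_splits)
qed

section \<open>Local conditions\<close>

lemma abs_square_if_multiplicities_even:
  fixes N :: int
  assumes "\<And>p. prime p \<Longrightarrow> even (multiplicity p N)"
  obtains x where "N = x^2 \<or> N = -(x^2)"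
proof -
  have "is_nth_power 2 (normalize N)"
    by (subst is_nth_power_conv_multiplicity) (use assms in auto)
  then obtain x where "\<bar>N\<bar> = x^2" by (auto simp: is_nth_power_def)
  then show thesis using that[of x] by linarith
qed

lemma multiplicity_square_cofactor:
  fixes a b c :: int
  assumes "prime p" "a * b = c^2" "c \<noteq> 0"
  shows "even (multiplicity p a) \<longleftrightarrow> even (multiplicity p b)"
proof -
  have "a \<noteq> 0" "b \<noteq> 0" using assms by auto
  then have "multiplicity p a + multiplicity p b = 2 * multiplicity p c"
    using assms by (metis prime_elem_multiplicity_mult_distrib prime_elem_multiplicity_power_distrib prime_imp_prime_elem)
  then show ?thesis by presburger
qed

lemma odd_multiplicity_dvd: "odd (multiplicity p a) \<Longrightarrow> p dvd a" for p a :: int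
  by (metis even_zero not_dvd_imp_multiplicity_0)

lemma square_or_double_if_odd_multiplicities_even:
  fixes N :: int
  assumes "N \<noteq> 0" "\<And>p. prime p \<Longrightarrow> odd p \<Longrightarrow> even (multiplicity p N)"
  obtains x where "N = x^2 \<or> N = -(x^2) \<or> N = 2*x^2 \<or> N = -(2*x^2)"
proof (cases "even (multiplicity 2 N)")
  case True
  have "even (multiplicity p N)" if "prime p" for p
  proof (cases "odd p")
    case False
    then have "p = 2" using that by (metis dvd_refl primes_dvd_imp_eq two_is_prime_nat prime_int_numeral_eq)
    then show ?thesis using True by simp
  qed (use assms that in auto)
  then obtain x where "N = x^2 \<or> N = -(x^2)" using abs_square_if_multiplicities_even by blast
  then show thesis using that by blast
next
  case False
  have "even (multiplicity p (2*N))" if p: "prime p" for p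
  proof -
    have m: "multiplicity p (2*N) = multiplicity p 2 + multiplicity p N"
      by (subst prime_elem_multiplicity_mult_distrib) (use p assms(1) in auto)
    show ?thesis
    proof (cases "odd p")
      case True
      then have "\<not> p dvd 2" by (metis p dvd_refl primes_dvd_imp_eq two_is_prime_nat prime_int_numeral_eq)
      then show ?thesis using m assms(2)[OF p True] by (simp add: not_dvd_imp_multiplicity_0)
    next
      case e: False
      then have "p = 2" using p by (metis dvd_refl primes_dvd_imp_eq two_is_prime_nat prime_int_numeral_eq)
      then show ?thesis using m False by simp
    qed
  qed
  then obtain x where x: "2*N = x^2 \<or> 2*N = -(x^2)" using abs_square_if_multiplicities_even by blast
  then have "even (x^2)" by (metis dvd_minus_iff dvd_triv_left)
  then obtain y where "x = 2*y" by auto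
  then have "N = 2*y^2 \<or> N = -(2*y^2)" using x by (auto simp: power_mult_distrib)
  then show thesis using that by blast
qed

text \<open>One of x+y and x-y is twice an odd number; since the product is a square, the
  multiplicity of 2 in the other is odd as well.\<close>

lemma odd_multiplicity_2:
  fixes x y z :: int
  assumes "(x+y)*(x-y) = z^2" "odd x" "odd y" "x+y \<noteq> 0"
  shows "odd (multiplicity 2 (x+y))"
proof -
  have one: "multiplicity 2 (2*s) = 1" if "odd s" for s :: int
    using that by (metis multiplicity_times_same not_dvd_imp_multiplicity_0 One_nat_def not_is_unit_0 even_zero zero_neq_numeral prime_int_numeral_eq not_prime_unit two_is_prime_nat)
  obtain s where s: "x+y = 2*s" using assms(2,3) by (metis evenE odd_even_add)
  show ?thesis
  proof (cases "odd s")
    case True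
    then show ?thesis using one s by simp
  next
    case False
    have xy: "x - y = 2*(x-s)" using s by simp
    have ox: "odd (x-s)" using False assms(2) by simp
    have m1: "multiplicity 2 (x-y) = 1" unfolding xy by (rule one[OF ox])
    have "x - s \<noteq> 0" using ox by (metis even_zero)
    then have "x - y \<noteq> 0" using xy by simp
    note m = m1 this
    then have "z \<noteq> 0" using assms by auto
    moreover have "prime (2::int)" by simp
    ultimately show ?thesis using multiplicity_square_cofactor[of 2 "x+y" "x-y" z] assms(1) m by simp
  qed
qed

context
  fixes n m B E d e w :: int
  assumes y: "ypoint n m B E d e"
    and prim: "\<And>p. prime p \<Longrightarrow> p dvd n \<Longrightarrow> p dvd m \<Longrightarrow> p dvd B \<Longrightarrow> False"
    and w: "w^2 = 2*((B+E)*(B-m+e)*(d-n)*(n+m)*(d+m)*(2*n+m+B+e))" "w \<noteq> 0"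
    and E0: "E \<noteq> 0"
begin

lemmas point_eqs = ypointD[OF y]

text \<open>
  With \<open>c1 = n + m\<close>, \<open>c2 = d + m\<close>, \<open>c3 = 2n + m + B + e\<close> the obstructions to the existence of a
  rational preimage are the square classes of \<open>c1 c2\<close> and \<open>c1 c3\<close>. An odd prime that occurs to an odd
  power in one of \<open>c1\<close>, \<open>c2\<close>, \<open>c3\<close> would divide another factor of \<open>w^2\<close> and then all of \<open>n\<close>, \<open>m\<close>, \<open>B\<close>.
\<close>

lemma c3_eq: "(2*n+m+B+e)*(2*n+m+B-e) = 2*(n+m+B)^2" using point_eqs by algebra

lemma prime_dvd_squareD: "prime p \<Longrightarrow> p dvd x^2 \<Longrightarrow> p dvd x" for p x :: int using prime_dvd_power by blast
lemma odd_prime_dvd_double_squareD: "prime p \<Longrightarrow> odd p \<Longrightarrow> p dvd 2*x^2 \<Longrightarrow> p dvd x" for p x :: int using odd_dvd_doubleD prime_dvd_squareD by blast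

lemma prime_dvd_cofactor:
  assumes p: "prime p" "odd p" and m: "odd (multiplicity p a)" and r: "w^2 = a * (2*r)"
  shows "p dvd r"
proof -
  have "odd (multiplicity p (2*r))" using multiplicity_square_cofactor[of p a "2*r" w] p m r w(2) by metis
  then have "p dvd 2*r" by (rule odd_multiplicity_dvd)
  then show ?thesis using p odd_dvd_doubleD by blast
qed

lemma even_multiplicity_c1: assumes p: "prime p" "odd p" shows "even (multiplicity p (n+m))"
proof (rule ccontr)
  assume o: "odd (multiplicity p (n+m))"
  have "(n+m)*(n-m) = E^2" using point_eqs by algebra
  then have "odd (multiplicity p (n-m))" using o multiplicity_square_cofactor[OF p(1)] E0 by metis
  then have d: "p dvd n+m" "p dvd n-m" using o odd_multiplicity_dvd by blast+
  have "p dvd (n+m)+(n-m)" "p dvd (n+m)-(n-m)" using d dvd_add dvd_diff by blast+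
  then have "p dvd 2*n" "p dvd 2*m" by simp_all
  then have pn: "p dvd n" and pm: "p dvd m" using p odd_dvd_doubleD by blast+
  have pE: "p dvd E"
  proof -
    have "p dvd n^2 - m^2" using pn pm by (simp add: power2_eq_square)
    then show ?thesis using point_eqs(1) prime_dvd_squareD p(1) by metis
  qed
  have nB: "\<not> p dvd B" using prim p(1) pn pm by blast
  \<comment> \<open>Modulo \<open>p\<close> now \<open>n\<close>, \<open>m\<close> and
    \<open>E\<close> vanish, and divisibility of any remaining factor of \<open>w^2\<close> forces
    \<open>p dvd B\<close>.\<close>
  have "p dvd (B+E)*(B-m+e)*(d-n)*(d+m)*(2*n+m+B+e)"
    by (rule prime_dvd_cofactor[OF p o]) (simp add: w algebra_simps)
  then consider "p dvd B+E" | "p dvd B-m+e" | "p dvd d-n" | "p dvd d+m" | "p dvd 2*n+m+B+e"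
    using p(1) by (auto simp: prime_dvd_mult_iff)
  then show False
  proof cases
    case 1 then show False using pE nB by (simp add: dvd_add_left_iff)
  next
    case 2
    have "2*B^2 = (B-m+e)*(B-m-e) + n*(2*n) - m*(2*m)" using point_eqs by algebra
    then have "p dvd 2*B^2" using 2 pn pm by simp
    then show False using odd_prime_dvd_double_squareD p nB by blast
  next
    case 3
    then have "p dvd d" using pn by (metis dvd_add diff_add_cancel)
    moreover have "B^2 = d*d - m*m" using point_eqs by algebra
    ultimately have "p dvd B^2" using pm by simp
    then show False using prime_dvd_squareD p nB by blast
  next
    case 4
    then have "p dvd d" using pm by (simp add: dvd_add_left_iff)
    moreover have "B^2 = d*d - m*m" using point_eqs by algebra
    ultimately have "p dvd B^2" using pm by simp
    then show False using prime_dvd_squareD p nB by blast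
  next
    case 5
    then have "p dvd 2*(n+m+B)^2" by (metis c3_eq dvd_mult2)
    then have "p dvd (n+m)+B" using odd_prime_dvd_double_squareD p by blast
    then show False using d nB by (simp add: dvd_add_right_iff)
  qed
qed

lemma even_multiplicity_c2: assumes p: "prime p" "odd p" shows "even (multiplicity p (d+m))"
\<comment> \<open>For B = 0 the product (d+m)*(d-m) is 0 and multiplicities in it say nothing, but
  then d = m and c2 is simply 2*m.\<close>
proof (cases "B = 0")
  case True
  have pnm: "\<not> (p dvd n \<and> p dvd m)" using prim p True by auto
  have "(d+m)*(d-m) = 0" using point_eqs True by algebra
  moreover have "d+m \<noteq> 0" using w by auto
  ultimately have dm: "d = m" by simp
  show ?thesis
  proof (rule ccontr)
    assume o: "odd (multiplicity p (d+m))"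
    then have "p dvd 2*m" using odd_multiplicity_dvd dm by fastforce
    then have pm: "p dvd m" using p odd_dvd_doubleD by blast
    then have pn: "\<not> p dvd n" using pnm by blast
    have "p dvd (B+E)*(B-m+e)*(d-n)*(n+m)*(2*n+m+B+e)"
      by (rule prime_dvd_cofactor[OF p o]) (simp add: w algebra_simps)
    then consider "p dvd B+E" | "p dvd B-m+e" | "p dvd d-n" | "p dvd n+m" | "p dvd 2*n+m+B+e"
      using p(1) by (auto simp: prime_dvd_mult_iff)
    then show False
    proof cases
      case 1
      moreover have "n^2 = (B+E)*E + m*m" using point_eqs True by algebra
      ultimately have "p dvd n^2" using pm by simp
      then show False using prime_dvd_squareD p pn by blast
    next
      case 2
      then have "p dvd (B-m+e)+m" using pm dvd_add by blast
      then have "p dvd e" using True by simp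
      moreover have "2*n^2 = e*e + m*m" using point_eqs True by algebra
      ultimately have "p dvd 2*n^2" using pm by simp
      then show False using odd_prime_dvd_double_squareD p pn by blast
    next
      case 3 then show False using pm pn dm by (metis dvd_diff_commute dvd_add diff_add_cancel)
    next
      case 4 then show False using pm pn by (simp add: dvd_add_left_iff)
    next
      case 5
      then have "p dvd 2*(n+m+B)^2" by (metis c3_eq dvd_mult2)
      then have "p dvd n+m+B" using odd_prime_dvd_double_squareD p by blast
      then show False using pm pn True by (simp add: dvd_add_left_iff)
    qed
  qed
next
  case B0: False
  show ?thesis
  proof (rule ccontr)
    assume o: "odd (multiplicity p (d+m))"
    have "(d+m)*(d-m) = B^2" using point_eqs by algebra
    then have "odd (multiplicity p (d-m))" using o multiplicity_square_cofactor[OF p(1)] B0 by metis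
    then have d: "p dvd d+m" "p dvd d-m" using o odd_multiplicity_dvd by blast+
    have "p dvd (d+m)+(d-m)" "p dvd (d+m)-(d-m)" using d dvd_add dvd_diff by blast+
    then have "p dvd 2*d" "p dvd 2*m" by simp_all
    then have pd: "p dvd d" and pm: "p dvd m" using p odd_dvd_doubleD by blast+
    have "B^2 = d*d - m*m" using point_eqs by algebra
    then have "p dvd B^2" using pd pm by simp
    then have pB: "p dvd B" using prime_dvd_squareD p by blast
    then have pn: "\<not> p dvd n" using prim pm p by blast
    have "p dvd (B+E)*(B-m+e)*(d-n)*(n+m)*(2*n+m+B+e)"
      by (rule prime_dvd_cofactor[OF p o]) (simp add: w algebra_simps)
    then consider "p dvd B+E" | "p dvd B-m+e" | "p dvd d-n" | "p dvd n+m" | "p dvd 2*n+m+B+e"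
      using p(1) by (auto simp: prime_dvd_mult_iff)
    then show False
    proof cases
      case 1
      moreover have "n^2 = (B+E)*(E-B) + B*B + m*m" using point_eqs by algebra
      ultimately have "p dvd n^2" using pm pB by simp
      then show False using prime_dvd_squareD p pn by blast
    next
      case 2
      moreover have "2*n^2 = (B-m+e)*(e-B+m) + 2*(B*B) + 2*(m*m)" using point_eqs by algebra
      ultimately have "p dvd 2*n^2" using pm pB by simp
      then show False using odd_prime_dvd_double_squareD p pn by blast
    next
      case 3 then show False using pd pn by (metis dvd_diff_right_iff dvd_diff_commute)
    next
      case 4 then show False using pm pn by (simp add: dvd_add_left_iff)
    next
      case 5
      then have "p dvd 2*(n+m+B)^2" by (metis c3_eq dvd_mult2)
      then have "p dvd n+m+B" using odd_prime_dvd_double_squareD p by blast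
      then show False using pm pn pB by (simp add: dvd_add_left_iff)
    qed
  qed
qed

lemma even_multiplicity_c3: assumes p: "prime p" "odd p" shows "even (multiplicity p (2*n+m+B+e))"
proof (rule ccontr)
  assume o: "odd (multiplicity p (2*n+m+B+e))"
  then have d1: "p dvd 2*n+m+B+e" by (rule odd_multiplicity_dvd)
  then have "p dvd 2*(n+m+B)^2" by (metis c3_eq dvd_mult2)
  then have pb: "p dvd n+m+B" using odd_prime_dvd_double_squareD p by blast
  have d2: "p dvd 2*n+m+B-e"
  proof (cases "n+m+B = 0")
    case True
    then have "(2*n+m+B+e)*(2*n+m+B-e) = 0" using c3_eq by simp
    moreover have "2*n+m+B+e \<noteq> 0" using w by auto
    ultimately show ?thesis by simp
  next
    case False
    have "(2*(2*n+m+B+e))*(2*n+m+B-e) = (2*(n+m+B))^2" using c3_eq by algebra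
    moreover have "odd (multiplicity p (2*(2*n+m+B+e)))"
    proof -
      have "\<not> p dvd 2" by (metis p dvd_refl primes_dvd_imp_eq two_is_prime_nat prime_int_numeral_eq)
      moreover have "2*n+m+B+e \<noteq> 0" using w by auto
      ultimately show ?thesis
        by (subst prime_elem_multiplicity_mult_distrib) (use o p(1) in \<open>auto simp: not_dvd_imp_multiplicity_0\<close>)
    qed
    ultimately have "odd (multiplicity p (2*n+m+B-e))"
      using multiplicity_square_cofactor[OF p(1)] False by (metis mult_eq_0_iff zero_neq_numeral)
    then show ?thesis by (rule odd_multiplicity_dvd)
  qed
  have "p dvd (2*n+m+B+e)-(2*n+m+B-e)" using d1 d2 by (rule dvd_diff)
  then have "p dvd 2*e" by simp
  then have pe: "p dvd e" using p odd_dvd_doubleD by blast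
  have "p dvd (2*n+m+B+e) - (n+m+B) - e" using d1 pb pe dvd_diff by blast
  then have pn: "p dvd n" by simp
  have "p dvd (n+m+B) - n" using pb pn by (rule dvd_diff)
  then have pmB: "p dvd m+B" by (simp add: add.commute)
  have contra: False if "p dvd m"
  proof -
    have "p dvd B" using pmB that by (simp add: dvd_add_right_iff)
    then show False using prim p that pn by blast
  qed
  have "p dvd (B+E)*(B-m+e)*(d-n)*(n+m)*(d+m)"
    by (rule prime_dvd_cofactor[OF p o]) (simp add: w algebra_simps)
  then consider "p dvd B+E" | "p dvd B-m+e" | "p dvd d-n" | "p dvd n+m" | "p dvd d+m"
    using p(1) by (auto simp: prime_dvd_mult_iff)
  then show False
  proof cases
    case 1
    moreover have "2*m^2 = n*n - (B+E)*(E-B) - (m+B)*(B-m)" using point_eqs by algebra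
    ultimately have "p dvd 2*m^2" using pn pmB by simp
    then show False using odd_prime_dvd_double_squareD p contra by blast
  next
    case 2
    have "p dvd (m+B) - (B-m+e) + e" using dvd_add[OF dvd_diff[OF pmB 2] pe] .
    then have "p dvd 2*m" by simp
    then show False using p odd_dvd_doubleD contra by blast
  next
    case 3
    then have "p dvd d" using pn by (metis dvd_add diff_add_cancel)
    moreover have "2*m^2 = d*d - (m+B)*(B-m)" using point_eqs by algebra
    ultimately have "p dvd 2*m^2" using pmB by simp
    then show False using odd_prime_dvd_double_squareD p contra by blast
  next
    case 4 then show False using pn contra by (simp add: dvd_add_right_iff)
  next
    case 5
    have "B^2 = (d+m)*(d-m)" using point_eqs by algebra
    then have "p dvd B^2" using 5 by simp
    then have "p dvd B" using prime_dvd_squareD p by blast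
    then show False using pmB contra by (simp add: dvd_add_left_iff)
  qed
qed

lemma parity_type: "odd n \<and> odd d \<and> (odd m \<and> even B \<or> even m \<and> odd B)"
  using ypoint_parity[OF y] prim[of 2] by auto

text \<open>At the prime 2 the parity pattern decides: for odd \<open>m\<close> both factors have
  odd multiplicity by \<open>odd_multiplicity_2\<close>, for even \<open>m\<close> both are odd
  numbers.\<close>

lemma c1_c2_square: "\<exists>x. (n+m)*(d+m) = x^2 \<or> (n+m)*(d+m) = -(x^2)"
proof -
  have nz: "n+m \<noteq> 0" "d+m \<noteq> 0" using w by auto
  have "even (multiplicity p ((n+m)*(d+m)))" if p: "prime p" for p
  proof -
    have s: "multiplicity p ((n+m)*(d+m)) = multiplicity p (n+m) + multiplicity p (d+m)"
      by (subst prime_elem_multiplicity_mult_distrib) (use p nz in auto)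
    show ?thesis
    proof (cases "odd p")
      case True
      then show ?thesis using s even_multiplicity_c1 even_multiplicity_c2 p by simp
    next
      case False
      then have p2: "p = 2" using p by (metis dvd_refl primes_dvd_imp_eq two_is_prime_nat prime_int_numeral_eq)
      from parity_type consider "odd n" "odd d" "odd m" | "odd n" "odd d" "even m" by blast
      then show ?thesis
      proof cases
        case 1
        have "(n+m)*(n-m) = E^2" "(d+m)*(d-m) = B^2" using point_eqs by algebra+
        then have "odd (multiplicity 2 (n+m))" "odd (multiplicity 2 (d+m))"
          using odd_multiplicity_2 1 nz by blast+
        then show ?thesis using s p2 by simp
      next
        case 2
        then show ?thesis using s p2 by (simp add: not_dvd_imp_multiplicity_0)
      qed
    qed
  qed
  then show ?thesis using abs_square_if_multiplicities_even by metis
qed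

text \<open>The multiplicity of 2 in c3 is not controlled here, so the class of 2 remains possible.
  It is absorbed later by the choice of another preimage.\<close>

lemma c1_c3_square_or_double: "\<exists>x. (n+m)*(2*n+m+B+e) = x^2 \<or> (n+m)*(2*n+m+B+e) = -(x^2)
    \<or> (n+m)*(2*n+m+B+e) = 2*x^2 \<or> (n+m)*(2*n+m+B+e) = -(2*x^2)"
proof -
  have nz: "n+m \<noteq> 0" "2*n+m+B+e \<noteq> 0" using w by auto
  have "even (multiplicity p ((n+m)*(2*n+m+B+e)))" if p: "prime p" "odd p" for p
  proof -
    have "multiplicity p ((n+m)*(2*n+m+B+e)) = multiplicity p (n+m) + multiplicity p (2*n+m+B+e)"
      by (subst prime_elem_multiplicity_mult_distrib) (use p nz in auto)
    then show ?thesis using even_multiplicity_c1 even_multiplicity_c3 p by simp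
  qed
  then show ?thesis using square_or_double_if_odd_multiplicities_even nz by (metis mult_eq_0_iff)
qed

end

section \<open>The descent step\<close>

lemma rat_quadruple_primitive:
  fixes a b c d :: rat
  assumes "a \<noteq> 0"
  obtains l a' b' c' d' where "l \<noteq> 0" "a = l * of_int a'" "b = l * of_int b'" "c = l * of_int c'" "d = l * of_int d'"
    "\<And>p. prime p \<Longrightarrow> p dvd a' \<Longrightarrow> p dvd b' \<Longrightarrow> p dvd c' \<Longrightarrow> p dvd d' \<Longrightarrow> False"
proof -
  obtain a1 a2 where a: "a = of_int a1 / of_int a2" "a2 > 0" by (metis rat_coprime_quotient)
  obtain b1 b2 where b: "b = of_int b1 / of_int b2" "b2 > 0" by (metis rat_coprime_quotient)
  obtain c1 c2 where c: "c = of_int c1 / of_int c2" "c2 > 0" by (metis rat_coprime_quotient)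
  obtain d1 d2 where d: "d = of_int d1 / of_int d2" "d2 > 0" by (metis rat_coprime_quotient)
  define D where "D = a2*b2*c2*d2"
  define A where "A = a1*b2*c2*d2"
  define B where "B = a2*b1*c2*d2"
  define C where "C = a2*b2*c1*d2"
  define E where "E = a2*b2*c2*d1"
  define g where "g = gcd (gcd A B) (gcd C E)"
  have "A \<noteq> 0" using assms a b c d by (auto simp: A_def)
  then have g0: "g \<noteq> 0" by (simp add: g_def)
  have "g dvd A" "g dvd B" "g dvd C" "g dvd E" unfolding g_def by (meson dvd_trans gcd_dvd1 gcd_dvd2)+
  then obtain a' b' c' d' where q: "A = g*a'" "B = g*b'" "C = g*c'" "E = g*d'" by (elim dvdE) blast
  have D0: "D \<noteq> 0" using a b c d by (simp add: D_def)
  show thesis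
  proof (rule that[of "of_int g / of_int D" a' b' c' d'])
    show "(of_int g :: rat) / of_int D \<noteq> 0" using g0 D0 by simp
    have "of_int g / of_int D * of_int a' = (of_int A :: rat) / of_int D" "of_int g / of_int D * of_int b' = (of_int B :: rat) / of_int D"
      "of_int g / of_int D * of_int c' = (of_int C :: rat) / of_int D" "of_int g / of_int D * of_int d' = (of_int E :: rat) / of_int D"
      by (simp_all add: q)
    then show "a = of_int g / of_int D * of_int a'" "b = of_int g / of_int D * of_int b'"
      "c = of_int g / of_int D * of_int c'" "d = of_int g / of_int D * of_int d'"
      using a b c d by (simp_all add: A_def B_def C_def E_def D_def field_simps)
    fix p :: int assume p: "prime p" "p dvd a'" "p dvd b'" "p dvd c'" "p dvd d'"
    have "g * p dvd A" "g * p dvd B" "g * p dvd C" "g * p dvd E"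
      unfolding q using p by (simp_all add: mult_dvd_mono)
    then have "g * p dvd gcd (gcd A B) (gcd C E)" by (intro gcd_greatest)
    then have "g * p dvd g" by (simp only: g_def [symmetric])
    then have "is_unit p" using g0 by simp
    then show False using p(1) by auto
  qed
qed

context
  fixes n m B E d e v :: rat
  assumes y: "ypoint n m B E d e" and v: "v^2 = 2*((B+E)*(B-m+e)*(d-n)*(n+m)*(d+m)*(2*n+m+B+e))" "v \<noteq> 0" and E0: "E \<noteq> 0"
begin

text \<open>Only \<open>n\<close>, \<open>m\<close>, \<open>B\<close> have to be scaled to a
  primitive integer triple: \<open>E\<close>, \<open>d\<close>, \<open>e\<close> and
  \<open>v\<close> become integers because their squares do.\<close>

lemma scaled_point:
  obtains l n' m' B' E' d' e' v' where "l \<noteq> 0" "n = l * of_int n'" "m = l * of_int m'" "B = l * of_int B'"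
     "E = l * of_int E'" "d = l * of_int d'" "e = l * of_int e'"
     "ypoint n' m' B' E' d' e'" "\<And>p. prime p \<Longrightarrow> p dvd n' \<Longrightarrow> p dvd m' \<Longrightarrow> p dvd B' \<Longrightarrow> False"
     "v'^2 = 2*((B'+E')*(B'-m'+e')*(d'-n')*(n'+m')*(d'+m')*(2*n'+m'+B'+e'))" "v' \<noteq> 0" "E' \<noteq> 0"
proof -
  note yc = ypointD[OF y]
  have "n \<noteq> 0" by (rule ypoint_n_nonzero[OF y E0])
  then obtain l n' m' B' where l: "l \<noteq> 0" "n = l * of_int n'" "m = l * of_int m'" "B = l * of_int B'"
     and pr: "\<And>p. prime p \<Longrightarrow> p dvd n' \<Longrightarrow> p dvd m' \<Longrightarrow> p dvd B' \<Longrightarrow> False"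

  proof -
    obtain l n' m' B' z where q: "l \<noteq> 0" "n = l * of_int n'" "m = l * of_int m'" "B = l * of_int B'" "0 = l * of_int z"
      "\<And>p. prime p \<Longrightarrow> p dvd n' \<Longrightarrow> p dvd m' \<Longrightarrow> p dvd B' \<Longrightarrow> p dvd z \<Longrightarrow> False"
      using rat_quadruple_primitive[of n m B 0] \<open>n \<noteq> 0\<close> by blast
    then have "z = 0" by simp
    then show thesis using that[of l n' m' B'] q by auto
  qed
  have q: "of_int (n'^2 - m'^2) = (E/l)^2" "of_int (m'^2 + B'^2) = (d/l)^2" "of_int (2*n'^2-(m'+B')^2) = (e/l)^2"
  proof -
    have "E^2 = l^2 * of_int (n'^2 - m'^2)" "d^2 = l^2 * of_int (m'^2 + B'^2)" "e^2 = l^2 * of_int (2*n'^2-(m'+B')^2)"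
      unfolding yc l by (simp_all add: power2_eq_square algebra_simps)
    then show "of_int (n'^2 - m'^2) = (E/l)^2" "of_int (m'^2 + B'^2) = (d/l)^2" "of_int (2*n'^2-(m'+B')^2) = (e/l)^2"
      using l(1) by (simp_all only: power_divide) simp_all
  qed
  obtain E' where i1: "n'^2 - m'^2 = E'^2" "E/l = of_int E'" using q(1) by (rule rat_square_of_int)
  obtain d' where i2: "m'^2+B'^2 = d'^2" "d/l = of_int d'" using q(2) by (rule rat_square_of_int)
  obtain e' where i3: "2*n'^2-(m'+B')^2 = e'^2" "e/l = of_int e'" using q(3) by (rule rat_square_of_int)
  note i = i1 i2 i3
  then have s: "E = l * of_int E'" "d = l * of_int d'" "e = l * of_int e'" using l(1) by (simp_all add: field_simps)
  have "of_int (2*((B'+E')*(B'-m'+e')*(d'-n')*(n'+m')*(d'+m')*(2*n'+m'+B'+e'))) = (v/l^3)^2"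
  proof -
    have "v^2 = (l^3)^2 * of_int (2*((B'+E')*(B'-m'+e')*(d'-n')*(n'+m')*(d'+m')*(2*n'+m'+B'+e')))"
      unfolding v(1) l s by simp algebra
    then show ?thesis using l(1) by (simp add: power_divide field_simps)
  qed
  then obtain v' where v': "2*((B'+E')*(B'-m'+e')*(d'-n')*(n'+m')*(d'+m')*(2*n'+m'+B'+e')) = v'^2" "v/l^3 = of_int v'"
    by (rule rat_square_of_int)
  have "v' \<noteq> 0" using v'(2) v(2) l(1) by auto
  moreover have "E' \<noteq> 0" using s E0 by auto
  moreover have "ypoint n' m' B' E' d' e'" using i by (simp add: ypoint_def)
  ultimately show thesis by (intro that[of l n' m' B' E' d' e' v']) (use l s pr v'(1) in auto)
qed

lemma c1_c2_square_rat: "\<exists>x. (n+m)*(d+m) = x^2 \<or> (n+m)*(d+m) = -(x^2)"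
proof -
  obtain l n' m' B' E' d' e' v' where s: "l \<noteq> 0" "n = l * of_int n'" "m = l * of_int m'" "B = l * of_int B'"
     "E = l * of_int E'" "d = l * of_int d'" "e = l * of_int e'"
     and pt: "ypoint n' m' B' E' d' e'" "\<And>p. prime p \<Longrightarrow> p dvd n' \<Longrightarrow> p dvd m' \<Longrightarrow> p dvd B' \<Longrightarrow> False"
     "v'^2 = 2*((B'+E')*(B'-m'+e')*(d'-n')*(n'+m')*(d'+m')*(2*n'+m'+B'+e'))" "v' \<noteq> 0" "E' \<noteq> 0"
    using scaled_point by blast
  obtain x where "(n'+m')*(d'+m') = x^2 \<or> (n'+m')*(d'+m') = -(x^2)"
  proof -
    have "\<exists>x. (n'+m')*(d'+m') = x^2 \<or> (n'+m')*(d'+m') = -(x^2)"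
      by (rule c1_c2_square[of n' m' B' E' d' e' v']) (use pt in auto)
    then show thesis using that by blast
  qed
  moreover define N where "N = (n'+m')*(d'+m')"
  ultimately have N: "N = x^2 \<or> N = -(x^2)" by simp
  have "(n+m)*(d+m) = l^2 * of_int N" using s by (simp add: N_def power2_eq_square algebra_simps)
  then have "(n+m)*(d+m) = (l * of_int x)^2 \<or> (n+m)*(d+m) = -((l * of_int x)^2)"
    using N by (auto simp: power_mult_distrib)
  then show ?thesis by blast
qed

lemma c1_c3_square_or_double_rat: "\<exists>x. (n+m)*(2*n+m+B+e) = x^2 \<or> (n+m)*(2*n+m+B+e) = -(x^2)
    \<or> (n+m)*(2*n+m+B+e) = 2*x^2 \<or> (n+m)*(2*n+m+B+e) = -(2*x^2)"
proof -
  obtain l n' m' B' E' d' e' v' where s: "l \<noteq> 0" "n = l * of_int n'" "m = l * of_int m'" "B = l * of_int B'"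
     "E = l * of_int E'" "d = l * of_int d'" "e = l * of_int e'"
     and pt: "ypoint n' m' B' E' d' e'" "\<And>p. prime p \<Longrightarrow> p dvd n' \<Longrightarrow> p dvd m' \<Longrightarrow> p dvd B' \<Longrightarrow> False"
     "v'^2 = 2*((B'+E')*(B'-m'+e')*(d'-n')*(n'+m')*(d'+m')*(2*n'+m'+B'+e'))" "v' \<noteq> 0" "E' \<noteq> 0"
    using scaled_point by blast
  obtain x where "(n'+m')*(2*n'+m'+B'+e') = x^2 \<or> (n'+m')*(2*n'+m'+B'+e') = -(x^2)
    \<or> (n'+m')*(2*n'+m'+B'+e') = 2*x^2 \<or> (n'+m')*(2*n'+m'+B'+e') = -(2*x^2)"
  proof -
    have "\<exists>x. (n'+m')*(2*n'+m'+B'+e') = x^2 \<or> (n'+m')*(2*n'+m'+B'+e') = -(x^2)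
    \<or> (n'+m')*(2*n'+m'+B'+e') = 2*x^2 \<or> (n'+m')*(2*n'+m'+B'+e') = -(2*x^2)"
      by (rule c1_c3_square_or_double[of n' m' B' E' d' e' v']) (use pt in auto)
    then show thesis using that by blast
  qed
  moreover define N where "N = (n'+m')*(2*n'+m'+B'+e')"
  ultimately have N: "N = x^2 \<or> N = -(x^2) \<or> N = 2*x^2 \<or> N = -(2*x^2)" by simp
  have "(n+m)*(2*n+m+B+e) = l^2 * of_int N" using s by (simp add: N_def power2_eq_square algebra_simps)
  then have "(n+m)*(2*n+m+B+e) = (l * of_int x)^2 \<or> (n+m)*(2*n+m+B+e) = -((l * of_int x)^2)
    \<or> (n+m)*(2*n+m+B+e) = 2*(l * of_int x)^2 \<or> (n+m)*(2*n+m+B+e) = -(2*(l * of_int x)^2)"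
    using N by (auto simp: power_mult_distrib)
  then show ?thesis by blast
qed

end

text \<open>The property that is passed to preimages. \<open>kummer\<close> alone determines
  \<open>E*d*e\<close> only up to sign; the equation for \<open>j\<close> fixes the sign as
  \<open>preimage_F\<close> needs it. The inequalities exclude doubled points and forms with a root
  at 0 or infinity.\<close>

definition descent_point :: "rat \<Rightarrow> rat \<Rightarrow> rat \<Rightarrow> rat \<Rightarrow> bool" where
  "descent_point n m B j \<longleftrightarrow> (\<exists>E d e w. ypoint n m B E d e \<and> j*(d^2-n^2) = n*B*(B-m) + E*d*e \<and> d^2 \<noteq> n^2
      \<and> E \<noteq> 0 \<and> Q1 n m B j = w^2 \<and> w \<noteq> 0)"

text \<open>Besides the squares, nondegeneracy has to be inherited. If the preimage had E' = 0 or
  discriminant zero, \<open>degenerate_E\<close> and \<open>degenerate_disc\<close> would make it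
  the origin or a torsion point, and applying \<open>F\<close> would give d^2 = n^2 for the given
  point.\<close>

lemma descent_pointI_preimage:
  fixes n m B j :: rat
  assumes y: "ypoint n m B E d e" and r: "j*(d^2-n^2) = n*B*(B-m) + E*d*e" "d^2 \<noteq> n^2"
    and J: "J*(d-n) = (B+E)*(B-m+e)" "2*J*(n+m) = w^2" "w \<noteq> 0"
    and sq: "(n+d)^2 - (B+E)^2 = E'^2" "(B+E)^2 + (m+E-e)^2 = d'^2" "2*(n+d)^2 - (m-B-e)^2 = e'^2"
  shows "descent_point (n+d) (-(B+E)) (m+E-e) J"
proof -
  have dn: "d \<noteq> n" using r(2) by auto
  have J0: "J \<noteq> 0" using J by auto
  define n' m' B' where "n' = n+d" and "m' = -(B+E)" and "B' = m+E-e"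
  have K: "kummer n' m' B' J = 0" using preimage_kummer[OF y J(1) dn] by (simp add: n'_def m'_def B'_def)
  have Q: "Q1 n' m' B' J = w^2" using preimage_F(5)[OF y J(1) dn] J(2) by (simp add: n'_def m'_def B'_def)
  have F: "Fn n' m' B' J = 4*J*n" "Fm n' m' B' J = 4*J*m" "FB n' m' B' J = 4*J*B"
    using preimage_F(1-3)[OF y J(1) dn] by (simp_all add: n'_def m'_def B'_def)
  have y': "ypoint n' m' B' E' d' e'"
  proof -
    have "m' + B' = m-B-e" by (simp add: m'_def B'_def)
    moreover have "m'^2 = (B+E)^2" unfolding m'_def by (rule power2_minus)
    ultimately show ?thesis unfolding ypoint_def by (simp only: sq n'_def B'_def)
  qed
  then have yc: "E'^2 = n'^2 - m'^2" "d'^2 = m'^2 + B'^2" "e'^2 = 2*n'^2 - (m'+B')^2" by (auto simp: ypoint_def)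
  have E'0: "E' \<noteq> 0"
  proof
    assume "E' = 0"
    then have z: "n' = 0" "m' = 0" "B' = 0" using degenerate_E[OF _ K Q] y' by auto
    then have "n = 0" "m = 0" "B = 0" using F J0 by (auto simp: F_defs)
    then show False using r(2) y by (simp add: ypoint_def)
  qed
  have K2: "d'^2 \<noteq> n'^2"
  proof
    assume a: "d'^2 = n'^2"
    have "n'^2 \<noteq> m'^2" using yc(1) E'0 by auto
    moreover have "n'^2 = m'^2 + B'^2" using a yc(2) by simp
    ultimately have z: "m' = 0" "J = n'" "B'^2 = n'^2" using degenerate_disc K Q J(3) by blast+
    have nm: "n' = 2*n" "m = 0" using F z J0 by (simp_all add: F_defs)
    have "J*(B' + 2*B) = 0" using F(3) z by (simp add: FB_def algebra_simps)
    then have "B' = -2*B" using J0 by simp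
    then have "d^2 = n^2" using z(3) nm y by (simp add: ypoint_def power_mult_distrib)
    then show False using r(2) by simp
  qed
  \<comment> \<open>The square root is determined up to sign; a wrong sign is absorbed in
    e'.\<close>
  have "((m'^2+B'^2-n'^2)*J - n'*B'*(B'-m'))^2 = (E'*d'*e')^2"
    using kummer_eq[of m' B' n' J] K yc by (simp add: power_mult_distrib)
  then have "(d'^2-n'^2)*J - n'*B'*(B'-m') = E'*d'*e' \<or> (d'^2-n'^2)*J - n'*B'*(B'-m') = -(E'*d'*e')"
    using yc(2) by (simp add: power2_eq_iff)
  then have "J*(d'^2-n'^2) = n'*B'*(B'-m') + E'*d'*e' \<or> J*(d'^2-n'^2) = n'*B'*(B'-m') + E'*d'*(-e')"
    by (auto simp: algebra_simps)
  moreover have "ypoint n' m' B' E' d' (-e')" using y' by (simp add: ypoint_def)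
  ultimately show ?thesis unfolding descent_point_def using y' K2 E'0 Q J(3)
    unfolding n'_def m'_def B'_def by blast
qed

lemma ypoint_flip:
  assumes "ypoint n m B E d e"
  shows "ypoint n m B (-E) (-d) e" "ypoint n m B (-E) d (-e)"
  using assms by (simp_all add: ypoint_def)

lemma eq_quotient_square: "W^2 * N = Z^2 \<Longrightarrow> W \<noteq> 0 \<Longrightarrow> N = (Z/W)^2" for W N Z :: rat
  by (simp add: power_divide eq_divide_eq mult.commute)

text \<open>Signs of \<open>E\<close>, \<open>d\<close>, \<open>e\<close> may be changed two at a
  time, keeping their product. Such changes make c3 nonzero and then c1*c2 positive, since
  (m+d)*(m-d) = -(B^2) is negative. That B is nonzero follows from n^4 - E^4 = (m*e)^2, which
  otherwise holds and contradicts Fermat.\<close>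

lemma descent_normalize:
  assumes "descent_point n m B j"
  obtains E d e v where "ypoint n m B E d e" "j*(d^2-n^2) = n*B*(B-m) + E*d*e" "d^2 \<noteq> n^2"
    "v^2 = 2*((B+E)*(B-m+e)*(d-n)*(n+m)*(d+m)*(2*n+m+B+e))" "v \<noteq> 0" "E \<noteq> 0" "B \<noteq> 0" "(n+m)*(d+m) > 0"
proof -
  obtain E d e w where a: "ypoint n m B E d e" "j*(d^2-n^2) = n*B*(B-m) + E*d*e" "d^2 \<noteq> n^2"
      "E \<noteq> 0" "Q1 n m B j = w^2" "w \<noteq> 0" using assms unfolding descent_point_def by blast
  note yc = ypointD[OF a(1)]
  have n0: "n \<noteq> 0" by (rule ypoint_n_nonzero[OF a(1,4)])
  have B0: "B \<noteq> 0"
  proof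
    assume B: "B = 0"
    have "n^4 - E^4 = (m*e)^2" using yc B by algebra
    then have "m*e = 0" using fermat_minus_rat a(4) by blast
    then consider "m = 0" | "e = 0" by auto
    then show False
    proof cases
      case 1
      then have "d = 0" using yc B by simp
      then have "j = 0" using a(2) B n0 by simp
      then show False using a(5,6) 1 B by (simp add: Q1_def)
    next
      case 2
      then have "2*n^2 = m^2" using yc B by simp
      then show False using two_times_square_rat n0 by blast
    qed
  qed
  have flip_e: "\<exists>E e. ypoint n m B E d e \<and> j*(d^2-n^2) = n*B*(B-m) + E*d*e \<and> E \<noteq> 0 \<and> 2*n+m+B+e \<noteq> 0"
  proof (cases "2*n+m+B+e = 0")
    case True
    have "e \<noteq> 0"
    proof
      assume "e = 0"
      then have "m+B = -2*n" using True by linarith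
      then have "(m+B)^2 = 4*n^2" by (simp add: power_mult_distrib)
      then show False using yc(3) \<open>e = 0\<close> n0 by simp
    qed
    then have "2*n+m+B+(-e) \<noteq> 0" using True by linarith
    moreover have "ypoint n m B (-E) d (-e)" using ypoint_flip[OF a(1)] by simp
    moreover have "j*(d^2-n^2) = n*B*(B-m) + (-E)*d*(-e)" using a(2) by simp
    moreover have "-E \<noteq> 0" using a(4) by simp
    ultimately show ?thesis by blast
  qed (use a in blast)
  then obtain E1 e1 where b: "ypoint n m B E1 d e1" "j*(d^2-n^2) = n*B*(B-m) + E1*d*e1" "E1 \<noteq> 0" "2*n+m+B+e1 \<noteq> 0" by blast
  note bc = ypointD[OF b(1)]
  have nm: "n+m \<noteq> 0"
  proof
    assume "n+m = 0"
    then have "E1^2 = 0" using bc(1) by algebra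
    then show False using b(3) by simp
  qed
  have dm: "(d+m)*(d-m) = B^2" using bc by algebra
  then have dm0: "d+m \<noteq> 0" "m-d \<noteq> 0" using B0 by auto
  have "\<exists>E d. ypoint n m B E d e1 \<and> j*(d^2-n^2) = n*B*(B-m) + E*d*e1 \<and> E \<noteq> 0 \<and> (n+m)*(d+m) > 0 \<and> d^2 \<noteq> n^2"
  proof (cases "(n+m)*(d+m) > 0")
    case True then show ?thesis using b a(3) by blast
  next
    case False
    have "(n+m)*(d+m) * ((n+m)*(m-d)) = -(((n+m)*B)^2)" using dm by algebra
    moreover have "((n+m)*B)^2 > 0" using nm B0 by simp
    ultimately have "(n+m)*(d+m) * ((n+m)*(m-d)) < 0" by simp
    then have "(n+m)*(-d+m) > 0" using False by (simp add: mult_less_0_iff not_less)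
    moreover have "ypoint n m B (-E1) (-d) e1" using ypoint_flip[OF b(1)] by simp
    moreover have "j*((-d)^2-n^2) = n*B*(B-m) + (-E1)*(-d)*e1" using b(2) by simp
    moreover have "-E1 \<noteq> 0" "(-d)^2 \<noteq> n^2" using b(3) a(3) by simp_all
    ultimately show ?thesis by blast
  qed
  then obtain E2 d2 where c: "ypoint n m B E2 d2 e1" "j*(d2^2-n^2) = n*B*(B-m) + E2*d2*e1" "E2 \<noteq> 0" "(n+m)*(d2+m) > 0" "d2^2 \<noteq> n^2" by blast
  note cc = ypointD[OF c(1)]
  define L where "L = (B+E2)*(B-m+e1)*(d2-n)*(n+m)*(d2+m)*(2*n+m+B+e1)"
  have k: "(B+E2)*(B-E2) = d2^2-n^2" "(B-m+e1)*(B-m-e1) = 2*(d2^2-n^2)" using cc by algebra+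
  have "B+E2 \<noteq> 0" "B-m+e1 \<noteq> 0" "d2-n \<noteq> 0" using k c(5) by auto
  moreover have "d2+m \<noteq> 0" using c(4) by auto
  ultimately have L0: "L \<noteq> 0" using nm b(4) by (simp add: L_def)
  obtain W where W: "W^2 = 2*L*Q1 n m B j" using lift_identity[OF c(1,2,5)] by (auto simp: L_def)
  then have "(W/w)^2 = 2*L" using a(5,6) by (simp add: power_divide field_simps)
  moreover have "W/w \<noteq> 0" using W L0 a(5,6) by auto
  ultimately show thesis using that[of E2 d2 e1 "W/w"] c B0 by (simp add: L_def)
qed

text \<open>Positivity reduces c1*c2 to a square, and c1*c3 to a square or twice a square: the
  second resultant of the preimage is a nonzero sum of two squares, which excludes the negative
  classes. If c1*c3 is a square the standard preimage works, otherwise the one with \<open>E\<close>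
  and \<open>e\<close> negated.\<close>

lemma descent_step:
  assumes "descent_point n m B j"
  obtains n' m' B' j' c where "descent_point n' m' B' j'" "c \<noteq> 0"
    "Fn n' m' B' j' = c*n" "Fm n' m' B' j' = c*m" "FB n' m' B' j' = c*B" "Fj n' m' B' j' = c*j"
proof -
  obtain E d e v where y: "ypoint n m B E d e" and r: "j*(d^2-n^2) = n*B*(B-m) + E*d*e" "d^2 \<noteq> n^2"
    and v: "v^2 = 2*((B+E)*(B-m+e)*(d-n)*(n+m)*(d+m)*(2*n+m+B+e))" "v \<noteq> 0" and nz: "E \<noteq> 0" "B \<noteq> 0" "(n+m)*(d+m) > 0"
    using descent_normalize[OF assms] by blast
  note yc = ypointD[OF y]
  have dn: "d \<noteq> n" using r(2) by auto
  have n0: "n \<noteq> 0" by (rule ypoint_n_nonzero[OF y nz(1)])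
  define J where "J = (B+E)*(B-m+e)/(d-n)"
  have J: "J*(d-n) = (B+E)*(B-m+e)" using dn by (simp add: J_def)
  have J0: "J \<noteq> 0" using v dn by (auto simp: J_def)
  define c1 c2 c3 where "c1 = n+m" and "c2 = d+m" and "c3 = 2*n+m+B+e"
  have c0: "c1 \<noteq> 0" "c2 \<noteq> 0" "c3 \<noteq> 0" using v by (auto simp: c1_def c2_def c3_def)
  have v': "v^2 = 2*(J*(d-n)^2*c1*c2*c3)" using v(1) J unfolding c1_def c2_def c3_def by algebra
  obtain x where "c1*c2 = x^2 \<or> c1*c2 = -(x^2)" using c1_c2_square_rat[OF y v nz(1)] unfolding c1_def c2_def by blast
  moreover have "x^2 \<ge> 0" by simp
  ultimately have c12: "c1*c2 = x^2" using nz(3) unfolding c1_def c2_def by linarith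
  have x0: "x \<noteq> 0" using c12 c0 by auto
  define E' where "E' = (c1*c2 - E*B)/x"
  have sqE: "(n+d)^2 - (B+E)^2 = E'^2"
  proof -
    define S where "S = (n+d)^2 - (B+E)^2"
    have "S * (c1*c2) = (c1*c2-E*B)^2" using preimage_sq1[OF y] by (simp only: S_def c1_def c2_def)
    then have "S * x^2 = (c1*c2-E*B)^2" by (simp only: c12)
    then have "S = ((c1*c2-E*B)/x)^2" using x0 by (simp add: power_divide eq_divide_eq)
    then show ?thesis by (simp only: S_def E'_def)
  qed
  define M1 M2 where "M1 = (B+E)^2 + (m+E-e)^2" and "M2 = 2*(n+d)^2 - (m-B-e)^2"
  define W1 W2 where "W1 = (m+B-e)*c1 + c3*E" and "W2 = c3*c2 + (m+B-e)*B"
  have i1: "M1*(c1*c3) = W1^2" and i2: "M2*(c2*c3) = W2^2"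
    using preimage_sq2[OF y] preimage_sq3[OF y] by (simp_all add: M1_def M2_def W1_def W2_def c1_def c2_def c3_def)
  have F: "Fn (n+d) (-(B+E)) (m+E-e) J = 4*J*n" "Fm (n+d) (-(B+E)) (m+E-e) J = 4*J*m"
    "FB (n+d) (-(B+E)) (m+E-e) J = 4*J*B" "Fj (n+d) (-(B+E)) (m+E-e) J = 4*J*j"
    using preimage_F[OF y J dn] r by blast+
  have M1p: "M1 > 0"
  proof (rule ccontr)
    assume "\<not> M1 > 0"
    moreover have "M1 \<ge> 0" by (simp add: M1_def)
    ultimately have "M1 = 0" by linarith
    then have z: "B+E = 0" "m+E-e = 0" unfolding M1_def by (simp_all add: sum_power2_eq_zero_iff)
    have "4*J*B = 0" unfolding F(3) [symmetric] z by (simp add: FB_def z)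
    then show False using J0 nz by simp
  qed
  have M2n: "M2 \<noteq> 0"
  proof
    assume "M2 = 0"
    then have e2: "2*(n+d)^2 = (m-B-e)^2" by (simp add: M2_def)
    then have "n+d = 0" by (rule two_times_square_rat)
    then have "d = -n" by simp
    then show False using r(2) by simp
  qed
  have W10: "W1 \<noteq> 0" using i1 M1p c0 by auto
  then have "M1*(c1*c3) > 0" unfolding i1 by simp
  then have c13p: "c1*c3 > 0" using M1p by (rule zero_less_mult_pos)
  obtain z where "c1*c3 = z^2 \<or> c1*c3 = -(z^2) \<or> c1*c3 = 2*z^2 \<or> c1*c3 = -(2*z^2)"
    using c1_c3_square_or_double_rat[OF y v nz(1)] unfolding c1_def c3_def by blast
  moreover have "z^2 \<ge> 0" by simp
  ultimately have "c1*c3 = z^2 \<or> c1*c3 = 2*z^2" using c13p by linarith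
  then consider (one) "c1*c3 = z^2" | (two) "c1*c3 = 2*z^2" by blast
  then show thesis
  proof cases
    case one
    have z0: "z \<noteq> 0" using one c0 by auto
    have c23: "c2*c3 = (x*z/c1)^2" using one c12 c0 by (simp add: power_divide power_mult_distrib field_simps) algebra
    have "M1 = (W1/z)^2" using i1 one z0 by (simp add: power_divide field_simps)
    moreover have "M2 = (W2/(x*z/c1))^2" using i2 c23 z0 x0 c0 by (simp add: power_divide field_simps)
    moreover have "2*J*(n+m) = (v/((d-n)*(x*z/c1)))^2"
    proof -
      define Y where "Y = (d-n)*(x*z/c1)"
      have "v^2 = (2*J*c1)*Y^2" unfolding Y_def v' power_mult_distrib[of "d-n"] c23[symmetric] by algebra
      moreover have "Y \<noteq> 0" using dn x0 z0 c0 by (simp add: Y_def)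
      ultimately have "2*J*c1 = (v/Y)^2" by (simp add: power_divide)
      then show ?thesis by (simp only: Y_def c1_def)
    qed
    moreover have "v/((d-n)*(x*z/c1)) \<noteq> 0" using v(2) dn x0 z0 c0 by simp
    ultimately have "descent_point (n+d) (-(B+E)) (m+E-e) J"
      using descent_pointI_preimage[OF y r J] sqE unfolding M1_def M2_def by metis
    then show thesis using that[of _ _ _ _ "4*J"] F J0 by auto
  next
    case two
    have z0: "z \<noteq> 0" using two c0 by auto
    have c23: "c2*c3 = 2*(x*z/c1)^2" using two c12 c0 by (simp add: power_divide power_mult_distrib field_simps) algebra
    have yf: "ypoint n m B (-E) d (-e)" using ypoint_flip[OF y] by simp
    have rf: "j*(d^2-n^2) = n*B*(B-m) + (-E)*d*(-e)" using r by simp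
    define Jf where "Jf = (B-E)*(B-m-e)/(d-n)"
    have Jf: "Jf*(d-n) = (B+(-E))*(B-m+(-e))" using dn by (simp add: Jf_def)
    \<comment> \<open>Thus Jf is 2*J up to squares, which compensates the class of 2 in c2*c3 and
      makes \<open>Q1\<close> of the new preimage a square.\<close>
    have JJ: "J*Jf = 2*(d+n)^2"
    proof -
      have "(d-n)^2*(J*Jf) = (d-n)^2*(2*(d+n)^2)" using J Jf yc by algebra
      then show ?thesis using dn by simp
    qed
    have dn': "d+n \<noteq> 0" using r(2) by (metis add_eq_0_iff power2_minus)
    have Jf0: "Jf \<noteq> 0" using JJ dn' by auto
    have sqE': "(n+d)^2 - (B+(-E))^2 = ((c1*c2 + E*B)/x)^2"
    proof -
      define S where "S = (n+d)^2 - (B+(-E))^2"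
      have "S * (c1*c2) = (c1*c2-(-E)*B)^2" using preimage_sq1[OF yf] by (simp only: S_def c1_def c2_def)
      then have "S * x^2 = (c1*c2+E*B)^2" by (simp add: c12)
      then have "S = ((c1*c2+E*B)/x)^2" using x0 by (simp add: power_divide eq_divide_eq)
      then show ?thesis by (simp only: S_def)
    qed
    have W20: "W2 \<noteq> 0" using i2 M2n c0 by auto
    have sq2: "(B+(-E))^2 + (m+(-E)-(-e))^2 = (4*(n^2-m*(m+B)-E*e)*z/W1)^2"
    proof -
      define N where "N = (B-E)^2 + (m-E+e)^2"
      define T where "T = n^2-m*(m+B)-E*e"
      have "M1*N = 8*T^2" using preimage_sq2_flip[OF y] by (simp add: M1_def N_def T_def)
      then have "W1^2 * N = (4*T*z)^2" using i1 two by algebra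
      then have "N = (4*T*z/W1)^2" using W10 by (rule eq_quotient_square)
      then show ?thesis by (simp add: N_def T_def)
    qed
    have sq3: "2*(n+d)^2 - (m-B-(-e))^2 = (4*((m+B)*(n+d))*(x*z/c1)/W2)^2"
    proof -
      define N where "N = 2*(n+d)^2 - (m-B+e)^2"
      define T where "T = (m+B)*(n+d)"
      have "M2*N = 8*T^2" using preimage_sq3_flip[OF y] by (simp add: M2_def N_def T_def)
      then have "W2^2 * N = (4*T*(x*z/c1))^2" using i2 c23 by algebra
      then have "N = (4*T*(x*z/c1)/W2)^2" using W20 by (rule eq_quotient_square)
      then show ?thesis by (simp add: N_def T_def)
    qed
    define s where "s = 4*(d+n)*c1*(d-n)*(x*z/c1)/v"
    have s: "2*Jf*(n+m) = s^2"
    proof -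
      have "v^2 = 4*(J*c1)*((d-n)*(x*z/c1))^2" unfolding v' power_mult_distrib[of "d-n"] using c23 by algebra
      then have "v^2 * (2*Jf*c1) = (4*(d+n)*c1*(d-n)*(x*z/c1))^2" using JJ by algebra
      then show ?thesis using v(2) unfolding s_def c1_def[symmetric] by (rule eq_quotient_square)
    qed
    have "s \<noteq> 0" using v(2) dn dn' c0 x0 z0 by (simp add: s_def)
    then have "descent_point (n+d) (-(B+(-E))) (m+(-E)-(-e)) Jf"
      using descent_pointI_preimage[OF yf rf r(2) Jf s _ sqE' sq2 sq3] by blast
    moreover have "Fn (n+d) (-(B+(-E))) (m+(-E)-(-e)) Jf = 4*Jf*n" "Fm (n+d) (-(B+(-E))) (m+(-E)-(-e)) Jf = 4*Jf*m"
      "FB (n+d) (-(B+(-E))) (m+(-E)-(-e)) Jf = 4*Jf*B" "Fj (n+d) (-(B+(-E))) (m+(-E)-(-e)) Jf = 4*Jf*j"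
      using preimage_F[OF yf Jf dn] rf r by blast+
    ultimately show thesis using that[of _ _ _ _ "4*Jf"] Jf0 by auto
  qed
qed

section \<open>Contraction at 2\<close>

definition descent_point_int :: "int \<Rightarrow> int \<Rightarrow> int \<Rightarrow> int \<Rightarrow> bool" where
  "descent_point_int n m B j \<longleftrightarrow> descent_point (of_int n) (of_int m) (of_int B) (of_int j)
     \<and> (\<forall>p. prime p \<and> p dvd n \<and> p dvd m \<and> p dvd B \<longrightarrow> \<not> p dvd j)"

lemma descent_point_scale:
  assumes "descent_point (l*n) (l*m) (l*B) (l*j)" "l \<noteq> 0"
  shows "descent_point n m B j"
proof -
  obtain E d e w where a: "ypoint (l*n) (l*m) (l*B) E d e" "(l*j)*(d^2-(l*n)^2) = (l*n)*(l*B)*(l*B-l*m) + E*d*e" "d^2 \<noteq> (l*n)^2"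
      "E \<noteq> 0" "Q1 (l*n) (l*m) (l*B) (l*j) = w^2" "w \<noteq> 0" using assms unfolding descent_point_def by blast
  define E' d' e' w' where "E' = E/l" and "d' = d/l" and "e' = e/l" and "w' = w/l"
  have s: "E = l*E'" "d = l*d'" "e = l*e'" "w = l*w'" using assms(2) by (simp_all add: E'_def d'_def e'_def w'_def)
  have l2: "l^2 \<noteq> 0" "l^3 \<noteq> 0" using assms(2) by simp_all
  have "l^2*E'^2 = l^2*(n^2-m^2)" "l^2*d'^2 = l^2*(m^2+B^2)" "l^2*e'^2 = l^2*(2*n^2-(m+B)^2)"
    using a(1) unfolding s ypoint_def by algebra+
  then have "ypoint n m B E' d' e'" using l2 by (simp add: ypoint_def)
  moreover have "l^3*(j*(d'^2-n^2)) = l^3*(n*B*(B-m) + E'*d'*e')" using a(2) unfolding s by algebra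
  then have "j*(d'^2-n^2) = n*B*(B-m) + E'*d'*e'" using l2 by simp
  moreover have "l^2 * Q1 n m B j = l^2*w'^2" using a(5) unfolding s Q1_def by algebra
  then have "Q1 n m B j = w'^2" using l2 by simp
  moreover have "d'^2 \<noteq> n^2" using a(3) unfolding s by (auto simp: power_mult_distrib)
  moreover have "E' \<noteq> 0" "w' \<noteq> 0" using a(4,6) s by auto
  ultimately show ?thesis unfolding descent_point_def by blast
qed

lemma descent_point_n_nonzero: "descent_point n m B j \<Longrightarrow> n \<noteq> 0"
  unfolding descent_point_def using ypoint_n_nonzero by blast

lemma descent_point_primitive:
  assumes "descent_point n m B j"
  obtains l n' m' B' j' where "l \<noteq> 0" "n = l * of_int n'" "m = l * of_int m'" "B = l * of_int B'" "j = l * of_int j'"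
    "descent_point_int n' m' B' j'"
proof -
  obtain l n' m' B' j' where s: "l \<noteq> 0" "n = l * of_int n'" "m = l * of_int m'" "B = l * of_int B'" "j = l * of_int j'"
    "\<And>p. prime p \<Longrightarrow> p dvd n' \<Longrightarrow> p dvd m' \<Longrightarrow> p dvd B' \<Longrightarrow> p dvd j' \<Longrightarrow> False"
    using rat_quadruple_primitive[of n m B j] descent_point_n_nonzero[OF assms] by blast
  have "descent_point (of_int n') (of_int m') (of_int B') (of_int j')"
    using descent_point_scale[OF _ s(1)] assms s by simp
  then have "descent_point_int n' m' B' j'" using s(6) unfolding descent_point_int_def by blast
  then show thesis using that s by blast
qed

lemma descent_point_int_facts:
  assumes "descent_point_int n m B j"
  obtains E d e where "ypoint n m B E d e" "kummer n m B j = 0" "d^2 \<noteq> n^2" "n \<noteq> 0"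
proof -
  have D: "descent_point (of_int n) (of_int m) (of_int B) (of_int j)" using assms by (simp add: descent_point_int_def)
  then obtain E d e :: rat where a: "ypoint (of_int n) (of_int m) (of_int B) E d e" "of_int j*(d^2-(of_int n)^2) = of_int n*of_int B*(of_int B-of_int m) + E*d*e"
    "d^2 \<noteq> (of_int n)^2" unfolding descent_point_def by blast
  have "(of_int (kummer n m B j) :: rat) = kummer (of_int n) (of_int m) (of_int B) (of_int j)" by (simp add: kummer_def)
  also have "\<dots> = 0" using ypoint_kummer[OF a] .
  finally have K: "kummer n m B j = 0" by simp
  have "of_int (n^2-m^2) = E^2" "of_int (m^2+B^2) = d^2" "of_int (2*n^2-(m+B)^2) = e^2" using a(1) by (simp_all add: ypoint_def)
  then obtain E' d' e' where i: "n^2-m^2 = E'^2" "m^2+B^2 = d'^2" "d = of_int d'" "2*n^2-(m+B)^2 = e'^2" by (elim rat_square_of_int) blast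
  have "d'^2 \<noteq> n^2" using a(3) i(3) by (metis of_int_eq_iff of_int_power)
  moreover have "n \<noteq> 0" using descent_point_n_nonzero[OF D] by simp
  ultimately show thesis using that K i unfolding ypoint_def by metis
qed

lemma descent_step_int:
  assumes "descent_point_int n m B j"
  obtains n' m' B' j' a c where "descent_point_int n' m' B' j'" "a \<noteq> 0" "c \<noteq> 0"
    "a * Fn n' m' B' j' = c*n" "a * Fm n' m' B' j' = c*m" "a * FB n' m' B' j' = c*B" "a * Fj n' m' B' j' = c*j"
proof -
  have "descent_point (of_int n) (of_int m) (of_int B) (of_int j)" using assms by (simp add: descent_point_int_def)
  then obtain n1 m1 B1 j1 c1 where s: "descent_point n1 m1 B1 j1" "c1 \<noteq> 0"
    "Fn n1 m1 B1 j1 = c1*of_int n" "Fm n1 m1 B1 j1 = c1*of_int m" "FB n1 m1 B1 j1 = c1*of_int B" "Fj n1 m1 B1 j1 = c1*of_int j"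
    by (rule descent_step)
  obtain l n' m' B' j' where q: "l \<noteq> 0" "n1 = l * of_int n'" "m1 = l * of_int m'" "B1 = l * of_int B'" "j1 = l * of_int j'"
    "descent_point_int n' m' B' j'" using descent_point_primitive[OF s(1)] by blast
  obtain c a where ca: "c1/l^2 = of_int c / of_int a" "a > 0" by (metis rat_coprime_quotient)
  have a0: "(of_int a :: rat) \<noteq> 0" using ca by simp
  have "c1 * of_int a = l^2 * of_int c" using ca q(1) by (simp add: field_simps)
  then have key: "of_int a * x = of_int c * y" if "l^2 * x = c1 * y" for x y :: rat
  proof -
    have "l^2 * (of_int a * x) = of_int a * (c1 * y)" using that by algebra
    also have "\<dots> = l^2 * (of_int c * y)" using \<open>c1 * of_int a = l^2 * of_int c\<close> by algebra
    finally show ?thesis using q(1) by simp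
  qed
  have F: "l^2 * of_int (Fn n' m' B' j') = c1 * of_int n" "l^2 * of_int (Fm n' m' B' j') = c1 * of_int m"
    "l^2 * of_int (FB n' m' B' j') = c1 * of_int B" "l^2 * of_int (Fj n' m' B' j') = c1 * of_int j"
    using s(3-6) unfolding q F_defs by (simp_all add: power2_eq_square algebra_simps)
  have "of_int (a * Fn n' m' B' j') = (of_int (c*n) :: rat)" "of_int (a * Fm n' m' B' j') = (of_int (c*m) :: rat)"
    "of_int (a * FB n' m' B' j') = (of_int (c*B) :: rat)" "of_int (a * Fj n' m' B' j') = (of_int (c*j) :: rat)"
    using F[THEN key] by simp_all
  then have "a * Fn n' m' B' j' = c*n" "a * Fm n' m' B' j' = c*m" "a * FB n' m' B' j' = c*B" "a * Fj n' m' B' j' = c*j"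
    by (simp_all only: of_int_eq_iff)
  moreover have "c \<noteq> 0" using ca s(2) q(1) by auto
  ultimately show thesis by (intro that[of n' m' B' j' a c]) (use q(6) ca(2) in auto)
qed

text \<open>
  The 2-adic residue discs of the origin \<open>(0 : 0 : 0 : 1)\<close> and of the two torsion points
  \<open>(1 : 0 : \<plusminus>1 : 1)\<close>. In the second disc the distance from the centre is measured by \<open>m^2 + (j-n)^2\<close>.
\<close>

definition near_identity :: "int \<Rightarrow> int \<Rightarrow> int \<Rightarrow> int \<Rightarrow> bool" where
  "near_identity n m B j \<longleftrightarrow> even n \<and> even m \<and> even B \<and> odd j"
definition near_torsion :: "int \<Rightarrow> int \<Rightarrow> int \<Rightarrow> int \<Rightarrow> bool" where
  "near_torsion n m B j \<longleftrightarrow> odd n \<and> odd B \<and> 4 dvd m \<and> 4 dvd (j-n)"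

lemma coprime_power_2_odd: "odd x \<Longrightarrow> coprime (2^k) x" for x :: int
  by (simp add: coprime_left_2_iff_odd)

text \<open>If \<open>n\<close>, \<open>m\<close>, \<open>B\<close> are even, primitivity makes
  \<open>j\<close> odd. Otherwise \<open>ypoint_parity\<close> leaves two patterns. For odd
  \<open>m\<close> the Kummer quartic is odd, hence not 0; for odd \<open>B\<close>, m^2 = d^2 - B^2
  is divisible by 8, and the quartic modulo 8 then controls \<open>j - n\<close>.\<close>

lemma descent_point_int_cases:
  assumes "descent_point_int n m B j"
  shows "near_identity n m B j \<or> near_torsion n m B j"
proof -
  obtain E d e where y: "ypoint n m B E d e" and K: "kummer n m B j = 0" by (rule descent_point_int_facts[OF assms])
  note yc = ypointD[OF y]
  show ?thesis
  proof (cases "even n \<and> even m \<and> even B")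
    case True
    then have "odd j" using assms unfolding descent_point_int_def by (metis prime_int_numeral_eq two_is_prime_nat)
    then show ?thesis using True by (simp add: near_identity_def)
  next
    case False
    have t: "odd n \<and> odd d \<and> (odd m \<and> even B \<or> even m \<and> odd B)"
      using ypoint_parity[OF y] False by blast
    have "\<not> (odd m \<and> even B)"
    proof
      assume "odd m \<and> even B"
      then have "odd (kummer n m B j)" using t by (simp add: kummer_def)
      then show False using K by simp
    qed
    then have mB: "even m" "odd B" using t by auto
    obtain a b c where s: "n^2 = 8*a+1" "B^2 = 8*b+1" "d^2 = 8*c+1" using odd_square_mod_8 t mB by metis
    have m4: "4 dvd m"
    proof -
      obtain m1 where m1: "m = 2*m1" using mB(1) by blast
      have "4*m1^2 = 8*c - 8*b" using yc(2) s m1 by (simp add: power_mult_distrib)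
      then have "m1^2 = 2*(c-b)" by simp
      then have "even (m1^2)" by simp
      then show ?thesis using m1 by auto
    qed
    then obtain m2 where m2: "m = 4*m2" by blast
    have "(8*b+16*m2^2-8*a)*(j-n)^2 - 2*n*(n^2-m^2-m*B)*(j-n) + (n^2-m^2)*(16*m2^2+8*m2*B+8*b-8*a) + n^2*(16*m2^2) = 0"
      using K s m2 unfolding kummer_def by algebra
    then have "2*(n*(n^2-m^2-m*B)*(j-n)) = 8*((b+2*m2^2-a)*(j-n)^2 + (n^2-m^2)*(2*m2^2+m2*B+b-a) + n^2*(2*m2^2))"
      by (simp add: algebra_simps)
    then have "n*(n^2-m^2-m*B)*(j-n) = 4*((b+2*m2^2-a)*(j-n)^2 + (n^2-m^2)*(2*m2^2+m2*B+b-a) + n^2*(2*m2^2))"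
      by simp
    then have "4 dvd (n*(n^2-m^2-m*B))*(j-n)" by (metis dvd_triv_left)
    moreover have "odd (n*(n^2-m^2-m*B))" using t mB by simp
    then have "coprime (2^2) (n*(n^2-m^2-m*B))" by (rule coprime_power_2_odd)
    then have "coprime 4 (n*(n^2-m^2-m*B))" by simp
    ultimately have "4 dvd j-n" using coprime_dvd_mult_right_iff by blast
    then show ?thesis using t mB m4 by (simp add: near_torsion_def)
  qed
qed

lemma near_identity_F:
  assumes "near_identity n m B j"
  shows "odd (Fj n m B j)" "even (Fn n m B j)"
  using assms by (auto simp: near_identity_def F_defs)

lemma near_torsion_F:
  assumes "near_torsion n m B j"
  shows "even (Fj n m B j)" "\<exists>k. Fn n m B j = 2*(2*k+1)"
proof -
  have j: "odd j" "even m" "odd n" "odd B" using assms by (auto simp: near_torsion_def elim!: dvdE) (metis dvd_def even_add even_mult_iff even_numeral diff_add_cancel)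
  then show "even (Fj n m B j)" by (simp add: F_defs)
  have "odd (n*j - m*(m+B))" using j by simp
  then obtain k where "n*j - m*(m+B) = 2*k+1" by (rule oddE)
  then show "\<exists>k. Fn n m B j = 2*(2*k+1)" by (auto simp: F_defs)
qed

text \<open>The ratio n/j is even over odd near the origin, whereas \<open>F\<close> sends the
  torsion disc to points with \<open>Fn\<close> twice an odd number and \<open>Fj\<close> even. So a
  preimage cannot change its disc; the next lemma is the reverse case.\<close>

lemma near_identity_step:
  assumes x: "near_identity n m B j" and x': "descent_point_int n' m' B' j'"
    and F: "a * Fn n' m' B' j' = c*n" "a * Fj n' m' B' j' = c*j" "a \<noteq> 0" "c \<noteq> 0"
  shows "near_identity n' m' B' j'"
proof (rule ccontr)
  assume "\<not> ?thesis"
  then have t: "near_torsion n' m' B' j'" using descent_point_int_cases[OF x'] by blast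
  obtain k where k: "Fn n' m' B' j' = 2*(2*k+1)" using near_torsion_F(2)[OF t] by blast
  obtain f where f: "Fj n' m' B' j' = 2*f" using near_torsion_F(1)[OF t] by blast
  obtain n1 where n1: "n = 2*n1" using x by (auto simp: near_identity_def)
  have "a*c*(n * Fj n' m' B' j') = a*c*(j * Fn n' m' B' j')" using F(1,2) by algebra
  then have "n * Fj n' m' B' j' = j * Fn n' m' B' j'" using F(3,4) by simp
  then have "2*(2*(n1*f)) = 2*(j*(2*k+1))" using k f n1 by algebra
  then have "2*(n1*f) = j*(2*k+1)" by (simp add: mult.commute)
  moreover have "odd (j*(2*k+1))" using x by (simp add: near_identity_def)
  ultimately show False by (metis dvd_triv_left)
qed

lemma near_torsion_step:
  assumes x: "near_torsion n m B j" and x': "descent_point_int n' m' B' j'"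
    and F: "a * Fn n' m' B' j' = c*n" "a * Fj n' m' B' j' = c*j" "a \<noteq> 0" "c \<noteq> 0"
  shows "near_torsion n' m' B' j'"
proof (rule ccontr)
  assume "\<not> ?thesis"
  then have t: "near_identity n' m' B' j'" using descent_point_int_cases[OF x'] by blast
  have "a*c*(n * Fj n' m' B' j') = a*c*(j * Fn n' m' B' j')" using F(1,2) by algebra
  then have e: "n * Fj n' m' B' j' = j * Fn n' m' B' j'" using F(3,4) by simp
  have "odd (n * Fj n' m' B' j')" using near_identity_F(1)[OF t] x by (simp add: near_torsion_def)
  then show False using near_identity_F(2)[OF t] e by simp
qed

text \<open>Near the origin \<open>Fj\<close> is odd, while \<open>Fn\<close>, \<open>Fm\<close>,
  \<open>FB\<close> are 2 times combinations of \<open>n\<close>, \<open>m\<close>,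
  \<open>B\<close>. Hence divisibility of a preimage by 2^k gives divisibility by 2^(k+1) for the
  point itself; one more preimage gains one more factor 2.\<close>

lemma near_identity_divisible:
  assumes "descent_point_int n m B j" "near_identity n m B j"
  shows "2^k dvd n \<and> 2^k dvd m \<and> 2^k dvd B"
  using assms
proof (induction k arbitrary: n m B j)
  case (Suc k)
  obtain n' m' B' j' a c where s: "descent_point_int n' m' B' j'" "a \<noteq> 0" "c \<noteq> 0"
    "a * Fn n' m' B' j' = c*n" "a * Fm n' m' B' j' = c*m" "a * FB n' m' B' j' = c*B" "a * Fj n' m' B' j' = c*j"
    by (rule descent_step_int[OF Suc.prems(1)])
  have t: "near_identity n' m' B' j'" using near_identity_step[OF Suc.prems(2) s(1,4,7,2,3)] .
  have d: "2^k dvd n'" "2^k dvd m'" "2^k dvd B'" using Suc.IH[OF s(1) t] by blast+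
  have "2^Suc k dvd Fn n' m' B' j'" "2^Suc k dvd Fm n' m' B' j'" "2^Suc k dvd FB n' m' B' j'"
    using d by (simp_all add: F_defs)
  moreover have "n * Fj n' m' B' j' = j * Fn n' m' B' j'" "m * Fj n' m' B' j' = j * Fm n' m' B' j'" "B * Fj n' m' B' j' = j * FB n' m' B' j'"
  proof -
    have "a*c*(n * Fj n' m' B' j') = a*c*(j * Fn n' m' B' j')" "a*c*(m * Fj n' m' B' j') = a*c*(j * Fm n' m' B' j')"
      "a*c*(B * Fj n' m' B' j') = a*c*(j * FB n' m' B' j')" using s(4-7) by algebra+
    then show "n * Fj n' m' B' j' = j * Fn n' m' B' j'" "m * Fj n' m' B' j' = j * Fm n' m' B' j'" "B * Fj n' m' B' j' = j * FB n' m' B' j'"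
      using s(2,3) by simp_all
  qed
  ultimately have "2^Suc k dvd n * Fj n' m' B' j'" "2^Suc k dvd m * Fj n' m' B' j'" "2^Suc k dvd B * Fj n' m' B' j'"
    by (metis dvd_mult)+
  moreover have "coprime (2^Suc k) (Fj n' m' B' j')" using near_identity_F(1)[OF t] by (rule coprime_power_2_odd)
  ultimately show ?case using coprime_dvd_mult_left_iff by blast
qed simp

lemma all_powers_dvd_imp_0: "(\<And>k. 2^k dvd (x::int)) \<Longrightarrow> x = 0"
proof (rule ccontr)
  assume a: "\<And>k. 2^k dvd x" "x \<noteq> 0"
  have "2^nat \<bar>x\<bar> dvd x" by (rule a)
  then have "(2::int)^nat \<bar>x\<bar> \<le> \<bar>x\<bar>" using dvd_imp_le_int[OF a(2)] by fastforce
  moreover have "int (nat \<bar>x\<bar>) < 2^nat \<bar>x\<bar>" by (metis of_nat_less_two_power)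
  ultimately show False by simp
qed

text \<open>A sum of two squares divisible by 4 has both terms even, so factors 4 can be split off
  until \<open>e\<close> is below 2. This bounds the single monomials by the norm m^2 + k^2, up to a
  factor 2.\<close>

lemma dvd_sum_squares:
  fixes m k :: int
  assumes "2^e dvd m^2 + k^2"
  shows "2^e dvd 2*k^2 \<and> 2^e dvd 2*(m*k)"
  using assms
proof (induction e arbitrary: m k rule: less_induct)
  case (less e)
  show ?case
  proof (cases "e < 2")
    case True
    then have "e = 0 \<or> e = 1" by auto
    then show ?thesis by auto
  next
    case False
    then obtain f where f: "e = f + 2" by (metis add.commute le_Suc_ex not_less)
    then have d: "4 * 2^f dvd m^2 + k^2" using less.prems by (simp add: power_add mult.commute)
    then have "4 dvd m^2 + k^2" by (rule dvd_mult_left)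
    then have "even m \<and> even k"
    proof -
      assume a: "4 dvd m^2 + k^2"
      have "even m \<longleftrightarrow> even k" using dvd_trans[OF _ a, of 2] by simp
      moreover have False if o: "odd m" "odd k"
      proof -
        obtain x where x: "m^2 = 8*x+1" using odd_square_mod_8[OF o(1)] by blast
        obtain y where y: "k^2 = 8*y+1" using odd_square_mod_8[OF o(2)] by blast
        have "4 dvd 8*(x+y) + 2" using a x y by (simp add: algebra_simps)
        then show False by presburger
      qed
      ultimately show ?thesis by blast
    qed
    then obtain m1 k1 where mk: "m = 2*m1" "k = 2*k1" by blast
    have "4 * 2^f dvd 4 * (m1^2 + k1^2)" using d mk by (simp add: power_mult_distrib)
    then have "2^f dvd m1^2 + k1^2" by (simp only: dvd_mult_cancel_left) simp
    then have "2^f dvd 2*k1^2 \<and> 2^f dvd 2*(m1*k1)" using less.IH[of f] f by simp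
    then have "4 * 2^f dvd 4 * (2*k1^2)" "4 * 2^f dvd 4 * (2*(m1*k1))" using mult_dvd_mono dvd_refl by blast+
    moreover have "4 * (2*k1^2) = 2*k^2" "4 * (2*(m1*k1)) = 2*(m*k)" "(2::int)^e = 4 * 2^f"
      using f mk by (simp_all add: power_add power_mult_distrib)
    ultimately show ?thesis by (simp only: simp_thms)
  qed
qed

text \<open>Here 1 - i shows as a gain of a factor 2 in the norm. Write k = j' - n', so the preimage
  has norm N = m'^2 + k^2. To leading order \<open>Fm\<close> and \<open>Fj - Fn\<close> are 2Y and
  2X with X^2 + Y^2 = (n'^2 + B'^2)*N, and n'^2 + B'^2 is twice an odd number. The norm 8*N so
  obtained is divided by 4, since \<open>Fn\<close> is twice an odd number.\<close>

lemma near_torsion_divisible: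
  assumes "descent_point_int n m B j" "near_torsion n m B j"
  shows "2^(e+4) dvd m^2 + (j-n)^2"
  using assms
proof (induction e arbitrary: n m B j)
  case 0
  then obtain a b where "m = 4*a" "j-n = 4*b" by (auto simp: near_torsion_def elim!: dvdE)
  then have "m^2 + (j-n)^2 = 2^4*(a^2+b^2)" by (simp add: power_mult_distrib)
  then show ?case by simp
next
  case (Suc e)
  obtain n' m' B' j' a c where s: "descent_point_int n' m' B' j'" "a \<noteq> 0" "c \<noteq> 0"
    "a * Fn n' m' B' j' = c*n" "a * Fm n' m' B' j' = c*m" "a * FB n' m' B' j' = c*B" "a * Fj n' m' B' j' = c*j"
    by (rule descent_step_int[OF Suc.prems(1)])
  have t: "near_torsion n' m' B' j'" using near_torsion_step[OF Suc.prems(2) s(1,4,7,2,3)] .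
  define k where "k = j' - n'"
  have j': "j' = n' + k" by (simp add: k_def)
  have K: "kummer n' m' B' (n'+k) = 0" using descent_point_int_facts[OF s(1)] j' by metis
  obtain n1 where n1: "n' = 2*n1+1" using t by (auto simp: near_torsion_def elim!: oddE)
  obtain b1 where b1: "B' = 2*b1+1" using t by (auto simp: near_torsion_def elim!: oddE)
  obtain m1 where m1: "m' = 4*m1" using t by (auto simp: near_torsion_def)
  obtain k1 where k1: "k = 4*k1" using t by (auto simp: near_torsion_def k_def)
  define N where "N = m'^2 + k^2"
  have N: "2^(e+4) dvd N" using Suc.IH[OF s(1) t] by (simp add: N_def k_def)
  have d2: "2^(e+4) dvd 2*k^2" "2^(e+4) dvd 2*(m'*k)" using dvd_sum_squares N by (auto simp: N_def)
  define P R X Y where "P = n'^2 - m'^2" and "R = n'^2*N + n'*B'*(2*(m'*k)) + k^2*(k^2-m'^2)"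
    and "X = m'*B' - n'*k" and "Y = n'*m' + B'*k"
  define G where "G = k^2 + n'^2 - m'^2 - B'^2"
  have dR: "2^(e+4) dvd R"
  proof -
    have "k^2*(k^2-m'^2) = 2*k^2*(8*k1^2-8*m1^2)" unfolding m1 k1 by algebra
    moreover have "2^(e+4) dvd 2*k^2*(8*k1^2-8*m1^2)" using d2(1) by (rule dvd_mult2)
    ultimately have "2^(e+4) dvd k^2*(k^2-m'^2)" by (simp only:)
    moreover have "2^(e+4) dvd n'^2*N" "2^(e+4) dvd n'*B'*(2*(m'*k))" using N d2(2) by (simp_all only: dvd_mult)
    ultimately show ?thesis unfolding R_def by (simp only: dvd_add)
  qed
  \<comment> \<open>The Kummer equation in the form that shows G to be 2*X up to the error
    \<open>R\<close>; the factor P + k^2 is odd and is removed afterwards.\<close>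
  have G: "(P+k^2)*G = 2*P*X + R"
    using K unfolding kummer_def P_def R_def X_def G_def N_def by algebra
  have p8: "(2::int)^(e+7) = 8 * 2^(e+4)" by (simp add: power_add)
  have main: "2^(e+7) dvd 4*((P+k^2)^2*Y^2) + ((P+k^2)*G)^2"
  proof -
    have e1: "4*((P+k^2)^2*Y^2) + (2*P*X+R)^2 = 4*P^2*(n'^2+B'^2)*N + Y^2*(2*k^2)*(2*(2*P+k^2)) + 4*P*X*R + R*R"
      unfolding N_def X_def Y_def by algebra
    have "4*P^2*(n'^2+B'^2)*N = 8 * N * (P^2*(2*n1^2+2*n1+2*b1^2+2*b1+1))" unfolding n1 b1 by algebra
    moreover have "2^(e+7) dvd 8 * N * (P^2*(2*n1^2+2*n1+2*b1^2+2*b1+1))"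
    proof -
      have "8 * 2^(e+4) dvd 8 * N" using N by (rule mult_dvd_mono[OF dvd_refl])
      then show ?thesis unfolding p8 by (rule dvd_mult2)
    qed
    moreover have "2^(e+7) dvd Y^2*(2*k^2)*(2*(2*P+k^2))"
    proof -
      have "Y^2 = 16*(n'*m1+B'*k1)^2" unfolding Y_def m1 k1 by algebra
      then have "8 dvd Y^2" by simp
      then have "8 * 2^(e+4) dvd Y^2*(2*k^2)" using d2(1) by (rule mult_dvd_mono)
      then show ?thesis unfolding p8 by (rule dvd_mult2)
    qed
    moreover have "2^(e+7) dvd 4*P*X*R"
    proof -
      have "4*P*X = 8*(2*(P*(m1*B'-n'*k1)))" unfolding X_def m1 k1 by algebra
      then have "8 dvd 4*P*X" by (metis dvd_triv_left)
      then have "8 * 2^(e+4) dvd 4*P*X*R" using dR by (rule mult_dvd_mono)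
      then show ?thesis by (simp only: p8)
    qed
    moreover have "2^(e+7) dvd R*R"
    proof -
      have "8 dvd R" using dR by (rule dvd_trans[rotated]) (simp add: power_add)
      then have "8 * 2^(e+4) dvd R*R" using dR by (rule mult_dvd_mono)
      then show ?thesis by (simp only: p8)
    qed
    ultimately show ?thesis unfolding G e1 by (simp only: dvd_add)
  qed
  have "4*((P+k^2)^2*Y^2) + ((P+k^2)*G)^2 = (P+k^2)^2 * (4*Y^2 + G^2)" by algebra
  moreover have "odd ((P+k^2)^2)" unfolding P_def n1 m1 k1 by simp
  then have "coprime (2^(e+7)) ((P+k^2)^2)" by (rule coprime_power_2_odd)
  ultimately have YG: "2^(e+7) dvd 4*Y^2 + G^2" using main coprime_dvd_mult_right_iff by metis
  have FF: "Fm n' m' B' j' = 2*Y" "Fj n' m' B' j' - Fn n' m' B' j' = G"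
    unfolding F_defs j' Y_def G_def by algebra+
  obtain f where f: "Fn n' m' B' j' = 2*(2*f+1)" using near_torsion_F(2)[OF t] by blast
  have cancel: "x = y" if "2*a*c*x = 2*a*c*y" for x y using that s(2,3) by simp
  have "2*a*c*(n * Y) = 2*a*c*(m * (2*f+1))" using s(4,5) FF f by algebra
  then have r1: "n * Y = m * (2*f+1)" by (rule cancel)
  have "2*a*c*(n * G) = 2*a*c*((j-n) * (2*(2*f+1)))" using s(4,7) FF(2) f by algebra
  then have r2: "n * G = (j-n) * (2*(2*f+1))" by (rule cancel)
  have "n^2*(4*Y^2+G^2) = 4 * ((2*f+1)^2*(m^2+(j-n)^2))" using r1 r2 by algebra
  then have "2^(e+7) dvd 4 * ((2*f+1)^2*(m^2+(j-n)^2))" using YG by (metis dvd_mult)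
  moreover have "(2::int)^(e+7) = 4 * 2^(e+5)" by (simp add: power_add)
  ultimately have "4 * 2^(e+5) dvd 4 * ((2*f+1)^2*(m^2+(j-n)^2))" by (simp only:)
  then have "2^(e+5) dvd (2*f+1)^2*(m^2+(j-n)^2)" by simp
  moreover have "odd ((2*f+1)^2)" by simp
  then have "coprime (2^(e+5)) ((2*f+1)^2)" by (rule coprime_power_2_odd)
  ultimately have "2^(e+5) dvd m^2+(j-n)^2" using coprime_dvd_mult_right_iff by blast
  then show ?case by (simp add: add.commute)
qed

text \<open>A descent point is 2-adically as close as desired to the centre of its disc, hence equal
  to it. The origin violates n \<noteq> 0, the torsion points violate d^2 \<noteq> n^2.\<close>

theorem no_descent_point: "\<not> descent_point n m B j"
proof
  assume "descent_point n m B j"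
  then obtain n' m' B' j' where D: "descent_point_int n' m' B' j'" using descent_point_primitive by metis
  obtain E d e where y: "ypoint n' m' B' E d e" and K: "kummer n' m' B' j' = 0" and nz: "d^2 \<noteq> n'^2" "n' \<noteq> 0"
    by (rule descent_point_int_facts[OF D])
  from descent_point_int_cases[OF D] show False
  proof
    assume "near_identity n' m' B' j'"
    then have "n' = 0" using near_identity_divisible[OF D] all_powers_dvd_imp_0 by blast
    then show False using nz by simp
  next
    assume t: "near_torsion n' m' B' j'"
    have "2^k dvd m'^2 + (j'-n')^2" for k
      using near_torsion_divisible[OF D t, of k] by (metis dvd_trans le_add1 le_imp_power_dvd)
    then have "m'^2 + (j'-n')^2 = 0" by (rule all_powers_dvd_imp_0)
    then have z: "m' = 0" "j' = n'" by (simp_all add: sum_power2_eq_zero_iff)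
    then have "n'^2 * (B'^2 - n'^2) = 0" using K unfolding kummer_def by algebra
    then have "d^2 = n'^2" using y z nz by (simp add: ypoint_def)
    then show False using nz by simp
  qed
qed

section \<open>Divisors of degree two on the curve\<close>

lemma kummer_F:
  fixes n m B j :: "'a::idom"
  assumes K: "kummer n m B j = 0"
  shows "kummer (Fn n m B j) (Fm n m B j) (FB n m B j) (Fj n m B j) = 0"
  using K unfolding kummer_def F_defs by algebra

text \<open>These values of \<open>E\<close>, \<open>d\<close>, \<open>e\<close> solve the preimage
  formula backwards: n+d, -(B+E), m+E-e, formed at the image, must be 4*j times the coordinates of
  the given point. The factor 4*j arises from comparing \<open>preimage_F\<close> with the fact that
  \<open>F\<close> is quadratic.\<close>

lemma ypoint_F:
  fixes n m B j :: rat
  assumes K: "kummer n m B j = 0"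
  defines "E \<equiv> -4*j*m - FB n m B j" and "d \<equiv> 4*j*n - Fn n m B j"
  shows "ypoint (Fn n m B j) (Fm n m B j) (FB n m B j) E d (Fm n m B j + E - 4*j*B)"
    "Fj n m B j*(d^2-(Fn n m B j)^2) = Fn n m B j*FB n m B j*(FB n m B j-Fm n m B j) + E*d*(Fm n m B j + E - 4*j*B)"
    "d^2-(Fn n m B j)^2 = 16*j*n*m*(m+B)"
proof -
  show "ypoint (Fn n m B j) (Fm n m B j) (FB n m B j) E d (Fm n m B j + E - 4*j*B)"
    unfolding ypoint_def E_def d_def using K unfolding kummer_def F_defs by algebra
  show "Fj n m B j*(d^2-(Fn n m B j)^2) = Fn n m B j*FB n m B j*(FB n m B j-Fm n m B j) + E*d*(Fm n m B j + E - 4*j*B)"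
    unfolding E_def d_def F_defs by algebra
  show "d^2-(Fn n m B j)^2 = 16*j*n*m*(m+B)"
    unfolding d_def F_defs by algebra
qed

text \<open>Up to scaling the nonzero solutions are the kernel of 1 - \<sigma>: the origin (0 : 0 :
  0 : 1) and the points with j = 0 whose forms are x^2 + 1, x and x^2 - 2x - 1.\<close>

lemma F_eq_zero:
  fixes n m B j :: rat
  assumes "Fn n m B j = 0" "Fm n m B j = 0" "FB n m B j = 0"
  shows "(m = 0 \<and> B = 0 \<and> n*j = 0) \<or> (n = 0 \<and> j = 0 \<and> m*(m+B) = 0)"
proof (cases "m = 0 \<and> B = 0")
  case True
  then show ?thesis using assms(1) by (simp add: F_defs)
next
  case False
  have e: "n*m + B*(j-n) = 0" "n*m + B*n + j*m = 0" using assms by (simp_all add: F_defs)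
  have "(2*n^2 - j^2)*m = 0" "(2*n^2 - j^2)*B = 0" using e by algebra+
  then have "2*n^2 = j^2" using False by auto
  moreover from this have "n = 0" by (rule two_times_square_rat)
  ultimately show ?thesis using assms(1) by (simp add: F_defs)
qed

text \<open>The sum and the difference of the two values of \<open>Q1\<close> are \<open>Fn\<close>
  and \<open>Fm\<close>. If both vanish, the third square condition at the image reads e1^2 =
  -(FB^2), so the point lies in the kernel of \<open>F\<close>.\<close>

lemma Q1_not_both_zero:
  fixes n m B j :: rat
  assumes y: "ypoint n m B E d e" and E0: "E \<noteq> 0" and K: "kummer n m B j = 0"
    and Q: "Q1 n m B j = 0" "Q1 n (-m) (-B) j = 0"
  shows False
proof -
  note yc = ypointD[OF y]
  have n0: "n \<noteq> 0" by (rule ypoint_n_nonzero[OF y E0])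
  have F: "Fn n m B j = 0" "Fm n m B j = 0" using Q unfolding F_defs by algebra+
  define e1 where "e1 = Fm n m B j + (-4*j*m - FB n m B j) - 4*j*B"
  have "e1^2 = - ((FB n m B j)^2)"
  proof -
    have "e1^2 = 2*(Fn n m B j)^2 - (Fm n m B j + FB n m B j)^2"
      using ypoint_F(1)[OF K] unfolding ypoint_def e1_def by blast
    then show ?thesis using F by simp
  qed
  then have "e1^2 + (FB n m B j)^2 = 0" by simp
  then have "FB n m B j = 0" by (simp add: sum_power2_eq_zero_iff)
  then have "m = 0 \<and> B = 0" using F_eq_zero F n0 by blast
  then have "2*n^2 = e^2" using yc by simp
  then show False using two_times_square_rat n0 by blast
qed

text \<open>
  The two equations express that \<open>(b1 x + b0)^2\<close> is congruent to the right-hand side of the curve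
  modulo \<open>x^2 - s x + p\<close>.
\<close>

context
  fixes s p b0 b1 :: rat
  assumes eq1: "b1^2*s + 2*b0*b1 = - (s^4 - 3*s^2*p + p^2) + 2*(s^3 - 2*s*p) + 2*s + 1"
    and eq0: "b0^2 - b1^2*p = p*(s^3 - 2*s*p) - 2*p*(s^2 - p) - 2*p"
begin

text \<open>For distinct roots u1, u2 of x^2 - s*x + p and values v1, v2 of b1*x + b0 there, this is
  the classical Kummer coordinate (s + 4*p + 4*p^2 - s*p^2 - 2*v1*v2)/(u1 - u2)^2. Adding n = 1+p to
  it gives \<open>j\<close>.\<close>

definition "third_coord = b1^2 - 2 - 2*s^2 + s^3 - s*p"

lemma b_squares: "b1^2 = third_coord + 2 + 2*s^2 - s^3 + s*p"
  "2*(b0*b1) = - (s^4 - 3*s^2*p + p^2) + 2*(s^3 - 2*s*p) + 2*s + 1 - (third_coord + 2 + 2*s^2 - s^3 + s*p)*s"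
  "b0^2 = p*(s^3 - 2*s*p) - 2*p*(s^2 - p) - 2*p + (third_coord + 2 + 2*s^2 - s^3 + s*p)*p"
proof -
  show t: "b1^2 = third_coord + 2 + 2*s^2 - s^3 + s*p" by (simp add: third_coord_def)
  show "2*(b0*b1) = - (s^4 - 3*s^2*p + p^2) + 2*(s^3 - 2*s*p) + 2*s + 1 - (third_coord + 2 + 2*s^2 - s^3 + s*p)*s"
    using eq1 unfolding t by algebra
  show "b0^2 = p*(s^3 - 2*s*p) - 2*p*(s^2 - p) - 2*p + (third_coord + 2 + 2*s^2 - s^3 + s*p)*p"
    using eq0 unfolding t by algebra
qed

text \<open>The Kummer equation is the relation (b0*b1)^2 = b0^2*b1^2 after the three monomials have
  been expressed by \<open>s\<close>, \<open>p\<close> and \<open>third_coord\<close>.\<close>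

lemma kummer_start: "kummer (1+p) (1-p) (-s) (third_coord+1+p) = 0"
proof -
  have "(2*(b0*b1))^2 = 4*b0^2*b1^2" by algebra
  then show ?thesis unfolding b_squares kummer_def by algebra
qed

text \<open>Up to factors 2 and \<open>p\<close>, the square roots of \<open>Q1\<close> at the two
  images. They are odd in (b0, b1), that is under v -> -v, so they live on the Jacobian and not on
  the Kummer surface; this is why \<open>Q1\<close> detects the twist.\<close>

definition "root_Q1 = b1*(1+p^2) + b0*(third_coord+s*p)"
definition "root_Q1' = b0*(p*s^2-1-p^2+s*third_coord) + b1*(p*(s*p+third_coord))"

text \<open>
  A point of the surface and its image under \<open>(m, B) \<mapsto> (-m, -B)\<close> are both needed below, since
  one of the two values of \<open>Q1\<close> may vanish.
\<close>

lemma Q1_start: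
  defines "n \<equiv> 1+p" and "m \<equiv> 1-p" and "B \<equiv> -s" and "j \<equiv> third_coord+1+p"
  shows "Q1 (Fn n m B j) (Fm n m B j) (FB n m B j) (Fj n m B j) = (2*root_Q1)^2"
    "p^2 * Q1 (Fn n m B j) (-Fm n m B j) (-FB n m B j) (Fj n m B j) = (2*root_Q1')^2"
proof -
  have v: "(2*root_Q1)^2 = 4*b1^2*(1+p^2)^2 + 4*(2*(b0*b1))*((1+p^2)*(third_coord+s*p)) + 4*b0^2*(third_coord+s*p)^2"
    unfolding root_Q1_def by algebra
  have v': "(2*root_Q1')^2 = 4*b0^2*(p*s^2-1-p^2+s*third_coord)^2 + 4*(2*(b0*b1))*((p*s^2-1-p^2+s*third_coord)*(p*(s*p+third_coord))) + 4*b1^2*(p*(s*p+third_coord))^2"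
    unfolding root_Q1'_def by algebra
  show "Q1 (Fn n m B j) (Fm n m B j) (FB n m B j) (Fj n m B j) = (2*root_Q1)^2"
    unfolding v b_squares using kummer_start unfolding kummer_def F_defs n_def m_def B_def j_def by algebra
  show "p^2 * Q1 (Fn n m B j) (-Fm n m B j) (-FB n m B j) (Fj n m B j) = (2*root_Q1')^2"
    unfolding v' b_squares using kummer_start unfolding kummer_def F_defs n_def m_def B_def j_def by algebra
qed

text \<open>One application of \<open>F\<close> produces the squares required by
  \<open>ypoint\<close>, and \<open>Q1\<close> is a nonzero square at the image or at its image
  under \<sigma>. So \<open>no_descent_point\<close> applies unless the image is degenerate; what
  remains is to trace degenerate images back to forms x^2 - s*x + p that split, or to b0 = b1 =
  0.\<close>

lemma disc_square_or_b_zero: "(\<exists>r. s^2 - 4*p = r^2) \<or> (b0 = 0 \<and> b1 = 0)"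
proof (rule ccontr)
  assume neg: "\<not> ?thesis"
  define n m B j where "n = 1+p" and "m = 1-p" and "B = -s" and "j = third_coord+1+p"
  note xD = n_def m_def B_def j_def
  have K0: "kummer n m B j = 0" using kummer_start by (simp add: xD add.assoc)
  have p0: "p \<noteq> 0"
  proof
    assume "p = 0"
    then have "s^2 - 4*p = s^2" by simp
    then show False using neg by blast
  qed
  define N M b J where "N = Fn n m B j" and "M = Fm n m B j" and "b = FB n m B j" and "J = Fj n m B j"
  note x0 = N_def M_def b_def J_def
  define E d e where "E = -4*j*m - b" and "d = 4*j*n - N" and "e = M + E - 4*j*B"
  have y: "ypoint N M b E d e" and r: "J*(d^2-N^2) = N*b*(b-M) + E*d*e" and K2: "d^2-N^2 = 16*j*n*m*(m+B)"
    using ypoint_F[OF K0] by (simp_all only: x0 E_def d_def e_def)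
  have yc: "E^2 = N^2 - M^2" "d^2 = M^2 + b^2" "e^2 = 2*N^2 - (M+b)^2" using y by (auto simp: ypoint_def)
  have K: "kummer N M b J = 0" using kummer_F[OF K0] by (simp only: x0)
  have Kf: "kummer N (-M) (-b) J = 0" using K unfolding kummer_def by algebra
  have yf: "ypoint N (-M) (-b) E d e" using y unfolding ypoint_def by algebra
  have rf: "J*(d^2-N^2) = N*(-b)*((-b)-(-M)) + E*d*e" using r by algebra
  have Q: "Q1 N M b J = (2*root_Q1)^2" and Qf: "Q1 N (-M) (-b) J = (2*root_Q1'/p)^2"
    using Q1_start p0 by (simp_all add: x0 xD power_divide eq_divide_eq mult.commute)
  \<comment> \<open>For the kernel forms x^2 + 1 and x^2 - 2x - 1 the right-hand side of the curve
    vanishes at both roots, and so b0 = b1 = 0.\<close>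
  have not_F0: "\<not> (N = 0 \<and> M = 0 \<and> b = 0)"
  proof
    assume "N = 0 \<and> M = 0 \<and> b = 0"
    then have "(m = 0 \<and> B = 0 \<and> n*j = 0) \<or> (n = 0 \<and> j = 0 \<and> m*(m+B) = 0)"
      using F_eq_zero x0 by metis
    then consider "p = 1" "s = 0" | "p = -1" "s = 2" by (auto simp: xD)
    then show False
    proof cases
      case 1
      have "b0*b1 = 0" "b0^2 = b1^2" using eq1 eq0 1 by simp_all
      then show False using neg by auto
    next
      case 2
      have "b1*(b0+b1) = 0" "b0^2 + b1^2 = 0" using eq1 eq0 2 by (simp_all add: algebra_simps power2_eq_square)
      then show False using neg by (simp add: sum_power2_eq_zero_iff)
    qed
  qed
  have E0: "E \<noteq> 0"
  proof
    assume "E = 0"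
    then show False using degenerate_E[OF _ K Q] y not_F0 by simp
  qed
  have N0: "N \<noteq> 0" by (rule ypoint_n_nonzero[OF y E0])
  have root_Q1: "2*root_Q1 \<noteq> 0 \<or> 2*root_Q1'/p \<noteq> 0"
    using Q1_not_both_zero[OF y E0 K] Q Qf by auto
  have disc: "d^2 = N^2"
  proof (rule ccontr)
    assume a: "d^2 \<noteq> N^2"
    from root_Q1 have "descent_point N M b J \<or> descent_point N (-M) (-b) J"
      unfolding descent_point_def using y r yf rf E0 a Q Qf by blast
    then show False using no_descent_point by blast
  qed
  have nm: "N^2 \<noteq> M^2" "N^2 \<noteq> (-M)^2" using yc(1) E0 by auto
  have dd: "N^2 = M^2 + b^2" "N^2 = (-M)^2 + (-b)^2" using disc yc(2) by simp_all
  have z: "M = 0" "J = N" "b^2 = N^2"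
    using root_Q1 degenerate_disc[OF nm(1) dd(1) K Q] degenerate_disc[OF nm(2) dd(2) Kf Qf] by auto
  \<comment> \<open>The image is now (1 : 0 : 1 : 1) or (1 : 0 : -1 : 1), and the discriminant
    vanishes there. Each factor in turn yields a double root, roots 1 and -1, or p = 0.\<close>
  have "16*j*n*m*(m+B) = 0" using K2 disc by simp
  then consider "m = 0" | "n = 0" "m \<noteq> 0" | "m + B = 0" "m \<noteq> 0" "n \<noteq> 0" | "j = 0" "m \<noteq> 0" "n \<noteq> 0" by auto
  then show False
  proof cases
    case 1
    then have p1: "p = 1" "n = 2" by (simp_all add: xD)
    have "N = 4*j" "b = -4*B" "B*(j-2) = 0" using z(1) 1 p1 by (simp_all add: x0 F_defs)
    moreover from this have "B^2 = j^2" using z(3) by (simp add: power_mult_distrib)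
    ultimately have "j = 2" using N0 by auto
    then have "s^2 - 4*p = 0^2" using \<open>B^2 = j^2\<close> p1 by (simp add: xD)
    then show False using neg by blast
  next
    case 2
    then have p1: "p = -1" "m = 2" by (simp_all add: xD)
    have F: "N = -4*(2+B)" "b = -4*j" "B*j = 0" using z(1) 2 p1 by (simp_all add: x0 F_defs)
    have "j \<noteq> 0" using z(3) F(2) N0 by auto
    then have "s = 0" using F(3) by (simp add: xD)
    then have "s^2 - 4*p = 2^2" using p1 by simp
    then show False using neg by blast
  next
    case 3
    then have B: "B = -m" by simp
    have "m*(2*n-j) = 0" using z(1) B unfolding M_def Fm_def by algebra
    then have j: "j = 2*n" using 3 by simp
    have "N = 4*n^2" "b = -4*n*m" unfolding x0 F_defs j B by algebra+
    then have "16*n^2*(m^2-n^2) = 0" using z(3) by algebra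
    then have "m^2 = n^2" using 3 by simp
    then have "4*p = 0" by (simp add: xD power2_eq_square algebra_simps)
    then show False using p0 by simp
  next
    case 4
    have "n*(m-B) = 0" using z(1) 4(1) unfolding M_def Fm_def by algebra
    then have B: "B = m" using 4 by simp
    have "N = -4*m^2" "b = -4*n*m" unfolding x0 F_defs 4(1) B by algebra+
    then have "16*m^2*(m^2-n^2) = 0" using z(3) by algebra
    then have "m^2 = n^2" using 4 by simp
    then have "4*p = 0" by (simp add: xD power2_eq_square algebra_simps)
    then show False using p0 by simp
  qed
qed

end

section \<open>Quadratic fields\<close>

lemma is_subfield_closed:
  assumes "is_subfield K"
  shows "0 \<in> K" "1 \<in> K" "x \<in> K \<Longrightarrow> y \<in> K \<Longrightarrow> x + y \<in> K" "x \<in> K \<Longrightarrow> - x \<in> K"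
    "x \<in> K \<Longrightarrow> y \<in> K \<Longrightarrow> x * y \<in> K" "x \<in> K \<Longrightarrow> inverse x \<in> K"
    "x \<in> K \<Longrightarrow> y \<in> K \<Longrightarrow> x - y \<in> K" "x \<in> K \<Longrightarrow> y \<in> K \<Longrightarrow> x / y \<in> K" "x \<in> K \<Longrightarrow> x ^ i \<in> K"
proof -
  show c: "0 \<in> K" "1 \<in> K" "x \<in> K \<Longrightarrow> y \<in> K \<Longrightarrow> x + y \<in> K" "\<And>x. x \<in> K \<Longrightarrow> - x \<in> K"
    "\<And>x y. x \<in> K \<Longrightarrow> y \<in> K \<Longrightarrow> x * y \<in> K" "\<And>x. x \<in> K \<Longrightarrow> inverse x \<in> K" for x y
    using assms by (auto simp: is_subfield_def)
  show "x \<in> K \<Longrightarrow> y \<in> K \<Longrightarrow> x - y \<in> K" using c(3)[of x "-y"] c(4) by simp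
  show "x \<in> K \<Longrightarrow> y \<in> K \<Longrightarrow> x / y \<in> K" using c(5,6) by (simp add: divide_inverse)
  show "x \<in> K \<Longrightarrow> x ^ i \<in> K" by (induction i) (use c in auto)
qed

lemma is_subfield_of_nat: "is_subfield K \<Longrightarrow> of_nat i \<in> K"
  by (induction i) (auto simp: is_subfield_closed)

lemma is_subfield_of_rat: "is_subfield K \<Longrightarrow> of_rat q \<in> K"
proof -
  assume K: "is_subfield K"
  have i: "of_int z \<in> K" for z
    by (cases z rule: int_cases2) (use K in \<open>auto simp: is_subfield_closed is_subfield_of_nat\<close>)
  obtain a b where "q = of_int a / of_int b" by (metis rat_coprime_quotient)
  then show ?thesis using i K by (simp add: of_rat_divide is_subfield_closed)
qed

lemma quadratic_field_basis:
  fixes K :: "'a::field_char_0 set"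
  assumes "quadratic_field K"
    and u: "u \<in> K" "u \<notin> \<rat>" and v: "v \<in> K"
  shows "\<exists>a b. v = of_rat a * u + of_rat b"
proof -
  interpret vs: vector_space "rat_scale :: rat \<Rightarrow> 'a \<Rightarrow> 'a" by (rule vector_space_rat_scale)
  have K: "is_subfield K" "vs.dim K = 2" using assms(1) by (auto simp: quadratic_field_def)
  have sub: "vs.subspace K"
    by (rule vs.subspaceI) (use K(1) in \<open>auto simp: rat_scale_def is_subfield_closed is_subfield_of_rat\<close>)
  have sp1: "vs.span {1} = \<rat>"
    by (auto simp: vs.span_singleton rat_scale_def Rats_def)
  have ind: "vs.independent {u, 1}"
    using u(2) sp1 by (subst vs.independent_insert) auto
  have u1: "u \<noteq> 1" using u(2) by auto
  have "K \<subseteq> vs.span {u,1}"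
  proof -
    obtain b where b: "b \<subseteq> K" "vs.independent b" "K \<subseteq> vs.span b" "card b = vs.dim K"
      using vs.basis_exists by blast
    have fb: "finite b" using b(4) K(2) card.infinite by fastforce
    have sK: "vs.span b = K" using b sub vs.span_minimal by blast
    show ?thesis
    proof (rule ccontr)
      assume "\<not> ?thesis"
      then obtain w where w: "w \<in> K" "w \<notin> vs.span {u,1}" by blast
      then have "vs.independent (insert w {u,1})" using ind vs.independent_insertI by blast
      moreover have "insert w {u,1} \<subseteq> vs.span b" using sK w(1) u(1) K(1) by (auto simp: is_subfield_closed)
      ultimately have "card (insert w {u,1}) \<le> card b" using vs.independent_span_bound[OF fb] by blast
      moreover have "w \<notin> {u,1}" using w(2) vs.span_base by blast
      ultimately show False using b(4) K(2) u1 by simp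
    qed
  qed
  then have "v \<in> vs.span {u,1}" using v by blast
  then show "\<exists>a b. v = of_rat a * u + of_rat b"
    by (auto simp: vs.span_insert vs.span_singleton rat_scale_def) (metis add.commute diff_add_cancel)
qed

section \<open>Cycles of length four\<close>

text \<open>The period divides 4, and excluding 2 also excludes 1.\<close>

lemma has_exact_period_4_iff:
  "has_exact_period f 4 x \<longleftrightarrow> f (f (f (f x))) = x \<and> f (f x) \<noteq> x"
proof
  assume h: "has_exact_period f 4 x"
  have "(f ^^ 4) x = x" "(f ^^ 2) x \<noteq> x" using h unfolding has_exact_period_def by auto
  then show "f (f (f (f x))) = x \<and> f (f x) \<noteq> x" by (simp add: numeral_eq_Suc)
next
  assume h: "f (f (f (f x))) = x \<and> f (f x) \<noteq> x"
  have "(f ^^ n) x \<noteq> x" if n: "0 < n" "n < 4" for n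
  proof -
    have n': "n = 1 \<or> n = 2 \<or> n = 3" using n by auto
    have "f x \<noteq> x" using h by metis
    moreover have "f (f (f x)) \<noteq> x" using h by metis
    ultimately show ?thesis using n' h by (auto simp: numeral_eq_Suc)
  qed
  then show "has_exact_period f 4 x" using h by (simp add: has_exact_period_def numeral_eq_Suc)
qed

lemma quad_orbit_parametrized:
  fixes u v c \<alpha> :: "'a::field_char_0"
  assumes v: "v^2 = - u * (u^2 + 1) * (u^2 - 2*u - 1)" "v * (u+1) * (u-1) \<noteq> 0"
    and a: "\<alpha> = (u-1)/(2*(u+1)) + v/(2*u*(u-1))"
    and c: "c = (u^2 - 4*u - 1) * (u^4 + u^3 + 2*u^2 - u + 1) / (4*u*(u+1)^2*(u-1)^2)"
  shows "quad_map c \<alpha> = - (u+1)/(2*(u-1)) + v/(2*u*(u+1))"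
    "quad_map c (quad_map c \<alpha>) = (u-1)/(2*(u+1)) - v/(2*u*(u-1))"
    "quad_map c (quad_map c (quad_map c \<alpha>)) = - (u+1)/(2*(u-1)) - v/(2*u*(u+1))"
    "quad_map c (quad_map c (quad_map c (quad_map c \<alpha>))) = \<alpha>"
    "quad_map c (quad_map c \<alpha>) \<noteq> \<alpha>"
proof -
  have nz: "u \<noteq> 0" "u+1 \<noteq> 0" "u-1 \<noteq> 0" "v \<noteq> 0" using v by auto
  define D where "D = 2*u*(u+1)*(u-1)"
  have D0: "D \<noteq> 0" using nz by (simp add: D_def)
  define b a' b' where "b = - (u+1)/(2*(u-1)) + v/(2*u*(u+1))"
    and "a' = (u-1)/(2*(u+1)) - v/(2*u*(u-1))" and "b' = - (u+1)/(2*(u-1)) - v/(2*u*(u+1))"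
  have e: "D*\<alpha> = u*(u-1)^2 + v*(u+1)" "D*b = -(u*(u+1)^2) + v*(u-1)"
    "D*a' = u*(u-1)^2 - v*(u+1)" "D*b' = -(u*(u+1)^2) - v*(u-1)"
    unfolding a b_def a'_def b'_def D_def using nz by (simp_all add: divide_simps) algebra+
  have ec: "D^2*c = u*((u^2 - 4*u - 1) * (u^4 + u^3 + 2*u^2 - u + 1))"
    unfolding c D_def using nz by (simp add: divide_simps) algebra
  have D: "D = 2*u*(u+1)*(u-1)" by (rule D_def)
  have step: "quad_map c x = y" if "(D*x)^2 + D^2*c = D*(D*y)" for x y
  proof -
    have "D^2*(x^2+c) = D^2*y" using that by algebra
    then show ?thesis using D0 by (simp add: quad_map_def)
  qed
  have s: "quad_map c \<alpha> = b" "quad_map c b = a'" "quad_map c a' = b'" "quad_map c b' = \<alpha>"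
    by (rule step, unfold e ec, use v(1) D in algebra)+
  show "quad_map c \<alpha> = - (u+1)/(2*(u-1)) + v/(2*u*(u+1))"
    "quad_map c (quad_map c \<alpha>) = (u-1)/(2*(u+1)) - v/(2*u*(u-1))"
    "quad_map c (quad_map c (quad_map c \<alpha>)) = - (u+1)/(2*(u-1)) - v/(2*u*(u+1))"
    "quad_map c (quad_map c (quad_map c (quad_map c \<alpha>))) = \<alpha>"
    unfolding s by (simp_all only: b_def a'_def b'_def)
  have "D*\<alpha> - D*a' = 2*v*(u+1)" unfolding e by algebra
  then show "quad_map c (quad_map c \<alpha>) \<noteq> \<alpha>" using nz s by auto
qed

text \<open>Opposite points of the cycle are paired. With s = \<alpha> + x2, the differences satisfy
  x1 - x3 = s*(\<alpha> - x2) and x2 - \<alpha> = (x1 - x3)*(x1 + x3), so the two pair sums have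
  product -1. Eliminating \<open>c\<close> from the two sums of squares leaves one equation
  \<open>key\<close> between \<open>s\<close> and the half-difference \<open>q\<close>.\<close>

lemma quad_orbit_parametrization_exists:
  fixes c \<alpha> :: "'a::field_char_0"
  assumes K: "is_subfield K" "c \<in> K" "\<alpha> \<in> K" and per: "has_exact_period (quad_map c) 4 \<alpha>"
  shows "\<exists>u\<in>K. \<exists>v\<in>K. v^2 = - u * (u^2 + 1) * (u^2 - 2*u - 1) \<and> v * (u+1) * (u-1) \<noteq> 0
    \<and> \<alpha> = (u-1)/(2*(u+1)) + v/(2*u*(u-1))
    \<and> c = (u^2 - 4*u - 1) * (u^4 + u^3 + 2*u^2 - u + 1) / (4*u*(u+1)^2*(u-1)^2)"
proof -
  define x1 x2 x3 where "x1 = \<alpha>^2 + c" and "x2 = x1^2 + c" and "x3 = x2^2 + c"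
  have x0: "x3^2 + c = \<alpha>" and ne: "x2 \<noteq> \<alpha>"
    using per unfolding has_exact_period_4_iff by (simp_all add: quad_map_def x1_def x2_def x3_def)
  have xK: "x1 \<in> K" "x2 \<in> K" "x3 \<in> K" using K by (simp_all add: x1_def x2_def x3_def is_subfield_closed)
  define s q where "s = \<alpha> + x2" and "q = (\<alpha> - x2)/2"
  have q0: "q \<noteq> 0" using ne by (simp add: q_def)
  have aq: "\<alpha> = s/2 + q" "x2 = s/2 - q" by (simp_all add: s_def q_def field_simps)
  have e1: "x1 - x3 = s*(\<alpha> - x2)" by (simp add: x1_def x3_def s_def power2_eq_square algebra_simps)
  have "x2 - \<alpha> = x1^2 - x3^2" by (simp add: x2_def flip: x0)
  then have e2: "x2 - \<alpha> = (x1 - x3)*(x1 + x3)" by (simp add: power2_eq_square algebra_simps)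
  have "(\<alpha> - x2)*(s*(x1+x3) + 1) = 0" using e1 e2 by algebra
  then have s1: "s*(x1+x3) = -1" using ne by (simp add: eq_neg_iff_add_eq_0)
  then have s0: "s \<noteq> 0" by auto
  have e3: "s^2 + 4*q^2 + 4*c = 2*(x1+x3)"
  proof -
    have "\<alpha>^2 + x2^2 + 2*c = x1 + x3" by (simp add: x1_def x3_def)
    moreover have "2*q = \<alpha> - x2" by (simp add: q_def)
    then have "2*(\<alpha>^2 + x2^2) = s^2 + (2*q)^2" unfolding s_def by algebra
    ultimately show ?thesis by algebra
  qed
  have e4: "(x1+x3)^2 + 4*s^2*q^2 + 4*c = 2*s"
  proof -
    have "x1^2 + x3^2 + 2*c = s" by (simp add: x2_def s_def flip: x0)
    moreover have "(x1-x3)^2 = 4*s^2*q^2" unfolding e1 q_def by (simp add: power2_eq_square)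
    moreover have "(x1+x3)^2 + (x1-x3)^2 + 4*c = 2*(x1^2 + x3^2 + 2*c)" by algebra
    ultimately show ?thesis by (simp only:)
  qed
  have key: "4*q^2*s^2*(1-s^2) = (1+s^2)*(1-2*s-s^2)"
  proof -
    have "(s^2 - (x1+x3)^2 + 4*q^2*(1-s^2))*s^2 = (2*(x1+x3) - 2*s)*s^2" using e3 e4 by algebra
    then show ?thesis using s1 by algebra
  qed
  have sne: "s \<noteq> 1" "s \<noteq> -1" using key by auto
  then have sn: "1 - s \<noteq> 0" "1 + s \<noteq> 0" by (auto simp: add_eq_0_iff)
  \<comment> \<open>Dictated by \<alpha> = s/2 + q: the summand s/2 has to be (u-1)/(2(u+1)) and
    \<open>q\<close> has to be v/(2u(u-1)).\<close>
  define u v where "u = (1+s)/(1-s)" and "v = 2*q*u*(u-1)"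
  have us: "u*(1-s) = 1+s" "u+1 = 2/(1-s)" "u-1 = 2*s/(1-s)" using sn by (simp_all add: u_def field_simps)
  have nz: "u \<noteq> 0" "u+1 \<noteq> 0" "u-1 \<noteq> 0" "v \<noteq> 0" using sn s0 q0 us(2,3) by (auto simp: u_def v_def)
  have uK: "u \<in> K" "v \<in> K"
  proof -
    have "s \<in> K" "q \<in> K" using K xK is_subfield_of_nat[OF K(1), of 2] by (simp_all add: s_def q_def is_subfield_closed)
    then show "u \<in> K" using K by (simp add: u_def is_subfield_closed)
    then show "v \<in> K" using K \<open>q \<in> K\<close> is_subfield_of_nat[OF K(1), of 2] by (simp add: v_def is_subfield_closed)
  qed
  have su: "s*(u+1) = u-1" using us(1) by algebra
  have v2: "v^2 = - u * (u^2 + 1) * (u^2 - 2*u - 1)"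
  proof -
    have "(s*(u+1))^2*(4*q^2*s^2*(1-s^2))*(u+1)^2 = (s*(u+1))^2*((1+s^2)*(1-2*s-s^2))*(u+1)^2" using key by simp
    have "4*q^2*(u-1)^2*((u+1)^2-(u-1)^2) = ((u+1)^2+(u-1)^2)*((u+1)^2-2*(u-1)*(u+1)-(u-1)^2)"
      using key su by algebra
    then have "4*(v^2) = 4*(- u * (u^2 + 1) * (u^2 - 2*u - 1))" unfolding v_def by algebra
    then show ?thesis by simp
  qed
  have qv: "q = v/(2*u*(u-1))" using nz by (simp add: v_def)
  have "s = (u-1)/(u+1)" using su nz by (simp add: eq_divide_eq)
  then have "s/2 = (u-1)/(2*(u+1))" by simp
  then have av: "\<alpha> = (u-1)/(2*(u+1)) + v/(2*u*(u-1))" using aq(1) qv by metis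
  have "s*(s^2 + 4*q^2 + 4*c) = -2" using e3 s1 by algebra
  then have "(4*u*(u+1)^2*(u-1)^2) * c = (u^2 - 4*u - 1) * (u^4 + u^3 + 2*u^2 - u + 1)"
  proof -
    assume h: "s*(s^2 + 4*q^2 + 4*c) = -2"
    have q2: "4*q^2*(u*(u-1))^2 = - u * (u^2 + 1) * (u^2 - 2*u - 1)" using v2 unfolding v_def by algebra
    have h2: "(u-1)*((u-1)^2 + (u+1)^2*(4*q^2 + 4*c)) = -2*(u+1)^3" using h su by algebra
    have "u*((4*u*(u+1)^2*(u-1)^2) * c) = u*((u^2 - 4*u - 1) * (u^4 + u^3 + 2*u^2 - u + 1))"
      using h2 q2 by algebra
    then show ?thesis using nz by simp
  qed
  then have "c = (u^2 - 4*u - 1) * (u^4 + u^3 + 2*u^2 - u + 1) / (4*u*(u+1)^2*(u-1)^2)"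
    using nz by (simp add: eq_divide_eq mult.commute)
  then show ?thesis using uK v2 nz av by (intro bexI[of _ u] bexI[of _ v]) auto
qed

lemma curve_point_u_rational:
  fixes u v :: "'a::field_char_0"
  assumes Q: "quadratic_field K" and uv: "u \<in> K" "v \<in> K" and v: "v^2 = - u * (u^2 + 1) * (u^2 - 2*u - 1)" "v \<noteq> 0"
  shows "u \<in> \<rat>"
proof (rule ccontr)
  assume u: "u \<notin> \<rat>"
  have K: "is_subfield K" using Q by (simp add: quadratic_field_def)
  obtain s p' where u2: "u^2 = of_rat s * u + of_rat p'"
    using quadratic_field_basis[OF Q uv(1) u, of "u^2"] uv K is_subfield_closed(9) by blast
  obtain b1 b0 where vb: "v = of_rat b1 * u + of_rat b0"
    using quadratic_field_basis[OF Q uv(1) u uv(2)] by blast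
  define p where "p = - p'"
  have u2: "u^2 = of_rat s * u - of_rat p" using u2 by (simp add: p_def of_rat_minus)
  \<comment> \<open>The coefficients of \<open>u\<close> and 1 in the difference of the two sides of
    the curve equation, reduced by u^2 = s*u - p. Both vanish as \<open>u\<close> is
    irrational.\<close>
  define X Y where "X = b1^2*s + 2*b0*b1 - (- (s^4 - 3*s^2*p + p^2) + 2*(s^3 - 2*s*p) + 2*s + 1)"
    and "Y = b0^2 - b1^2*p - (p*(s^3 - 2*s*p) - 2*p*(s^2 - p) - 2*p)"
  have rX: "(of_rat X :: 'a) = (of_rat b1)^2*of_rat s + 2*of_rat b0*of_rat b1 - (- ((of_rat s)^4 - 3*(of_rat s)^2*of_rat p + (of_rat p)^2) + 2*((of_rat s)^3 - 2*of_rat s*of_rat p) + 2*of_rat s + 1)"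
    by (simp add: X_def of_rat_add of_rat_diff of_rat_mult of_rat_power of_rat_minus)
  have rY: "(of_rat Y :: 'a) = (of_rat b0)^2 - (of_rat b1)^2*of_rat p - (of_rat p*((of_rat s)^3 - 2*of_rat s*of_rat p) - 2*of_rat p*((of_rat s)^2 - of_rat p) - 2*of_rat p)"
    by (simp add: Y_def of_rat_add of_rat_diff of_rat_mult of_rat_power of_rat_minus)
  have XY: "of_rat X * u + of_rat Y = 0"
    unfolding rX rY using v(1) u2 vb by algebra
  have X0: "X = 0"
  proof (rule ccontr)
    assume "X \<noteq> 0"
    then have "u = of_rat (- Y / X)" using XY by (simp add: of_rat_divide of_rat_minus field_simps add_eq_0_iff)
    then show False using u by simp
  qed
  then have Y0: "Y = 0" using XY by simp
  have "(\<exists>r. s^2 - 4*p = r^2) \<or> (b0 = 0 \<and> b1 = 0)"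
    using disc_square_or_b_zero[of b1 s b0 p] X0 Y0 by (simp add: X_def Y_def)
  then show False
  proof
    assume "\<exists>r. s^2 - 4*p = r^2"
    then obtain r where r: "s^2 - 4*p = r^2" by blast
    have "(of_rat s :: 'a)^2 - 4 * of_rat p = (of_rat r)^2"
      using arg_cong[OF r, of "of_rat :: rat \<Rightarrow> 'a"] by (simp add: of_rat_diff of_rat_mult of_rat_power)
    then have "(2*u - of_rat s)^2 = (of_rat r)^2" using u2 by algebra
    then have "2*u - of_rat s = of_rat r \<or> 2*u - of_rat s = - of_rat r" by (simp add: power2_eq_iff)
    then have "u = of_rat ((s+r)/2) \<or> u = of_rat ((s-r)/2)"
      by (auto simp: of_rat_divide of_rat_add of_rat_diff field_simps)
    then show False using u by auto
  next
    assume "b0 = 0 \<and> b1 = 0"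
    then show False using vb v(2) by simp
  qed
qed

lemma curve_point_v_irrational:
  fixes u v :: "'a::field_char_0"
  assumes u: "u \<in> \<rat>" and v: "v^2 = - u * (u^2 + 1) * (u^2 - 2*u - 1)" "v * (u+1) * (u-1) \<noteq> 0"
  shows "v \<notin> \<rat>"
proof
  assume "v \<in> \<rat>"
  then obtain V where V: "v = of_rat V" by (auto simp: Rats_def)
  obtain U where U: "u = of_rat U" using u by (auto simp: Rats_def)
  have "of_rat (V^2) = (of_rat (- U * (U^2 + 1) * (U^2 - 2*U - 1)) :: 'a)"
    using v(1) unfolding U V by (simp add: of_rat_add of_rat_diff of_rat_mult of_rat_power of_rat_minus)
  then have "V^2 = - U * (U^2 + 1) * (U^2 - 2*U - 1)" by (simp only: of_rat_eq_iff)
  then have "U = 0 \<or> U = 1 \<or> U = -1" by (rule curve_rational_points)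
  then show False using v U by (auto simp: of_rat_minus)
qed

text \<open>In terms of t the value of \<open>c\<close> is (t^3 - 3t^2 - 16)/(4t^2), so equal values
  mean t = t' or (tt')^2 + 16(t+t') = 0. In the second case q = tt'/4 gives t + t' = -(q^2); since
  t^2 + 4 and t'^2 + 4 are squares of u + 1/u and u' + 1/u', their product yields the second
  curve.\<close>

lemma cycle_parameter_unique:
  fixes u u' :: rat
  assumes nz: "u \<noteq> 0" "u+1 \<noteq> 0" "u-1 \<noteq> 0" "u' \<noteq> 0" "u'+1 \<noteq> 0" "u'-1 \<noteq> 0"
    and eq: "(u^2 - 4*u - 1) * (u^4 + u^3 + 2*u^2 - u + 1) / (4*u*(u+1)^2*(u-1)^2)
      = (u'^2 - 4*u' - 1) * (u'^4 + u'^3 + 2*u'^2 - u' + 1) / (4*u'*(u'+1)^2*(u'-1)^2)"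
  shows "u' = u \<or> u' = -1/u"
proof -
  define t t' where "t = u - 1/u" and "t' = u' - 1/u'"
  have tu: "t*u = u^2 - 1" "t'*u' = u'^2 - 1" using nz by (simp_all add: t_def t'_def field_simps power2_eq_square)
  have t0: "t \<noteq> 0" "t' \<noteq> 0"
  proof -
    have "t*u = (u+1)*(u-1)" "t'*u' = (u'+1)*(u'-1)" using tu by algebra+
    then show "t \<noteq> 0" "t' \<noteq> 0" using nz by auto
  qed
  have form: "(x^2 - 4*x - 1) * (x^4 + x^3 + 2*x^2 - x + 1) / (4*x*(x+1)^2*(x-1)^2) = (y^3 - 3*y^2 - 16)/(4*y^2)"
    if "y*x = x^2 - 1" "x \<noteq> 0" "y \<noteq> 0" "x+1 \<noteq> 0" "x-1 \<noteq> 0" for x y :: rat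
  proof -
    have "((x^2 - 4*x - 1) * (x^4 + x^3 + 2*x^2 - x + 1))*(4*y^2)*x^2 = (y^3 - 3*y^2 - 16)*(4*x*(x+1)^2*(x-1)^2)*x^2"
      using that(1) by algebra
    then have "((x^2 - 4*x - 1) * (x^4 + x^3 + 2*x^2 - x + 1))*(4*y^2) = (y^3 - 3*y^2 - 16)*(4*x*(x+1)^2*(x-1)^2)"
      using that(2) by simp
    then show ?thesis using that by (simp add: frac_eq_eq)
  qed
  have "(t^3 - 3*t^2 - 16)/(4*t^2) = (t'^3 - 3*t'^2 - 16)/(4*t'^2)"
    using eq form[OF tu(1)] form[OF tu(2)] nz t0 by simp
  then have "(t^3 - 3*t^2 - 16)*(4*t'^2) = (t'^3 - 3*t'^2 - 16)*(4*t^2)" using t0 by (simp add: frac_eq_eq)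
  then have "4*((t - t')*((t*t')^2 + 16*(t+t'))) = 0" by algebra
  then have "t = t' \<or> (t*t')^2 + 16*(t+t') = 0" by simp
  then show ?thesis
  proof
    assume "t = t'"
    then have "t*u' = u'^2 - 1" using tu(2) by simp
    then have "(u' - u)*(u*u' + 1) = 0" using tu(1) by algebra
    then have "u' = u \<or> u*u' = -1" by (auto simp: add_eq_0_iff)
    then show ?thesis using nz by (auto simp: field_simps)
  next
    assume e: "(t*t')^2 + 16*(t+t') = 0"
    define q where "q = t*t'/4"
    define w where "w = (u+1/u)*(u'+1/u')/2"
    have r: "(u+1/u)^2 = t^2 + 4" "(u'+1/u')^2 = t'^2 + 4"
      using nz by (simp_all add: t_def t'_def power2_eq_square field_simps)
    have q4: "4*q = t*t'" by (simp add: q_def)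
    have s: "t+t' = -(q^2)" using e q4 by algebra
    have "4*w^2 = (u+1/u)^2*(u'+1/u')^2" by (simp add: w_def power_mult_distrib power_divide)
    also have "\<dots> = 4*(q^4 + 4*(q-1)^2)" unfolding r using q4 s by algebra
    finally have "w^2 = q^4 + 4*(q-1)^2" by simp
    then have "q = 0 \<or> q = 1" by (rule second_curve_rational_points)
    moreover have "q \<noteq> 0" using t0 by (simp add: q_def)
    ultimately have "q = 1" by blast
    \<comment> \<open>For q = 1 both t and t' are roots of x^2 + x + 4, which has negative
      discriminant.\<close>
    then have "(2*t+1)^2 + 15 = 0" using q4 s by algebra
    moreover have "(2*t+1)^2 \<ge> 0" by simp
    ultimately show ?thesis by linarith
  qed
qed

text \<open>The sign change in the basis v, 1 is multiplicative because v^2 is rational, and well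
  defined because v is irrational.\<close>

lemma conjugation_automorphism:
  fixes K :: "'a::field_char_0 set"
  assumes Q: "quadratic_field K" and v: "v \<in> K" "v \<notin> \<rat>" "v^2 \<in> \<rat>"
  obtains \<sigma> where "rat_automorphism K \<sigma>" "\<And>a b. \<sigma> (of_rat a * v + of_rat b) = - (of_rat a * v) + of_rat b"
proof -
  have K: "is_subfield K" using Q by (simp add: quadratic_field_def)
  obtain D where D: "v^2 = of_rat D" using v(3) by (auto simp: Rats_def)
  have uniq: "a = a' \<and> b = b'" if "of_rat a * v + of_rat b = of_rat a' * v + of_rat b'" for a b a' b'
  proof -
    have e: "of_rat (a-a') * v = of_rat (b'-b)" using that by (simp add: of_rat_diff algebra_simps)
    have "a = a'"
    proof (rule ccontr)
      assume "a \<noteq> a'"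
      then have "of_rat (a-a') \<noteq> (0::'a)" by simp
      then have "v = of_rat (b'-b) / of_rat (a-a')" using e by (simp add: eq_divide_eq mult.commute)
      then have "v = of_rat ((b'-b)/(a-a'))" by (simp only: of_rat_divide)
      then show False using v(2) by simp
    qed
    then show ?thesis using that by simp
  qed
  define \<sigma> where "\<sigma> x = (THE y. \<exists>a b. x = of_rat a * v + of_rat b \<and> y = - (of_rat a * v) + of_rat b)" for x
  have \<sigma>: "\<sigma> (of_rat a * v + of_rat b) = - (of_rat a * v) + of_rat b" for a b
    unfolding \<sigma>_def by (rule the_equality) (use uniq in blast)+
  have rep: "\<exists>a b. x = of_rat a * v + of_rat b" if "x \<in> K" for x
    using quadratic_field_basis[OF Q v(1,2) that] .
  have inK: "of_rat a * v + of_rat b \<in> K" "- (of_rat a * v) + of_rat b \<in> K" for a b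
    using K v(1) is_subfield_of_rat[OF K] by (simp_all add: is_subfield_closed)
  have inv: "\<sigma> x \<in> K \<and> \<sigma> (\<sigma> x) = x" if xK: "x \<in> K" for x
  proof -
    obtain a b where x: "x = of_rat a * v + of_rat b" using rep[OF xK] by blast
    have s: "\<sigma> x = of_rat (-a) * v + of_rat b" using \<sigma> x by (simp add: of_rat_minus)
    have "\<sigma> (\<sigma> x) = x" unfolding s \<sigma> by (simp add: x of_rat_minus)
    then show ?thesis using s inK by metis
  qed
  have "bij_betw \<sigma> K K" by (rule bij_betw_byWitness[of _ \<sigma>]) (use inv in auto)
  moreover have "\<sigma> (x + y) = \<sigma> x + \<sigma> y \<and> \<sigma> (x * y) = \<sigma> x * \<sigma> y" if xy: "x \<in> K" "y \<in> K" for x y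
  proof -
    obtain a b where x: "x = of_rat a * v + of_rat b" using rep[OF xy(1)] by blast
    obtain a' b' where y: "y = of_rat a' * v + of_rat b'" using rep[OF xy(2)] by blast
    have s: "x + y = of_rat (a+a') * v + of_rat (b+b')" unfolding x y by (simp add: of_rat_add algebra_simps)
    have m: "x * y = of_rat (a*b'+a'*b) * v + of_rat (a*a'*D + b*b')"
      unfolding x y of_rat_add of_rat_mult D[symmetric] by algebra
    have "\<sigma> (x+y) = \<sigma> x + \<sigma> y" unfolding s unfolding x y \<sigma> by (simp add: of_rat_add algebra_simps)
    moreover have "\<sigma> (x*y) = \<sigma> x * \<sigma> y" unfolding m \<sigma> unfolding x y \<sigma> of_rat_add of_rat_mult D[symmetric] by algebra
    ultimately show ?thesis by blast
  qed
  moreover have "\<sigma> q = q" if q: "q \<in> \<rat>" for q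
  proof -
    obtain r where "q = of_rat r" using q by (auto simp: Rats_def)
    then show ?thesis using \<sigma>[of 0 r] by simp
  qed
  ultimately have "rat_automorphism K \<sigma>" by (auto simp: rat_automorphism_def)
  then show thesis using that \<sigma> by blast
qed

theorem theorem4p12:
  fixes K :: "'a::field_char_0 set" and c :: 'a
  assumes "quadratic_field K" and "c \<in> K"
  shows
    "(\<forall>\<alpha>. \<alpha> \<in> K \<and> has_exact_period (quad_map c) 4 \<alpha> \<longleftrightarrow>
        (\<exists>u\<in>K. \<exists>v\<in>K.
           v ^ 2 = - u * (u ^ 2 + 1) * (u ^ 2 - 2 * u - 1) \<and>
           v * (u + 1) * (u - 1) \<noteq> 0 \<and>
           \<alpha> = (u - 1) / (2 * (u + 1)) + v / (2 * u * (u - 1)) \<and>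
           c = (u ^ 2 - 4 * u - 1) * (u ^ 4 + u ^ 3 + 2 * u ^ 2 - u + 1)
                 / (4 * u * (u + 1) ^ 2 * (u - 1) ^ 2))) \<and>
     (\<forall>\<alpha>. \<forall>u\<in>K. \<forall>v\<in>K.
        v ^ 2 = - u * (u ^ 2 + 1) * (u ^ 2 - 2 * u - 1) \<and>
        v * (u + 1) * (u - 1) \<noteq> 0 \<and>
        \<alpha> = (u - 1) / (2 * (u + 1)) + v / (2 * u * (u - 1)) \<and>
        c = (u ^ 2 - 4 * u - 1) * (u ^ 4 + u ^ 3 + 2 * u ^ 2 - u + 1)
              / (4 * u * (u + 1) ^ 2 * (u - 1) ^ 2) \<longrightarrow>
        card {x \<in> K. has_exact_period (quad_map c) 4 x} = 4 \<and>
        {x \<in> K. has_exact_period (quad_map c) 4 x} =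
          {\<alpha>, quad_map c \<alpha>, (quad_map c ^^ 2) \<alpha>, (quad_map c ^^ 3) \<alpha>} \<and>
        (quad_map c ^^ 4) \<alpha> = \<alpha> \<and>
        quad_map c \<alpha> = - (u + 1) / (2 * (u - 1)) + v / (2 * u * (u + 1)) \<and>
        (quad_map c ^^ 2) \<alpha> = (u - 1) / (2 * (u + 1)) - v / (2 * u * (u - 1)) \<and>
        (quad_map c ^^ 3) \<alpha> = - (u + 1) / (2 * (u - 1)) - v / (2 * u * (u + 1)) \<and>
        c \<in> \<rat> \<and>
        galois_conjugate K \<alpha> ((quad_map c ^^ 2) \<alpha>))"
proof -
  have K: "is_subfield K" using assms(1) by (simp add: quadratic_field_def)
  let ?f = "quad_map c"
  have fK: "?f x \<in> K" if "x \<in> K" for x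
    using that K assms(2) by (simp add: quad_map_def is_subfield_closed)
  have per_f: "has_exact_period ?f 4 (?f x)" if "has_exact_period ?f 4 x" for x
    using that unfolding has_exact_period_4_iff by metis
  have num: "2 \<in> K" "4 \<in> K"
    using is_subfield_of_nat[OF K, of 2] is_subfield_of_nat[OF K, of 4] by simp_all
  have point: "\<alpha> \<in> K \<and> has_exact_period ?f 4 \<alpha>"
    if uv: "u \<in> K" "v \<in> K" and v: "v ^ 2 = - u * (u ^ 2 + 1) * (u ^ 2 - 2 * u - 1)" "v * (u + 1) * (u - 1) \<noteq> 0"
      and a: "\<alpha> = (u - 1) / (2 * (u + 1)) + v / (2 * u * (u - 1))"
      and c: "c = (u ^ 2 - 4 * u - 1) * (u ^ 4 + u ^ 3 + 2 * u ^ 2 - u + 1) / (4 * u * (u + 1) ^ 2 * (u - 1) ^ 2)"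
    for \<alpha> u v
    using uv num K quad_orbit_parametrized(4,5)[OF v a c]
    by (simp add: a is_subfield_closed has_exact_period_4_iff)
  have iff: "\<alpha> \<in> K \<and> has_exact_period ?f 4 \<alpha> \<longleftrightarrow>
        (\<exists>u\<in>K. \<exists>v\<in>K.
           v ^ 2 = - u * (u ^ 2 + 1) * (u ^ 2 - 2 * u - 1) \<and>
           v * (u + 1) * (u - 1) \<noteq> 0 \<and>
           \<alpha> = (u - 1) / (2 * (u + 1)) + v / (2 * u * (u - 1)) \<and>
           c = (u ^ 2 - 4 * u - 1) * (u ^ 4 + u ^ 3 + 2 * u ^ 2 - u + 1)
                 / (4 * u * (u + 1) ^ 2 * (u - 1) ^ 2))" for \<alpha>
    using quad_orbit_parametrization_exists[OF K assms(2), of \<alpha>] point[of _ _ \<alpha>] by blast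
  show ?thesis
  proof (intro conjI allI ballI impI iff; (elim conjE)?)
    fix \<alpha> u v
    assume uK: "u \<in> K" and vK: "v \<in> K"
      and v: "v ^ 2 = - u * (u ^ 2 + 1) * (u ^ 2 - 2 * u - 1)" "v * (u + 1) * (u - 1) \<noteq> 0"
      and a: "\<alpha> = (u - 1) / (2 * (u + 1)) + v / (2 * u * (u - 1))"
      and c: "c = (u ^ 2 - 4 * u - 1) * (u ^ 4 + u ^ 3 + 2 * u ^ 2 - u + 1) / (4 * u * (u + 1) ^ 2 * (u - 1) ^ 2)"
    note orb = quad_orbit_parametrized[OF v a c]
    have nz: "u \<noteq> 0" "u + 1 \<noteq> 0" "u - 1 \<noteq> 0" "v \<noteq> 0" using v by auto
    have uQ: "u \<in> \<rat>" by (rule curve_point_u_rational[OF assms(1) uK vK v(1) nz(4)])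
    have vQ: "v \<notin> \<rat>" by (rule curve_point_v_irrational[OF uQ v])
    obtain U where U: "u = of_rat U" using uQ by (auto simp: Rats_def)
    have U0: "U \<noteq> 0" "U + 1 \<noteq> 0" "U - 1 \<noteq> 0"
      using nz by (auto simp: U eq_neg_iff_add_eq_0[symmetric] of_rat_minus)
    have pow: "(?f ^^ 2) \<alpha> = ?f (?f \<alpha>)" "(?f ^^ 3) \<alpha> = ?f (?f (?f \<alpha>))"
      "(?f ^^ 4) \<alpha> = ?f (?f (?f (?f \<alpha>)))"
      by (simp_all add: numeral_eq_Suc)
    show orbit: "(?f ^^ 4) \<alpha> = \<alpha>"
      "?f \<alpha> = - (u + 1) / (2 * (u - 1)) + v / (2 * u * (u + 1))"
      "(?f ^^ 2) \<alpha> = (u - 1) / (2 * (u + 1)) - v / (2 * u * (u - 1))"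
      "(?f ^^ 3) \<alpha> = - (u + 1) / (2 * (u - 1)) - v / (2 * u * (u + 1))"
      unfolding pow by (fact orb)+
    show "c \<in> \<rat>" unfolding c using uQ
      by (intro Rats_divide Rats_mult Rats_add Rats_diff Rats_power Rats_number_of Rats_1)
    have aK: "\<alpha> \<in> K" and aper: "has_exact_period ?f 4 \<alpha>"
      using point[OF uK vK v a c] by blast+
    have mem: "x \<in> {\<alpha>, ?f \<alpha>, (?f ^^ 2) \<alpha>, (?f ^^ 3) \<alpha>}"
      if x: "x \<in> K" "has_exact_period ?f 4 x" for x
    proof -
      obtain u' v' where uv': "u' \<in> K" "v' \<in> K"
        and v': "v' ^ 2 = - u' * (u' ^ 2 + 1) * (u' ^ 2 - 2 * u' - 1)" "v' * (u' + 1) * (u' - 1) \<noteq> 0"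
        and xe: "x = (u' - 1) / (2 * (u' + 1)) + v' / (2 * u' * (u' - 1))"
        and c': "c = (u' ^ 2 - 4 * u' - 1) * (u' ^ 4 + u' ^ 3 + 2 * u' ^ 2 - u' + 1)
           / (4 * u' * (u' + 1) ^ 2 * (u' - 1) ^ 2)"
        using x iff by blast
      have nz': "u' \<noteq> 0" "u' + 1 \<noteq> 0" "u' - 1 \<noteq> 0" "v' \<noteq> 0" using v' by auto
      have "u' \<in> \<rat>" by (rule curve_point_u_rational[OF assms(1) uv' v'(1) nz'(4)])
      then obtain U' where U': "u' = of_rat U'" by (auto simp: Rats_def)
      have U0': "U' \<noteq> 0" "U' + 1 \<noteq> 0" "U' - 1 \<noteq> 0"
        using nz' by (auto simp: U' eq_neg_iff_add_eq_0[symmetric] of_rat_minus)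
      have "of_rat ((U^2 - 4*U - 1) * (U^4 + U^3 + 2*U^2 - U + 1) / (4*U*(U+1)^2*(U-1)^2))
        = (of_rat ((U'^2 - 4*U' - 1) * (U'^4 + U'^3 + 2*U'^2 - U' + 1) / (4*U'*(U'+1)^2*(U'-1)^2)) :: 'a)"
        using c c' unfolding U U' by (simp add: of_rat_divide of_rat_mult of_rat_add of_rat_diff of_rat_power)
      then have "U' = U \<or> U' = -1/U"
        by (intro cycle_parameter_unique[OF U0 U0']) (simp only: of_rat_eq_iff)
      then consider "u' = u" | "u' = - 1/u"
        using U U' by (auto simp: of_rat_divide of_rat_minus)
      then show ?thesis
      proof cases
        case 1
        then have "v' = v \<or> v' = - v" using v(1) v'(1) by (simp flip: power2_eq_iff)
        then show ?thesis using xe 1 a orbit by auto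
      next
        case 2
        \<comment> \<open>Here (u', v') is \<sigma>(u, v) up to the sign of v', so x is the first or
          the third iterate of \<alpha>; for u' = u the sign chose between \<alpha> and the second
          iterate.\<close>
        then have uu: "u*u' = -1" using nz by simp
        have "(u^3*v')^2 = v^2" using v(1) v'(1) uu by algebra
        then have "u^3*v' = v \<or> u^3*v' = - v" by (simp add: power2_eq_iff)
        moreover have t: "(u' - 1) / (2 * (u' + 1)) = - (u + 1) / (2 * (u - 1))"
        proof -
          have "(u' - 1) * (2 * (u - 1)) = - (u + 1) * (2 * (u' + 1))" using uu by algebra
          then show ?thesis using nz nz'
            by (simp add: frac_eq_eq del: distrib_left_numeral right_diff_distrib_numeral)
        qed
        moreover have "v' / (2 * u' * (u' - 1)) = (u^3*v') / (2 * u * (u + 1))"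
        proof -
          have "v' * (2 * u * (u + 1)) = (u^3*v') * (2 * u' * (u' - 1))" using uu by algebra
          then show ?thesis using nz nz'
            by (simp add: frac_eq_eq del: distrib_left_numeral right_diff_distrib_numeral)
        qed
        ultimately show ?thesis using xe orbit by auto
      qed
    qed
    show eq: "{x \<in> K. has_exact_period ?f 4 x} = {\<alpha>, ?f \<alpha>, (?f ^^ 2) \<alpha>, (?f ^^ 3) \<alpha>}"
      using mem aK aper fK per_f unfolding pow by auto
    have "distinct [\<alpha>, ?f \<alpha>, ?f (?f \<alpha>), ?f (?f (?f \<alpha>))]"
      using orb(4,5) by (simp, metis)
    then have "card (set [\<alpha>, ?f \<alpha>, ?f (?f \<alpha>), ?f (?f (?f \<alpha>))]) = 4"
      by (subst distinct_card) simp_all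
    then show "card {x \<in> K. has_exact_period ?f 4 x} = 4"
      unfolding eq pow by simp
    have "v^2 \<in> \<rat>" unfolding v(1) using uQ
      by (intro Rats_mult Rats_add Rats_diff Rats_power Rats_minus_iff[THEN iffD2] Rats_number_of Rats_1)
    then obtain \<sigma> where \<sigma>: "rat_automorphism K \<sigma>"
      "\<And>a b. \<sigma> (of_rat a * v + of_rat b) = - (of_rat a * v) + of_rat b"
      using conjugation_automorphism[OF assms(1) vK vQ] by blast
    have coeff: "of_rat (1/(2*U*(U-1))) = 1/(2*u*(u-1))" "of_rat ((U-1)/(2*(U+1))) = (u-1)/(2*(u+1))"
      unfolding U by (simp_all add: of_rat_divide of_rat_mult of_rat_add of_rat_diff)
    have ae: "\<alpha> = of_rat (1/(2*U*(U-1))) * v + of_rat ((U-1)/(2*(U+1)))"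
      unfolding coeff by (subst a) simp
    have "\<sigma> \<alpha> = (?f ^^ 2) \<alpha>"
      unfolding orbit(3) by (subst ae, subst \<sigma>(2), unfold coeff) simp
    then show "galois_conjugate K \<alpha> ((?f ^^ 2) \<alpha>)"
      using aK fK \<sigma>(1) unfolding galois_conjugate_def pow by blast
  qed
qed

end
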